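(* Let $\psi_0$ be a two-sided Lévy process with paths of bounded variation satisfying Hypothesis A, and suppose that $0$ is regular for both $[0,\infty)$ and $(-\infty,0]$ for the process $(\psi_0(x))_{x\ge0}$. Then almost surely Lagrangian regular points exist.
   Context: A two-sided Lévy process $\psi_0=(\psi_0(x))_{x\in\mathbb{R}}$ has càdlàg paths, $\psi_0(0)=0$, and stationary independent increments indexed by $\mathbb{R}$; standing convention: bounded variation $\psi_0$ has zero drift coefficient. Hypothesis A: a.s. $\lim_{|x|\to\infty}x^{-2}\psi_0(x)=0$. $0$ is regular for a set $B$ if a.s. $\inf\{x>0:\psi_0(x)\in B\}=0$. For $x\in\mathbb{R}$, $a(x)$ is the largest maximizer of $y\mapsto\psi_0(y)\vee\psi_0(y-)-\tfrac12(y-x)^2$; $\mathcal{A}:=\overline{\{a(x):x\in\mathbb{R}\}}$. A Lagrangian regular point is a point of $\mathcal{A}$ that is isolated in $\mathcal{A}$ neither from the left nor from the right. *)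

theory Defs
  imports "HOL-Probability.Probability"
begin

(* left limit of a path f at y (meaningful when the left limit exists) *)
definition left_lim :: "(real \<Rightarrow> real) \<Rightarrow> real \<Rightarrow> real" where
  "left_lim f y = Lim (at_left y) f"

definition jump :: "(real \<Rightarrow> real) \<Rightarrow> real \<Rightarrow> real" where
  "jump f s = f s - left_lim f s"

definition cadlag :: "(real \<Rightarrow> real) \<Rightarrow> bool" where
  "cadlag f \<longleftrightarrow> (\<forall>x. (f \<longlongrightarrow> f x) (at_right x) \<and> (\<exists>l. (f \<longlongrightarrow> l) (at_left x)))"

definition bounded_variation :: "(real \<Rightarrow> real) \<Rightarrow> bool" where
  "bounded_variation f \<longleftrightarrow>
     (\<forall>a b. \<exists>B. \<forall>(n::nat) (t::nat \<Rightarrow> real).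
        (\<forall>i<n. t i \<le> t (Suc i)) \<and> a \<le> t 0 \<and> t n \<le> b \<longrightarrow>
        (\<Sum>i<n. \<bar>f (t (Suc i)) - f (t i)\<bar>) \<le> B)"

(* zero drift: a bounded variation path is the (absolutely convergent) sum of its jumps *)
definition pure_jump :: "(real \<Rightarrow> real) \<Rightarrow> bool" where
  "pure_jump f \<longleftrightarrow>
     (\<forall>x>0. (jump f has_sum f x) {0<..x}) \<and>
     (\<forall>x<0. (jump f has_sum (- f x)) {x<..0})"

definition two_sided_levy :: "'a measure \<Rightarrow> ('a \<Rightarrow> real \<Rightarrow> real) \<Rightarrow> bool" where
  "two_sided_levy M X \<longleftrightarrow>
     prob_space M \<and>
     (\<forall>x. (\<lambda>\<omega>. X \<omega> x) \<in> borel_measurable M) \<and>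
     (AE \<omega> in M. X \<omega> 0 = 0) \<and>
     (AE \<omega> in M. cadlag (X \<omega>)) \<and>
     (\<forall>t h. distr M borel (\<lambda>\<omega>. X \<omega> (t + h) - X \<omega> t) = distr M borel (\<lambda>\<omega>. X \<omega> h)) \<and>
     (\<forall>t::nat \<Rightarrow> real. strict_mono t \<longrightarrow>
        prob_space.indep_vars M (\<lambda>_. borel) (\<lambda>i \<omega>. X \<omega> (t (Suc i)) - X \<omega> (t i)) UNIV)"

definition hypothesis_A :: "'a measure \<Rightarrow> ('a \<Rightarrow> real \<Rightarrow> real) \<Rightarrow> bool" where
  "hypothesis_A M X \<longleftrightarrow> (AE \<omega> in M. ((\<lambda>x. X \<omega> x / x\<^sup>2) \<longlongrightarrow> 0) at_infinity)"

definition regular_for :: "'a measure \<Rightarrow> ('a \<Rightarrow> real \<Rightarrow> real) \<Rightarrow> real set \<Rightarrow> bool" where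
  "regular_for M X B \<longleftrightarrow> (AE \<omega> in M. \<forall>\<epsilon>>0. \<exists>x. 0 < x \<and> x < \<epsilon> \<and> X \<omega> x \<in> B)"

definition lag_obj :: "(real \<Rightarrow> real) \<Rightarrow> real \<Rightarrow> real \<Rightarrow> real" where
  "lag_obj f x y = max (f y) (left_lim f y) - (y - x)\<^sup>2 / 2"

definition lag_a :: "(real \<Rightarrow> real) \<Rightarrow> real \<Rightarrow> real" where
  "lag_a f x = (GREATEST y. \<forall>z. lag_obj f x z \<le> lag_obj f x y)"

definition lag_A :: "(real \<Rightarrow> real) \<Rightarrow> real set" where
  "lag_A f = closure (range (lag_a f))"

definition lagrangian_regular_point :: "(real \<Rightarrow> real) \<Rightarrow> real \<Rightarrow> bool" where
  "lagrangian_regular_point f p \<longleftrightarrow>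
     p \<in> lag_A f \<and> p islimpt (lag_A f \<inter> {..<p}) \<and> p islimpt (lag_A f \<inter> {p<..})"

end

(* Zero drift makes linear drifts invisible at small scales: for d > 0 the records of X(t) - d t on
   dyadic grids have bounded expected number, uniformly in the grid. Hence a point that is steep on its
   left is found, up to small errors, at one of boundedly many stopping times, after which the path is
   fresh; so almost surely no point that is steep on one side is a local maximum on the other side,
   provided 0 is regular for both open half-lines. If this fails, regularity for the closed half-lines
   forces the paths to be flat near 0 with positive probability.

   Independent blocks produce, almost surely, a place where the path sits below a suitable pair of
   half-parabolas on both sides. In the flat case the map a is the identity on an interval there. In the
   other case the maximiser p of the path over the gap between the parabolas satisfies a(p) = p, and
   p being steep on neither side means that a(x) differs from p for all other x while a(x) tends to p
   as x tends to p; so p is accumulated by points of the Lagrangian set on both sides. *)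

theory Submission
  imports Defs
begin

section \<open>Independent sequences and their records\<close>

text \<open>The obstacle: the points to be excluded are random, uncountably many and no stopping
  times, and the event that one exists need not be measurable. Starting the path at a rational just
  behind such a point removes the uncountability; working on grids and letting the mesh shrink
  removes the rest. A union bound over the records then costs at most the inverse of the probability
  of not climbing above slope \<open>\<delta>\<close> in a short window, while the probability of
  not climbing after a record tends to 0 with the tolerance. That inverse must be bounded uniformly
  in the mesh. By stationarity the probability in question is an average over starting points in
  [0, 1], and a maximal inequality bounds the bad starting points of each path: all but finitely
  many jumps have arbitrarily small total size, and there is no drift to add to them. Left sides
  need no theory of their own. An i.i.d. sequence does not see the order in which grid cells are
  read, so the path read leftwards from a fixed point has, as a function of the distance, the law of
  \<open>- X\<close>.\<close>

abbreviation SB :: "(nat \<Rightarrow> real) measure" where "SB \<equiv> PiM UNIV (\<lambda>_. borel)"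

definition psum :: "(nat \<Rightarrow> real) \<Rightarrow> nat \<Rightarrow> real" where "psum \<xi> k = (\<Sum>i<k. \<xi> i)"

definition shift_seq :: "nat \<Rightarrow> (nat \<Rightarrow> real) \<Rightarrow> nat \<Rightarrow> real" where "shift_seq k \<xi> = (\<lambda>i. \<xi> (k + i))"

text \<open>For measurable \<open>P\<close> this is adaptedness at time \<open>k\<close>. Phrased as
  invariance under changes of later steps, it needs no filtration.\<close>

definition depends_on :: "nat \<Rightarrow> ((nat \<Rightarrow> real) \<Rightarrow> bool) \<Rightarrow> bool" where
  "depends_on k P \<longleftrightarrow> (\<forall>\<xi> \<xi>'. (\<forall>i<k. \<xi> i = \<xi>' i) \<longrightarrow> P \<xi> = P \<xi>')"

lemma measurable_psum [measurable]: "(\<lambda>\<xi>. psum \<xi> k) \<in> borel_measurable SB"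
  unfolding psum_def by measurable

lemma measurable_shift [measurable]: "shift_seq k \<in> measurable SB SB"
  unfolding shift_seq_def by (rule measurable_PiM_single') auto

lemma psum_0 [simp]: "psum \<xi> 0 = 0"
  by (simp add: psum_def)

lemma psum_shift: "psum (shift_seq k \<xi>) i = psum \<xi> (k + i) - psum \<xi> k"
  by (induction i) (auto simp: psum_def shift_seq_def)

lemma psum_cong: "(\<And>i. i < k \<Longrightarrow> \<xi> i = \<xi>' i) \<Longrightarrow> psum \<xi> k = psum \<xi>' k"
  by (simp add: psum_def)

lemma depends_on_psum:
  assumes "\<And>\<xi> \<xi>'. (\<And>i. i \<le> k \<Longrightarrow> psum \<xi> i = psum \<xi>' i) \<Longrightarrow> P \<xi> = P \<xi>'"
  shows "depends_on k P"
  unfolding depends_on_def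
proof (intro allI impI)
  fix \<xi> \<xi>' :: "nat \<Rightarrow> real" assume *: "\<forall>i<k. \<xi> i = \<xi>' i"
  show "P \<xi> = P \<xi>'" by (rule assms, rule psum_cong) (use * in auto)
qed

text \<open>Index 0 is always a record, so the first maximum over an initial stretch is a record
  even if the walk never rises.\<close>

definition strict_record :: "real \<Rightarrow> nat \<Rightarrow> (nat \<Rightarrow> real) \<Rightarrow> bool" where
  "strict_record d k \<xi> \<longleftrightarrow> (\<forall>i<k. psum \<xi> i - d * i < psum \<xi> k - d * k)"

lemma pred_record [measurable]: "Measurable.pred SB (strict_record d k)"
  unfolding strict_record_def by measurable

lemma depends_on_record: "depends_on k (strict_record d k)"
  by (rule depends_on_psum) (simp add: strict_record_def)

locale iid_seq =
  fixes N :: "real measure"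
  assumes prob_N: "prob_space N" and sets_N [measurable_cong]: "sets N = sets borel"
begin

definition S :: "(nat \<Rightarrow> real) measure" where "S = PiM UNIV (\<lambda>_. N)"

lemma sets_S [measurable_cong]: "sets S = sets SB"
  unfolding S_def by (rule sets_PiM_cong) (auto simp: sets_N)

lemma space_S [simp]: "space S = UNIV"
  using sets_eq_imp_space_eq[OF sets_S] by (simp add: space_PiM)

sublocale N: prob_space N by (rule prob_N)
sublocale seq: sequence_space N ..

lemma prob_S: "prob_space S"
  unfolding S_def by (rule prob_space_PiM) (rule prob_N)

sublocale S: prob_space S by (rule prob_S)

lemma sets_SI: "Measurable.pred SB P \<Longrightarrow> {\<xi>. P \<xi>} \<in> sets S"
proof -
  assume "Measurable.pred SB P"
  then have "{\<xi> \<in> space SB. P \<xi>} \<in> sets SB" by measurable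
  then show ?thesis by (simp add: sets_S space_PiM)
qed

text \<open>The Markov property at a fixed time: \<open>comb_seq k\<close> glues the first
  \<open>k\<close> entries of one sequence to an independent second one and preserves the i.i.d.
  law.\<close>

lemma prob_split:
  assumes A: "Measurable.pred SB A" "depends_on k A" and B: "Measurable.pred SB B"
  shows "S.prob {\<xi>. A \<xi> \<and> B (shift_seq k \<xi>)} = S.prob {\<xi>. A \<xi>} * S.prob {\<xi>. B \<xi>}"
proof -
  let ?c = "\<lambda>(\<omega>, \<omega>'). comb_seq k \<omega> \<omega>'"
  have c: "?c \<in> measurable (S \<Otimes>\<^sub>M S) S"
    unfolding S_def by measurable
  have d: "distr (S \<Otimes>\<^sub>M S) S ?c = S"
    unfolding S_def by (rule seq.PiM_comb_seq)
  have AB: "{\<xi>. A \<xi> \<and> B (shift_seq k \<xi>)} \<in> sets S"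
    by (rule sets_SI) (use A B in measurable)
  have 1: "A (comb_seq k a b) = A a" for a b
    using A(2) unfolding depends_on_def by (auto simp: comb_seq_def)
  have 2: "shift_seq k (comb_seq k a b) = b" for a b
    by (auto simp: comb_seq_def shift_seq_def)
  have "emeasure S {\<xi>. A \<xi> \<and> B (shift_seq k \<xi>)} = emeasure (distr (S \<Otimes>\<^sub>M S) S ?c) {\<xi>. A \<xi> \<and> B (shift_seq k \<xi>)}"
    by (simp only: d)
  also have "\<dots> = emeasure (S \<Otimes>\<^sub>M S) ({\<xi>. A \<xi>} \<times> {\<xi>. B \<xi>})"
    by (subst emeasure_distr[OF c AB], rule arg_cong[where f="emeasure _"])
       (auto simp: space_pair_measure 1 2)
  also have "\<dots> = emeasure S {\<xi>. A \<xi>} * emeasure S {\<xi>. B \<xi>}"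
    by (rule S.emeasure_pair_measure_Times) (auto intro!: sets_SI A B)
  finally show ?thesis
    by (simp add: S.emeasure_eq_measure ennreal_mult[symmetric])
qed

text \<open>Stands in for the strong Markov property: a random time is replaced by all its possible
  values, and the union bound costs the expected number of indices satisfying
  \<open>A\<close>.\<close>

lemma prob_ex_split_le:
  assumes "finite I" and A: "\<And>k. k \<in> I \<Longrightarrow> Measurable.pred SB (A k)" "\<And>k. k \<in> I \<Longrightarrow> depends_on k (A k)"
    and B: "Measurable.pred SB B"
  shows "S.prob {\<xi>. \<exists>k\<in>I. A k \<xi> \<and> B (shift_seq k \<xi>)} \<le> (\<Sum>k\<in>I. S.prob {\<xi>. A k \<xi>}) * S.prob {\<xi>. B \<xi>}"
proof -
  have *: "{\<xi>. A k \<xi> \<and> B (shift_seq k \<xi>)} \<in> sets S" if "k \<in> I" for k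
    by (rule sets_SI) (use A(1)[OF that] B in measurable)
  have "S.prob {\<xi>. \<exists>k\<in>I. A k \<xi> \<and> B (shift_seq k \<xi>)} = S.prob (\<Union>k\<in>I. {\<xi>. A k \<xi> \<and> B (shift_seq k \<xi>)})"
    by (rule arg_cong[where f=S.prob]) auto
  also have "\<dots> \<le> (\<Sum>k\<in>I. S.prob {\<xi>. A k \<xi> \<and> B (shift_seq k \<xi>)})"
    by (rule S.finite_measure_subadditive_finite) (use * \<open>finite I\<close> in auto)
  also have "\<dots> = (\<Sum>k\<in>I. S.prob {\<xi>. A k \<xi>}) * S.prob {\<xi>. B \<xi>}"
    by (simp add: sum_distrib_right prob_split A B)
  finally show ?thesis .
qed

text \<open>A last-exit decomposition: \<open>B\<close> after time \<open>k\<close> excludes every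
  later index, so the joint events are disjoint, and by independence their probabilities are
  products.\<close>

lemma sum_prob_split_le_1:
  assumes "finite I" and A: "\<And>k. k \<in> I \<Longrightarrow> Measurable.pred SB (A k)" "\<And>k. k \<in> I \<Longrightarrow> depends_on k (A k)"
    and B: "Measurable.pred SB B"
    and disj: "\<And>\<xi> k l. k \<in> I \<Longrightarrow> l \<in> I \<Longrightarrow> k < l \<Longrightarrow> A k \<xi> \<Longrightarrow> B (shift_seq k \<xi>) \<Longrightarrow> A l \<xi> \<Longrightarrow> False"
  shows "(\<Sum>k\<in>I. S.prob {\<xi>. A k \<xi>}) * S.prob {\<xi>. B \<xi>} \<le> 1"
proof -
  have *: "{\<xi>. A k \<xi> \<and> B (shift_seq k \<xi>)} \<in> sets S" if "k \<in> I" for k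
    by (rule sets_SI) (use A(1)[OF that] B in measurable)
  have "(\<Sum>k\<in>I. S.prob {\<xi>. A k \<xi>}) * S.prob {\<xi>. B \<xi>} = (\<Sum>k\<in>I. S.prob {\<xi>. A k \<xi> \<and> B (shift_seq k \<xi>)})"
    by (simp add: sum_distrib_right prob_split A B)
  also have "\<dots> = S.prob (\<Union>k\<in>I. {\<xi>. A k \<xi> \<and> B (shift_seq k \<xi>)})"
  proof (rule S.finite_measure_finite_Union[symmetric])
    show "disjoint_family_on (\<lambda>k. {\<xi>. A k \<xi> \<and> B (shift_seq k \<xi>)}) I"
    proof (unfold disjoint_family_on_def, intro ballI impI)
      fix k l assume "k \<in> I" "l \<in> I" "k \<noteq> l"
      then show "{\<xi>. A k \<xi> \<and> B (shift_seq k \<xi>)} \<inter> {\<xi>. A l \<xi> \<and> B (shift_seq l \<xi>)} = {}"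
        by (cases k l rule: linorder_cases) (blast dest: disj)+
    qed
  qed (use * \<open>finite I\<close> in auto)
  also have "\<dots> \<le> 1" by (rule S.prob_le_1)
  finally show ?thesis .
qed

text \<open>The last strict record is followed by no further one, so the expected number of records
  is at most the inverse of the probability of never exceeding the starting level.\<close>

lemma sum_prob_record:
  "(\<Sum>k\<le>K. S.prob {\<xi>. strict_record d k \<xi>}) * S.prob {\<xi>. \<forall>i\<le>K. psum \<xi> i \<le> d * i} \<le> 1"
proof (rule sum_prob_split_le_1)
  fix \<xi> :: "nat \<Rightarrow> real" and k l assume kl: "k \<in> {..K}" "l \<in> {..K}" "k < l"
    and r: "\<forall>i\<le>K. psum (shift_seq k \<xi>) i \<le> d * i" and l: "strict_record d l \<xi>"
  have "psum (shift_seq k \<xi>) (l - k) \<le> d * (l - k)" using r kl by (metis atMost_iff diff_le_self le_trans)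
  then have "psum \<xi> l - psum \<xi> k \<le> d * (real l - real k)" using kl by (simp add: psum_shift of_nat_diff)
  moreover have "psum \<xi> k - d * k < psum \<xi> l - d * l" using l kl unfolding strict_record_def by auto
  ultimately show False by (simp add: algebra_simps)
qed (use depends_on_record in \<open>simp_all add: pred_record\<close>)

text \<open>The union bound over records, combined with the bound on their expected number; the
  factor stays on the left to avoid dividing by a probability.\<close>

lemma prob_ex_record_le:
  assumes "Measurable.pred SB B"
  shows "S.prob {\<xi>. \<exists>k\<le>K. strict_record d k \<xi> \<and> B (shift_seq k \<xi>)} * S.prob {\<xi>. \<forall>i\<le>K. psum \<xi> i \<le> d * i} \<le> S.prob {\<xi>. B \<xi>}"
proof -
  have "S.prob {\<xi>. \<exists>k\<in>{..K}. strict_record d k \<xi> \<and> B (shift_seq k \<xi>)} * S.prob {\<xi>. \<forall>i\<le>K. psum \<xi> i \<le> d * i}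
    \<le> ((\<Sum>k\<le>K. S.prob {\<xi>. strict_record d k \<xi>}) * S.prob {\<xi>. B \<xi>}) * S.prob {\<xi>. \<forall>i\<le>K. psum \<xi> i \<le> d * i}"
    by (intro mult_right_mono prob_ex_split_le) (auto intro: depends_on_record assms)
  also have "\<dots> = ((\<Sum>k\<le>K. S.prob {\<xi>. strict_record d k \<xi>}) * S.prob {\<xi>. \<forall>i\<le>K. psum \<xi> i \<le> d * i}) * S.prob {\<xi>. B \<xi>}"
    by simp
  also have "\<dots> \<le> 1 * S.prob {\<xi>. B \<xi>}"
    by (intro mult_right_mono sum_prob_record) auto
  finally show ?thesis by (simp only: Bex_def atMost_iff mult_1)
qed

end

section \<open>Increments on dyadic grids\<close>

text \<open>Independence of increments is given along increasing times only; this transfers it to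
  sequences reading the same cells in another order.\<close>

lemma (in prob_space) indep_sets_reindex:
  assumes F: "indep_sets F I" and s: "inj_on s J" "s ` J \<subseteq> I"
  shows "indep_sets (\<lambda>j. F (s j)) J"
  unfolding indep_sets_def
proof (intro conjI ballI allI impI)
  fix i assume "i \<in> J" then show "F (s i) \<subseteq> events"
    using F s unfolding indep_sets_def by blast
next
  fix K A assume K: "K \<subseteq> J" "K \<noteq> {}" "finite K" and A: "A \<in> Pi K (\<lambda>j. F (s j))"
  have inj: "inj_on s K" using s K inj_on_subset by blast
  define A' where "A' = (\<lambda>i. A (the_inv_into K s i))"
  have A': "A' (s j) = A j" if "j \<in> K" for j
    unfolding A'_def using that inj by (simp add: the_inv_into_f_f)
  have "prob (\<Inter>i\<in>s ` K. A' i) = (\<Prod>i\<in>s ` K. prob (A' i))"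
    by (rule indep_setsD[OF F]) (use K s A A' in auto)
  moreover have "(\<Inter>i\<in>s ` K. A' i) = (\<Inter>j\<in>K. A j)" using A' by auto
  moreover have "(\<Prod>i\<in>s ` K. prob (A' i)) = (\<Prod>j\<in>K. prob (A j))"
    using inj A' by (simp add: prod.reindex)
  ultimately show "prob (\<Inter>j\<in>K. A j) = (\<Prod>j\<in>K. prob (A j))" by simp
qed

lemma (in prob_space) prob_liminf_le:
  fixes A :: "nat \<Rightarrow> 'a set"
  assumes "\<And>n. A n \<in> events" and "\<And>n. n \<ge> n0 \<Longrightarrow> prob (A n) \<le> c"
  shows "(\<Union>k. \<Inter>n\<in>{k..}. A n) \<in> events" "prob (\<Union>k. \<Inter>n\<in>{k..}. A n) \<le> c"
proof -
  have s: "(\<Inter>n\<in>{k..}. A n) \<in> events" for k :: nat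
    by (rule sets.countable_INT') (use assms in auto)
  then show "(\<Union>k. \<Inter>n\<in>{k..}. A n) \<in> events" by auto
  have "(\<lambda>k. prob (\<Inter>n\<in>{k..}. A n)) \<longlonglongrightarrow> prob (\<Union>k. \<Inter>n\<in>{k..}. A n)"
    by (rule finite_Lim_measure_incseq) (use s in \<open>auto simp: incseq_def\<close>)
  moreover have "prob (\<Inter>n\<in>{k..}. A n) \<le> c" for k
  proof -
    have "prob (\<Inter>n\<in>{k..}. A n) \<le> prob (A (max k n0))"
      by (rule finite_measure_mono) (use assms in auto)
    also have "\<dots> \<le> c" by (rule assms) auto
    finally show ?thesis .
  qed
  ultimately show "prob (\<Union>k. \<Inter>n\<in>{k..}. A n) \<le> c"
    by (intro LIMSEQ_le_const2) auto
qed

text \<open>\<open>P\<close> need not be measurable. Its failure only has to force membership in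
  \<open>A n\<close> for all large \<open>n\<close>; the liminf of these events is an event of
  probability at most \<open>e\<close>, and \<open>e\<close> is arbitrary.\<close>

lemma (in prob_space) AE_liminfI:
  assumes "\<And>e::real. e > 0 \<Longrightarrow> \<exists>A (n0::nat). (\<forall>n. A n \<in> events) \<and> (\<forall>n\<ge>n0. prob (A n) \<le> e) \<and>
      (AE \<omega> in M. \<not> P \<omega> \<longrightarrow> (\<exists>k. \<forall>n\<ge>k. \<omega> \<in> A n))"
  shows "AE \<omega> in M. P \<omega>"
proof -
  have "\<exists>B\<in>events. prob B \<le> 1 / Suc n \<and> (AE \<omega> in M. \<not> P \<omega> \<longrightarrow> \<omega> \<in> B)" for n :: nat
  proof -
    have pos: "0 < 1 / real (Suc n)" by simp
    obtain A and n0 :: nat where A: "\<forall>n. A n \<in> events" "\<forall>m\<ge>n0. prob (A m) \<le> 1 / Suc n"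
      "AE \<omega> in M. \<not> P \<omega> \<longrightarrow> (\<exists>k. \<forall>n\<ge>k. \<omega> \<in> A n)"
      using assms[OF pos] by blast
    have "AE \<omega> in M. \<not> P \<omega> \<longrightarrow> \<omega> \<in> (\<Union>k. \<Inter>n\<in>{k..}. A n)"
      using A(3) by eventually_elim auto
    moreover have "(\<Union>k. \<Inter>n\<in>{k..}. A n) \<in> events" "prob (\<Union>k. \<Inter>n\<in>{k..}. A n) \<le> 1 / Suc n"
      using prob_liminf_le[of A n0 "1 / Suc n"] A(1,2) by auto
    ultimately show ?thesis by blast
  qed
  then obtain B where B: "\<And>n. B n \<in> events" "\<And>n::nat. prob (B n) \<le> 1 / Suc n"
    "\<And>n. AE \<omega> in M. \<not> P \<omega> \<longrightarrow> \<omega> \<in> B n"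
    by metis
  have "prob (\<Inter>n. B n) \<le> 1 / Suc n" for n
    by (rule order_trans[OF finite_measure_mono B(2)[of n]]) (use B in auto)
  then have "prob (\<Inter>n. B n) \<le> 0"
    by (intro LIMSEQ_le_const[OF LIMSEQ_inverse_real_of_nat]) (auto simp: inverse_eq_divide)
  then have "prob (\<Inter>n. B n) = 0" by (simp add: measure_le_0_iff)
  then have "AE \<omega> in M. \<omega> \<notin> (\<Inter>n. B n)"
    using B(1) by (intro AE_not_in null_setsI) (auto simp: emeasure_eq_measure)
  moreover have "AE \<omega> in M. \<forall>n. \<not> P \<omega> \<longrightarrow> \<omega> \<in> B n"
    using B(3) unfolding AE_all_countable by blast
  ultimately show ?thesis by eventually_elim auto
qed

text \<open>The cell number is an integer so that cells on both sides of \<open>t\<close> can be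
  enumerated; \<open>t\<close> need not be a grid point.\<close>

definition grid_inc :: "(real \<Rightarrow> real) \<Rightarrow> nat \<Rightarrow> real \<Rightarrow> int \<Rightarrow> real" where
  "grid_inc f m t j = f (t + (of_int j + 1) / 2 ^ m) - f (t + of_int j / 2 ^ m)"

lemma psum_grid_inc:
  "psum (\<lambda>i. grid_inc f m t (j + int i)) k = f (t + (of_int j + k) / 2 ^ m) - f (t + of_int j / 2 ^ m)"
  by (induction k) (auto simp: psum_def grid_inc_def add_ac)

lemma psum_grid_inc_fwd: "psum (\<lambda>i. grid_inc f m t (int i)) k = f (t + k / 2 ^ m) - f t"
  using psum_grid_inc[of f m t 0 k] by simp

text \<open>Cells are read leftwards while each increment keeps its orientation. This makes a left
  side an i.i.d. walk with the same step law as a right side.\<close>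

lemma psum_grid_inc_bwd:
  "psum (\<lambda>i. grid_inc f m t (- int i - 1)) k = f t - f (t - k / 2 ^ m)"
  by (induction k) (auto simp: psum_def grid_inc_def algebra_simps add_divide_distrib diff_divide_distrib)

text \<open>The two regularity assumptions swap under a change of sign, so everything proved here is
  also available for \<open>- X\<close>, which serves the left sides.\<close>

locale levy = prob_space M for M :: "'a measure" +
  fixes X :: "'a \<Rightarrow> real \<Rightarrow> real"
  assumes rv [measurable]: "\<And>x. (\<lambda>\<omega>. X \<omega> x) \<in> borel_measurable M"
    and zero: "AE \<omega> in M. X \<omega> 0 = 0"
    and cadlag: "AE \<omega> in M. cadlag (X \<omega>)"
    and stationary: "\<And>t h. distr M borel (\<lambda>\<omega>. X \<omega> (t + h) - X \<omega> t) = distr M borel (\<lambda>\<omega>. X \<omega> h)"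
    and indep: "\<And>t::nat \<Rightarrow> real. strict_mono t \<Longrightarrow> indep_vars (\<lambda>_. borel) (\<lambda>i \<omega>. X \<omega> (t (Suc i)) - X \<omega> (t i)) UNIV"
    and pure: "AE \<omega> in M. pure_jump (X \<omega>)"
    and hypA: "AE \<omega> in M. ((\<lambda>x. X \<omega> x / x\<^sup>2) \<longlongrightarrow> 0) at_infinity"
    and reg_nonneg: "AE \<omega> in M. \<forall>\<epsilon>>0. \<exists>x. 0 < x \<and> x < \<epsilon> \<and> X \<omega> x \<ge> 0"
    and reg_nonpos: "AE \<omega> in M. \<forall>\<epsilon>>0. \<exists>x. 0 < x \<and> x < \<epsilon> \<and> X \<omega> x \<le> 0"
begin

definition step_law :: "nat \<Rightarrow> real measure" where
  "step_law m = distr M borel (\<lambda>\<omega>. X \<omega> (1 / 2 ^ m))"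

sublocale G: iid_seq "step_law m" for m
  by (rule iid_seq.intro) (simp_all add: step_law_def prob_space_distr)

lemma measurable_grid_inc [measurable]: "(\<lambda>\<omega>. grid_inc (X \<omega>) m t j) \<in> borel_measurable M"
  unfolding grid_inc_def by measurable

lemma measurable_grid_seq [measurable]:
  "(\<lambda>\<omega> i. grid_inc (X \<omega>) m t (p i)) \<in> measurable M SB"
  by (rule measurable_PiM_single') auto

lemma distr_grid_inc: "distr M borel (\<lambda>\<omega>. grid_inc (X \<omega>) m t j) = step_law m"
proof -
  have "t + (of_int j + 1) / 2 ^ m = t + of_int j / 2 ^ m + 1 / 2 ^ m" by (simp add: add_divide_distrib)
  then show ?thesis unfolding grid_inc_def step_law_def by (simp only: stationary)
qed

lemma indep_grid_inc:
  fixes p :: "nat \<Rightarrow> int"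
  assumes "inj p"
  shows "indep_vars (\<lambda>_. borel) (\<lambda>i \<omega>. grid_inc (X \<omega>) m t (p i)) UNIV"
  unfolding indep_vars_def2
proof (intro conjI ballI)
  show "indep_sets (\<lambda>i. {(\<lambda>\<omega>. grid_inc (X \<omega>) m t (p i)) -` A \<inter> space M |A. A \<in> sets borel}) UNIV"
  proof (subst indep_sets_finite_index_sets, intro allI impI)
    fix J :: "nat set" assume J: "finite J"
    \<comment> \<open>A common shift that makes the finitely many labels in \<open>J\<close>
      nonnegative, so that they index an increasing sequence of times.\<close>
    define n where "n = (\<Sum>j\<in>J. \<bar>p j\<bar>)"
    have n: "p j + n \<ge> 0" if "j \<in> J" for j
    proof -
      have "\<bar>p j\<bar> \<le> n" unfolding n_def using J that by (intro member_le_sum) auto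
      then show ?thesis by simp
    qed
    define s where "s = (\<lambda>j. nat (p j + n))"
    have inj: "inj_on s J" 
    proof (rule inj_onI)
      fix x y assume "x \<in> J" "y \<in> J" "s x = s y"
      then have "p x + n = p y + n" unfolding s_def using n by (metis int_nat_eq)
      then show "x = y" using assms by (auto dest: injD)
    qed
    define T :: "nat \<Rightarrow> real" where "T = (\<lambda>k. t + of_int (int k - n) / 2 ^ m)"
    have "strict_mono T" unfolding T_def by (auto simp: strict_mono_def divide_strict_right_mono)
    note I = indep[OF this]
    have "indep_sets (\<lambda>k. {(\<lambda>\<omega>. X \<omega> (T (Suc k)) - X \<omega> (T k)) -` A \<inter> space M |A. A \<in> sets borel}) UNIV"
      using I unfolding indep_vars_def2 by simp
    from indep_sets_reindex[OF this inj]
    have "indep_sets (\<lambda>j. {(\<lambda>\<omega>. X \<omega> (T (Suc (s j))) - X \<omega> (T (s j))) -` A \<inter> space M |A. A \<in> sets borel}) J"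
      by simp
    moreover have "X \<omega> (T (Suc (s j))) - X \<omega> (T (s j)) = grid_inc (X \<omega>) m t (p j)" if "j \<in> J" for j \<omega>
      using n[OF that] unfolding T_def s_def grid_inc_def by (simp add: algebra_simps)
    ultimately show "indep_sets (\<lambda>i. {(\<lambda>\<omega>. grid_inc (X \<omega>) m t (p i)) -` A \<inter> space M |A. A \<in> sets borel}) J"
      by (subst indep_sets_cong[OF refl]) auto
  qed
qed auto

text \<open>The law depends neither on the starting point nor on the injective order of reading;
  forward, backward and folded readings all rely on this.\<close>

lemma distr_grid_seq:
  assumes "inj p"
  shows "distr M SB (\<lambda>\<omega> i. grid_inc (X \<omega>) m t (p i)) = G.S m"
proof -
  have "distr M SB (\<lambda>\<omega>. \<lambda>i\<in>UNIV. grid_inc (X \<omega>) m t (p i)) =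
      PiM UNIV (\<lambda>i. distr M borel (\<lambda>\<omega>. grid_inc (X \<omega>) m t (p i)))"
    by (rule indep_vars_iff_distr_eq_PiM'[THEN iffD1, OF _ _ indep_grid_inc[OF assms]]) auto
  then show ?thesis by (simp only: distr_grid_inc G.S_def restrict_UNIV)
qed

lemma prob_grid:
  assumes "inj p" and [measurable]: "Measurable.pred SB P"
  shows "prob {\<omega> \<in> space M. P (\<lambda>i. grid_inc (X \<omega>) m t (p i))} = G.S.prob m {\<xi>. P \<xi>}"
proof -
  have "G.S.prob m {\<xi>. P \<xi>} = measure (distr M SB (\<lambda>\<omega> i. grid_inc (X \<omega>) m t (p i))) {\<xi>. P \<xi>}"
    by (simp only: distr_grid_seq[OF assms(1)])
  also have "\<dots> = prob ((\<lambda>\<omega> i. grid_inc (X \<omega>) m t (p i)) -` {\<xi>. P \<xi>} \<inter> space M)"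
  proof (rule measure_distr)
    have "{\<xi> \<in> space SB. P \<xi>} \<in> sets SB" by measurable
    then show "{\<xi>. P \<xi>} \<in> sets SB" by (simp add: space_PiM)
  qed measurable
  also have "\<dots> = prob {\<omega> \<in> space M. P (\<lambda>i. grid_inc (X \<omega>) m t (p i))}"
    by (rule arg_cong[where f=prob]) auto
  finally show ?thesis by simp
qed

lemma inj_fwd: "inj (\<lambda>i. j + int i)" and inj_bwd: "inj (\<lambda>i. - int i - 1)"
  by (auto simp: inj_def)

end

section \<open>Left limits and change of sign of a path\<close>

lemma left_lim_eq: "(f \<longlongrightarrow> l) (at_left x) \<Longrightarrow> left_lim f x = l"
  for f :: "real \<Rightarrow> real"
  unfolding left_lim_def by (rule tendsto_Lim) auto

lemma cadlagD:
  assumes "cadlag f"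
  shows "(f \<longlongrightarrow> f x) (at_right x)" "(f \<longlongrightarrow> left_lim f x) (at_left x)"
  using assms left_lim_eq[of f] unfolding cadlag_def by metis+

lemma cadlag_uminus:
  assumes "cadlag f"
  shows "cadlag (\<lambda>x. - f x)" "left_lim (\<lambda>x. - f x) = (\<lambda>x. - left_lim f x)" "jump (\<lambda>x. - f x) = (\<lambda>x. - jump f x)"
proof -
  have l: "((\<lambda>x. - f x) \<longlongrightarrow> - left_lim f x) (at_left x)" for x
    by (intro tendsto_minus cadlagD assms)
  show "cadlag (\<lambda>x. - f x)"
    unfolding cadlag_def using l cadlagD(1)[OF assms] by (auto intro: tendsto_minus)
  show 1: "left_lim (\<lambda>x. - f x) = (\<lambda>x. - left_lim f x)"
    using left_lim_eq[OF l] by auto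
  show "jump (\<lambda>x. - f x) = (\<lambda>x. - jump f x)"
    by (auto simp: jump_def 1)
qed

lemma pure_jump_uminus:
  assumes "cadlag f" "pure_jump f"
  shows "pure_jump (\<lambda>x. - f x)"
  using assms(2) unfolding pure_jump_def cadlag_uminus(3)[OF assms(1)]
  by (metis has_sum_uminusI)

lemma (in levy) levy_uminus: "levy M (\<lambda>\<omega> x. - X \<omega> x)"
proof unfold_locales
  fix t h
  have "distr M borel (\<lambda>\<omega>. - X \<omega> (t + h) - - X \<omega> t) = distr (distr M borel (\<lambda>\<omega>. X \<omega> (t + h) - X \<omega> t)) borel uminus"
    by (subst distr_distr) (auto simp: o_def)
  also have "\<dots> = distr (distr M borel (\<lambda>\<omega>. X \<omega> h)) borel uminus"
    by (simp only: stationary)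
  also have "\<dots> = distr M borel (\<lambda>\<omega>. - X \<omega> h)"
    by (subst distr_distr) (auto simp: o_def)
  finally show "distr M borel (\<lambda>\<omega>. - X \<omega> (t + h) - - X \<omega> t) = distr M borel (\<lambda>\<omega>. - X \<omega> h)" .
next
  fix t :: "nat \<Rightarrow> real" assume t: "strict_mono t"
  have "indep_vars (\<lambda>_. borel) (\<lambda>i. uminus \<circ> (\<lambda>\<omega>. X \<omega> (t (Suc i)) - X \<omega> (t i))) UNIV"
    by (rule indep_vars_compose[OF indep[OF t]]) auto
  then show "indep_vars (\<lambda>_. borel) (\<lambda>i \<omega>. - X \<omega> (t (Suc i)) - - X \<omega> (t i)) UNIV"
    by (simp add: o_def)
next
  show "AE \<omega> in M. pure_jump (\<lambda>x. - X \<omega> x)"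
    using pure cadlag by eventually_elim (rule pure_jump_uminus)
  show "AE \<omega> in M. ((\<lambda>x. - X \<omega> x / x\<^sup>2) \<longlongrightarrow> 0) at_infinity"
    using hypA by eventually_elim (auto dest: tendsto_minus)
  show "AE \<omega> in M. Defs.cadlag (\<lambda>x. - X \<omega> x)"
    using cadlag by eventually_elim (rule cadlag_uminus)
qed (use zero reg_nonneg reg_nonpos in auto)

section \<open>Small slopes of pure jump paths\<close>

text \<open>By absolute summability a finite set \<open>J\<close> of times carries all but
  \<open>\<rho>\<close> of the total jump size, and \<open>H\<close> accumulates the sizes of the
  remaining jumps. Zero drift is what bounds an increment over an interval free of \<open>J\<close>
  by jumps alone.\<close>

lemma pure_jump_approx:
  assumes f: "pure_jump f" "f 0 = 0" and "T > 0" "\<rho> > 0"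
  obtains J H where "finite J" "\<And>s t. 0 \<le> s \<Longrightarrow> s \<le> t \<Longrightarrow> t \<le> T \<Longrightarrow> H s \<le> H t" "H T - H 0 \<le> \<rho>"
    "\<And>s t. 0 \<le> s \<Longrightarrow> s \<le> t \<Longrightarrow> t \<le> T \<Longrightarrow> J \<inter> {s<..t} = {} \<Longrightarrow> \<bar>f t - f s\<bar> \<le> H t - H s"
proof -
  define g where "g = (\<lambda>x. \<bar>jump f x\<bar>)"
  have sT: "jump f summable_on {0<..T}"
    using f(1) \<open>T > 0\<close> unfolding pure_jump_def summable_on_def by blast
  have gT: "g summable_on {0<..T}"
    using summable_on_iff_abs_summable_on_real[THEN iffD1, OF sT] unfolding g_def by simp
  have g: "g summable_on A" if "A \<subseteq> {0<..T}" for A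
    using summable_on_subset_banach[OF gT that] .
  have s: "jump f summable_on A" if "A \<subseteq> {0<..T}" for A
    using summable_on_subset_banach[OF sT that] .
  obtain J where J: "finite J" "J \<subseteq> {0<..T}" "dist (sum g J) (infsum g {0<..T}) \<le> \<rho>"
    using has_sum_finite_approximation[OF has_sum_infsum[OF gT] \<open>\<rho> > 0\<close>] by blast
  define H where "H = (\<lambda>t. infsum g ({0<..t} - J))"
  have inc: "H t = H s + infsum g ({s<..t} - J)" if "0 \<le> s" "s \<le> t" "t \<le> T" for s t
  proof -
    have "{0<..t} - J = ({0<..s} - J) \<union> ({s<..t} - J)" using that by auto
    moreover have "infsum g (({0<..s} - J) \<union> ({s<..t} - J)) = infsum g ({0<..s} - J) + infsum g ({s<..t} - J)"
      by (rule infsum_Un_disjoint) (use that in \<open>auto intro!: g\<close>)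
    ultimately show ?thesis unfolding H_def by simp
  qed
  have feq: "f t = infsum (jump f) {0<..t}" if "0 \<le> t" for t
    using f that unfolding pure_jump_def by (cases "t = 0") (auto intro!: infsumI[symmetric])
  show thesis
  proof (rule that[of J H])
    show "H s \<le> H t" if "0 \<le> s" "s \<le> t" "t \<le> T" for s t
      using inc[OF that] infsum_nonneg[of "{s<..t} - J" g] by (simp add: g_def)
    have "infsum g {0<..T} = infsum g (({0<..T} - J) \<union> J)" using J by (simp add: Un_absorb2)
    also have "\<dots> = infsum g ({0<..T} - J) + infsum g J"
      by (rule infsum_Un_disjoint) (use J in \<open>auto intro!: g\<close>)
    finally show "H T - H 0 \<le> \<rho>"
      using J unfolding H_def dist_real_def by simp
    show "\<bar>f t - f s\<bar> \<le> H t - H s" if st: "0 \<le> s" "s \<le> t" "t \<le> T" and Jst: "J \<inter> {s<..t} = {}" for s t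
    proof -
      have "{0<..t} = {0<..s} \<union> {s<..t}" using st by auto
      moreover have "infsum (jump f) ({0<..s} \<union> {s<..t}) = infsum (jump f) {0<..s} + infsum (jump f) {s<..t}"
        by (rule infsum_Un_disjoint) (use st in \<open>auto intro!: s\<close>)
      ultimately have "f t - f s = infsum (jump f) {s<..t}" using feq[of s] feq[of t] st by simp
      moreover have "norm (infsum (jump f) {s<..t}) \<le> infsum (\<lambda>x. norm (jump f x)) {s<..t}"
        by (rule norm_infsum_bound) (use g[of "{s<..t}"] st in \<open>auto simp: g_def subset_eq\<close>)
      moreover have "{s<..t} - J = {s<..t}" using Jst by auto
      ultimately show ?thesis using inc[OF st] by (simp add: g_def)
    qed
  qed (use J in auto)
qed

text \<open>The discrete form of the rising sun lemma.\<close>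

lemma card_maximal_le:
  fixes a :: "nat \<Rightarrow> real" and c :: real
  assumes a: "\<And>l. a l \<ge> 0" and "c > 0"
  shows "c * card {j \<in> {s..<n}. \<exists>i. j + i \<le> n \<and> c * i < (\<Sum>l=j..<j + i. a l)} \<le> (\<Sum>l=s..<n. a l)"
proof (induction "n - s" arbitrary: s rule: less_induct)
  case less
  let ?P = "\<lambda>j. \<exists>i. j + i \<le> n \<and> c * i < (\<Sum>l=j..<j + i. a l)"
  let ?J = "\<lambda>s. {j \<in> {s..<n}. ?P j}"
  show ?case
  proof (cases "s < n")
    case False
    then show ?thesis using a by (simp add: sum_nonneg)
  next
    case True
    show ?thesis
    proof (cases "?P s")
      case False
      then have "?J s = ?J (Suc s)" by (auto simp: Suc_le_eq intro: le_neq_implies_less)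
      moreover have "c * card (?J (Suc s)) \<le> (\<Sum>l=Suc s..<n. a l)" using True by (intro less) auto
      moreover have "(\<Sum>l=s..<n. a l) = a s + (\<Sum>l=Suc s..<n. a l)" using True by (simp add: sum.atLeast_Suc_lessThan)
      ultimately show ?thesis using a[of s] by simp
    next
      case P: True
      then obtain i where i: "s + i \<le> n" "c * i < (\<Sum>l=s..<s + i. a l)" by blast
      then have "i > 0" by (cases i) auto
      have "?J s \<subseteq> {s..<s + i} \<union> ?J (s + i)" by auto
      then have "card (?J s) \<le> card ({s..<s + i} \<union> ?J (s + i))" by (intro card_mono) auto
      also have "\<dots> \<le> card {s..<s + i} + card (?J (s + i))" by (rule card_Un_le)
      finally have "card (?J s) \<le> i + card (?J (s + i))" by simp
      then have "real (card (?J s)) \<le> real i + real (card (?J (s + i)))" by linarith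
      then have "c * card (?J s) \<le> c * (real i + real (card (?J (s + i))))"
        using \<open>c > 0\<close> by (intro mult_left_mono) auto
      also have "\<dots> = c * i + c * card (?J (s + i))" by (simp add: distrib_left)
      also have "\<dots> \<le> (\<Sum>l=s..<s + i. a l) + (\<Sum>l=s + i..<n. a l)"
        using \<open>i > 0\<close> True i less[of "s + i"] by (intro add_mono) auto
      also have "\<dots> = (\<Sum>l=s..<n. a l)" using i by (intro sum.atLeastLessThan_concat) auto
      finally show ?thesis .
    qed
  qed
qed

lemma card_window_le:
  assumes "finite B"
  shows "card {j::nat. \<exists>b\<in>B. j \<le> b \<and> b < j + k} \<le> card B * k"
proof -
  have "card (\<Union>b\<in>B. {j. j \<le> b \<and> b < j + k}) \<le> (\<Sum>b\<in>B. card {j. j \<le> b \<and> b < j + k})"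
    by (rule card_UN_le[OF assms])
  also have "\<dots> \<le> (\<Sum>b\<in>B. k)"
  proof (rule sum_mono)
    fix b
    have "{j. j \<le> b \<and> b < j + k} \<subseteq> {Suc b - k..<Suc b}" by auto
    then have "card {j. j \<le> b \<and> b < j + k} \<le> card {Suc b - k..<Suc b}" by (intro card_mono) auto
    then show "card {j. j \<le> b \<and> b < j + k} \<le> k" by simp
  qed
  finally show ?thesis
    by (simp add: UNION_eq) 
qed

text \<open>The expectation of a count that is at most \<open>c\<close> on \<open>G\<close> and at
  most \<open>card J\<close> elsewhere.\<close>

lemma (in prob_space) sum_prob_le:
  assumes A: "\<And>j. j \<in> J \<Longrightarrow> A j \<in> events" and G: "G \<in> events" and "finite J" "0 \<le> c"
    and c: "\<And>\<omega>. \<omega> \<in> G \<Longrightarrow> real (card {j \<in> J. \<omega> \<in> A j}) \<le> c"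
  shows "(\<Sum>j\<in>J. prob (A j)) \<le> c + card J * (1 - prob G)"
proof -
  have int: "integrable M (indicator B :: 'a \<Rightarrow> real)" if "B \<in> events" for B
    using that by (simp add: integrable_indicator_iff emeasure_eq_measure)
  have "(\<Sum>j\<in>J. prob (A j)) = (\<Sum>j\<in>J. \<integral>\<omega>. indicator (A j) \<omega> \<partial>M)"
    using A by (intro sum.cong) auto
  also have "\<dots> = (\<integral>\<omega>. (\<Sum>j\<in>J. indicator (A j) \<omega>) \<partial>M)"
    by (rule Bochner_Integration.integral_sum[symmetric]) (use A int in auto)
  also have "\<dots> \<le> (\<integral>\<omega>. c + real (card J) * indicator (space M - G) \<omega> \<partial>M)"
  proof (rule integral_mono)
    fix \<omega> assume "\<omega> \<in> space M"
    have "(\<Sum>j\<in>J. indicator (A j) \<omega>) = real (card {j \<in> J. \<omega> \<in> A j})"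
      using \<open>finite J\<close> by (simp add: indicator_def sum.If_cases Int_def)
    moreover have "card {j \<in> J. \<omega> \<in> A j} \<le> card J" using \<open>finite J\<close> by (intro card_mono) auto
    ultimately show "(\<Sum>j\<in>J. indicator (A j) \<omega>) \<le> c + real (card J) * indicator (space M - G) \<omega>"
      using c[of \<omega>] \<open>\<omega> \<in> space M\<close> \<open>0 \<le> c\<close> by (auto simp: indicator_def)
  qed (use int A G in \<open>auto intro!: Bochner_Integration.integrable_sum Bochner_Integration.integrable_add\<close>)
  also have "\<dots> = c + card J * (1 - prob G)"
    using G int[of "space M - G"] by (simp add: prob_compl prob_space)
  finally show ?thesis .
qed

text \<open>A bad starting index either has a window meeting a cell with a large jump, which
  concerns at most \<open>b * 2 ^ (m - r)\<close> indices, or its window climbs by small jumps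
  alone, which the maximal inequality allows for at most \<open>\<rho> * 2 ^ m\<close> indices. The
  number \<open>b\<close> depends on the path, but not on the mesh or the window length.\<close>

lemma pure_jump_count:
  assumes f: "pure_jump f" "f 0 = 0" and "\<delta> > 0" "\<rho> > 0"
  shows "\<exists>b::nat. \<forall>m r. r \<le> m \<longrightarrow>
    real (card {j \<in> {..<2 ^ m}. \<exists>i\<le>2 ^ (m - r). f ((real j + real i) / 2 ^ m) - f (real j / 2 ^ m) > \<delta> / 2 ^ m * real i})
      \<le> 2 ^ m * (\<rho> + b / 2 ^ r)"
proof -
  \<comment> \<open>Windows start before 1 and have length at most 1, hence the range up to 2. The
    total is \<open>\<delta> * \<rho>\<close> because the maximal inequality at level
    \<open>\<delta> / 2 ^ m\<close> divides by \<open>\<delta>\<close>.\<close>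
  obtain J H where J: "finite J" and H: "\<And>s t. 0 \<le> s \<Longrightarrow> s \<le> t \<Longrightarrow> t \<le> 2 \<Longrightarrow> H s \<le> H t" "H 2 - H 0 \<le> \<delta> * \<rho>"
    and JH: "\<And>s t. 0 \<le> s \<Longrightarrow> s \<le> t \<Longrightarrow> t \<le> 2 \<Longrightarrow> J \<inter> {s<..t} = {} \<Longrightarrow> \<bar>f t - f s\<bar> \<le> H t - H s"
    using pure_jump_approx[OF f, of 2 "\<delta> * \<rho>"] \<open>\<delta> > 0\<close> \<open>\<rho> > 0\<close> by (metis mult_pos_pos zero_less_numeral)
  show ?thesis
  proof (intro exI[of _ "card J"] allI impI)
    fix m r :: nat assume "r \<le> m"
    define t where "t = (\<lambda>j. real j / 2 ^ m)"
    have t: "0 \<le> t i" "i \<le> j \<Longrightarrow> t i \<le> t j" for i j by (auto simp: t_def divide_right_mono)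
    have t2: "t i \<le> 2" if "i \<le> 2 * 2 ^ m" for i
    proof -
      have "real i \<le> real (2 * 2 ^ m)" using that by (subst of_nat_le_iff)
      then show ?thesis by (simp add: t_def divide_le_eq)
    qed
    \<comment> \<open>Cells containing a large jump. Distinct cells contain distinct jumps, so every
      mesh has at most \<open>card J\<close> of them.\<close>
    define B where "B = {l. J \<inter> {t l<..t (Suc l)} \<noteq> {}}"
    have "\<exists>x\<in>J. t l < x \<and> x \<le> t (Suc l)" if "l \<in> B" for l using that unfolding B_def by auto
    then obtain x where x: "\<And>l. l \<in> B \<Longrightarrow> x l \<in> J \<and> t l < x l \<and> x l \<le> t (Suc l)" by metis
    have "inj_on x B"
    proof (rule inj_onI)
      fix k l assume *: "k \<in> B" "l \<in> B" "x k = x l"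
      have "\<not> k < l" if "k \<in> B" "l \<in> B" "x k = x l" for k l
        using x[OF that(1)] x[OF that(2)] that(3) t(2)[of "Suc k" l] by (auto simp: Suc_le_eq)
      from this[of k l] this[of l k] * show "k = l" by (simp add: not_less)
    qed
    then have B: "finite B" "card B \<le> card J"
      using J x by (auto intro!: card_inj_on_le[of x] inj_on_finite[of x B J])
    \<comment> \<open>On windows avoiding \<open>B\<close> this dominates the increments of
      \<open>f\<close>; windows meeting \<open>B\<close> are counted in \<open>?J2\<close>, so the
      value 0 there does no harm.\<close>
    define a where "a = (\<lambda>l. if l < 2 * 2 ^ m \<and> l \<notin> B then H (t (Suc l)) - H (t l) else 0)"
    have a0: "a l \<ge> 0" for l using H(1)[OF t(1) t(2)] t2[of "Suc l"] unfolding a_def by auto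
    have asum: "(\<Sum>l=0..<2 * 2 ^ m. a l) \<le> \<delta> * \<rho>"
    proof -
      have "(\<Sum>l=0..<2 * 2 ^ m. a l) \<le> (\<Sum>l=0..<2 * 2 ^ m. H (t (Suc l)) - H (t l))"
        using H(1)[OF t(1) t(2) t2] by (intro sum_mono) (auto simp: a_def)
      also have "\<dots> = H (t (2 * 2 ^ m)) - H (t 0)"
        by (rule sum_Suc_diff') simp
      also have "\<dots> = H 2 - H 0" by (simp add: t_def)
      finally show ?thesis using H by simp
    qed
    let ?c = "\<delta> / 2 ^ m"
    let ?bad = "{j \<in> {..<2 ^ m}. \<exists>i\<le>2 ^ (m - r). f ((real j + real i) / 2 ^ m) - f (real j / 2 ^ m) > \<delta> / 2 ^ m * real i}"
    let ?J1 = "{j \<in> {0..<2 * 2 ^ m}. \<exists>i. j + i \<le> 2 * 2 ^ m \<and> ?c * i < (\<Sum>l=j..<j + i. a l)}"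
    let ?J2 = "{j. \<exists>b\<in>B. j \<le> b \<and> b < j + 2 ^ (m - r)}"
    have "?bad \<subseteq> ?J1 \<union> ?J2"
    proof
      fix j :: nat assume "j \<in> ?bad"
      then obtain i where j: "j < 2 ^ m" and i: "i \<le> 2 ^ (m - r)" and ji: "f (t (j + i)) - f (t j) > ?c * i"
        unfolding t_def by auto
      have "(2::nat) ^ (m - r) \<le> 2 ^ m" by (rule power_increasing) auto
      with i j have jim: "j + i \<le> 2 * 2 ^ m" by linarith
      show "j \<in> ?J1 \<union> ?J2"
      proof (cases "j \<in> ?J2")
        case False
        then have nB: "l \<notin> B" if "j \<le> l" "l < j + i" for l using that i by auto
        have "f (t (j + i)) - f (t j) = (\<Sum>l=j..<j + i. f (t (Suc l)) - f (t l))"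
          by (rule sum_Suc_diff'[symmetric]) simp
        also have "\<dots> \<le> (\<Sum>l=j..<j + i. a l)"
        proof (rule sum_mono)
          fix l assume l: "l \<in> {j..<j + i}"
          then have "\<bar>f (t (Suc l)) - f (t l)\<bar> \<le> H (t (Suc l)) - H (t l)"
            using nB[of l] jim by (intro JH t t2) (auto simp: B_def)
          then show "f (t (Suc l)) - f (t l) \<le> a l" using l nB[of l] jim by (auto simp: a_def)
        qed
        finally show ?thesis using ji jim j by force
      qed auto
    qed
    moreover have fin: "finite ?J2"
    proof (rule finite_subset)
      show "?J2 \<subseteq> {..Max (insert 0 B)}" using B(1) by (auto intro: order_trans[OF _ Max_ge])
    qed auto
    ultimately have "card ?bad \<le> card (?J1 \<union> ?J2)" by (intro card_mono) auto
    also have "\<dots> \<le> card ?J1 + card ?J2" by (rule card_Un_le)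
    also have "card ?J2 \<le> card B * 2 ^ (m - r)" by (rule card_window_le[OF B(1)])
    also have "card B * 2 ^ (m - r) \<le> card J * 2 ^ (m - r)" using B(2) by simp
    finally have "real (card ?bad) \<le> real (card ?J1 + card J * 2 ^ (m - r))" by (subst of_nat_le_iff) simp
    also have "\<dots> = real (card ?J1) + card J * (2 ^ m / 2 ^ r)" using power_diff[of "2::real", OF _ \<open>r \<le> m\<close>] by simp
    also have "real (card ?J1) \<le> 2 ^ m * \<rho>"
    proof -
      have "?c * card ?J1 \<le> \<delta> * \<rho>"
        using card_maximal_le[of a ?c 0 "2 * 2 ^ m"] a0 \<open>\<delta> > 0\<close> asum by simp
      then show ?thesis using \<open>\<delta> > 0\<close> by (simp add: field_simps)
    qed
    finally show "real (card ?bad) \<le> 2 ^ m * (\<rho> + card J / 2 ^ r)" by (simp add: algebra_simps)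
  qed
qed

lemma (in iid_seq) prob_neg:
  assumes "Measurable.pred SB P"
  shows "S.prob {\<xi>. \<not> P \<xi>} = 1 - S.prob {\<xi>. P \<xi>}"
proof -
  have "{\<xi>. \<not> P \<xi>} = space S - {\<xi>. P \<xi>}" by auto
  then show ?thesis using S.prob_compl[OF sets_SI[OF assms]] by simp
qed

context levy
begin

text \<open>By stationarity all grid points of [0, 1) are bad with the same probability, which
  therefore equals the expected fraction of bad grid points; the pathwise count bounds that fraction
  uniformly in the mesh.\<close>

lemma prob_below_slope:
  assumes "\<delta> > 0"
  obtains r0 where "\<And>r m. r0 \<le> r \<Longrightarrow> r \<le> m \<Longrightarrow>
    G.S.prob m {\<xi>. \<forall>i\<le>2 ^ (m - r). psum \<xi> i \<le> \<delta> / 2 ^ m * i} \<ge> 1 / 2"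
proof -
  define bad where "bad = (\<lambda>m r j \<omega>. \<exists>i\<le>2 ^ (m - r). X \<omega> ((real j + real i) / 2 ^ m) - X \<omega> (real j / 2 ^ m) > \<delta> / 2 ^ m * real i)"
  have bad_meas [measurable]: "Measurable.pred M (bad m r j)" for m r j
    unfolding bad_def by measurable
  define Good where "Good = (\<lambda>b::nat. {\<omega> \<in> space M. \<forall>m r. r \<le> m \<longrightarrow>
    (\<Sum>j<2 ^ m. if bad m r j \<omega> then 1 else 0 :: real) \<le> 2 ^ m * (1 / 8 + b / 2 ^ r)})"
  have Good_meas [measurable]: "Good b \<in> events" for b unfolding Good_def by measurable
  have card_eq: "(\<Sum>j<2 ^ m. if bad m r j \<omega> then 1 else 0 :: real) = card {j \<in> {..<2 ^ m}. bad m r j \<omega>}" for m r \<omega>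
    by (simp add: sum.If_cases Int_def)
  have "AE \<omega> in M. \<omega> \<in> (\<Union>b. Good b)"
    using pure zero AE_space
  proof eventually_elim
    case (elim \<omega>)
    have "0 < (1 / 8 :: real)" by simp
    from pure_jump_count[OF elim(1,2) \<open>\<delta> > 0\<close> this]
    obtain b :: nat where b: "\<forall>m r. r \<le> m \<longrightarrow>
      real (card {j \<in> {..<2 ^ m}. \<exists>i\<le>2 ^ (m - r). X \<omega> ((real j + real i) / 2 ^ m) - X \<omega> (real j / 2 ^ m) > \<delta> / 2 ^ m * real i})
      \<le> 2 ^ m * (1 / 8 + real b / 2 ^ r)" ..
    have "(\<Sum>j<2 ^ m. if bad m r j \<omega> then 1 else 0 :: real) \<le> 2 ^ m * (1 / 8 + b / 2 ^ r)" if "r \<le> m" for m r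
      unfolding card_eq unfolding bad_def by (rule b[rule_format, OF that])
    then have "\<omega> \<in> Good b" using elim(3) by (simp add: Good_def)
    then show ?case by blast
  qed
  then have "prob (\<Union>b. Good b) = 1" by (subst prob_eq_1) auto
  moreover have "(\<lambda>b. prob (Good b)) \<longlonglongrightarrow> prob (\<Union>b. Good b)"
  proof (rule finite_Lim_measure_incseq)
    have "2 ^ m * (1 / 8 + real b / 2 ^ r) \<le> 2 ^ m * (1 / 8 + real b' / 2 ^ r)" if "b \<le> b'" for m r and b b' :: nat
      using that by (intro mult_left_mono add_left_mono divide_right_mono) auto
    then show "incseq Good"
      unfolding incseq_def Good_def by (blast intro: order_trans)
  qed auto
  ultimately have "eventually (\<lambda>b. prob (Good b) > 7 / 8) sequentially"
    by (intro order_tendstoD(1)) auto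
  \<comment> \<open>Three errors of 1/8 arise: from the density \<open>\<rho>\<close>, from the
    large jumps once \<open>8 * b < 2 ^ r0\<close>, and from paths outside \<open>Good b\<close>.
    Their sum 3/8 leaves more than 1/2.\<close>
  then obtain b where b: "prob (Good b) > 7 / 8" using eventually_happens by force
  obtain r0 where r0: "8 * real b < 2 ^ r0" using real_arch_pow[of 2 "8 * real b"] by auto
  show thesis
  proof (rule that[of r0])
    fix r m assume r: "r0 \<le> r" "r \<le> m"
    define \<pi> where "\<pi> = G.S.prob m {\<xi>. \<exists>i\<le>2 ^ (m - r). psum \<xi> i > \<delta> / 2 ^ m * i}"
    have pj: "prob {\<omega> \<in> space M. bad m r j \<omega>} = \<pi>" for j
    proof -
      have "prob {\<omega> \<in> space M. \<exists>i\<le>2 ^ (m - r). psum (\<lambda>i. grid_inc (X \<omega>) m (real j / 2 ^ m) (0 + int i)) i > \<delta> / 2 ^ m * i} = \<pi>"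
        unfolding \<pi>_def by (rule prob_grid[OF inj_fwd]) measurable
      then show ?thesis
        by (simp only: psum_grid_inc bad_def) (simp add: add_divide_distrib)
    qed
    have "(\<Sum>j<2 ^ m. prob {\<omega> \<in> space M. bad m r j \<omega>}) \<le> 2 ^ m * (1 / 4) + card {..<(2::nat) ^ m} * (1 - prob (Good b))"
    proof (rule sum_prob_le)
      fix \<omega> assume g: "\<omega> \<in> Good b"
      have "(2::real) ^ r0 \<le> 2 ^ r" using r by (intro power_increasing) auto
      with r0 have "8 * real b < 2 ^ r" by linarith
      then have "real b / 2 ^ r \<le> 1 / 8" by (simp add: divide_le_eq)
      then have "1 / 8 + real b / 2 ^ r \<le> 1 / 4" by linarith
      then have "2 ^ m * (1 / 8 + b / 2 ^ r) \<le> (2::real) ^ m * (1 / 4)" by (rule mult_left_mono) simp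
      moreover have "real (card {j \<in> {..<2 ^ m}. bad m r j \<omega>}) \<le> 2 ^ m * (1 / 8 + b / 2 ^ r)"
        using g r unfolding Good_def card_eq by blast
      moreover have "\<omega> \<in> space M" using g unfolding Good_def by blast
      ultimately show "real (card {j \<in> {..<2 ^ m}. \<omega> \<in> {\<omega> \<in> space M. bad m r j \<omega>}}) \<le> 2 ^ m * (1 / 4)"
        by (simp only: mem_Collect_eq simp_thms)
    qed auto
    also have "\<dots> \<le> 2 ^ m * (1 / 4) + 2 ^ m * (1 / 8)" using b by simp
    finally have "2 ^ m * \<pi> \<le> 2 ^ m * (3 / 8)" unfolding pj by simp
    then have "\<pi> \<le> 3 / 8" by simp
    moreover have "G.S.prob m {\<xi>. \<forall>i\<le>2 ^ (m - r). psum \<xi> i \<le> \<delta> / 2 ^ m * i} = 1 - \<pi>"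
    proof -
      have "G.S.prob m {\<xi>. \<not> (\<exists>i\<le>2 ^ (m - r). psum \<xi> i > \<delta> / 2 ^ m * i)} = 1 - \<pi>"
        unfolding \<pi>_def by (rule G.prob_neg) measurable
      then show ?thesis by (simp only: not_ex not_less de_Morgan_conj not_le imp_conv_disj)
    qed
    ultimately show "G.S.prob m {\<xi>. \<forall>i\<le>2 ^ (m - r). psum \<xi> i \<le> \<delta> / 2 ^ m * i} \<ge> 1 / 2" by simp
  qed
qed

end

section \<open>Steep points\<close>

text \<open>The constraint sets are indexed by real time, not by step number, so that the same
  constraint can be compared across meshes.\<close>

definition stay :: "nat \<Rightarrow> real \<Rightarrow> (real \<Rightarrow> real set) \<Rightarrow> (nat \<Rightarrow> real) \<Rightarrow> bool" where
  "stay m T C \<xi> \<longleftrightarrow> (\<forall>k. real k / 2 ^ m \<le> T \<longrightarrow> psum \<xi> k \<in> C (real k / 2 ^ m))"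

lemma pred_stay [measurable]:
  assumes [measurable]: "\<And>s. C s \<in> sets borel"
  shows "Measurable.pred SB (stay m T C)"
  unfolding stay_def by measurable

lemma depends_on_stay: "T * 2 ^ m \<le> real K \<Longrightarrow> depends_on K (stay m T C)"
proof (rule depends_on_psum)
  fix \<xi> \<xi>' assume T: "T * 2 ^ m \<le> real K" and *: "\<And>i. i \<le> K \<Longrightarrow> psum \<xi> i = psum \<xi>' i"
  have "psum \<xi> k = psum \<xi>' k" if "real k / 2 ^ m \<le> T" for k
  proof (rule *)
    have "real k \<le> T * 2 ^ m" using that by (simp add: divide_le_eq)
    with T show "k \<le> K" by linarith
  qed
  then show "stay m T C \<xi> = stay m T C \<xi>'" unfolding stay_def by auto
qed

lemma real_two_power_diff: "r \<le> m \<Longrightarrow> real (2 ^ (m - r)) = 2 ^ m / 2 ^ r"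
  using power_diff[of "2::real" r m] by simp

lemma grid_le_iff: "r \<le> m \<Longrightarrow> real k / 2 ^ m \<le> 1 / 2 ^ r \<longleftrightarrow> k \<le> 2 ^ (m - r)"
proof -
  assume "r \<le> m"
  have "real k / 2 ^ m \<le> 1 / 2 ^ r \<longleftrightarrow> real k \<le> 2 ^ m / 2 ^ r" by (simp add: divide_le_eq)
  then show ?thesis by (simp only: real_two_power_diff[OF \<open>r \<le> m\<close>, symmetric] of_nat_le_iff)
qed

lemma grid_le_nat_iff: "real k / 2 ^ m \<le> real L \<longleftrightarrow> k \<le> L * 2 ^ m"
proof -
  have "real k / 2 ^ m \<le> real L \<longleftrightarrow> real k \<le> real (L * 2 ^ m)" by (simp add: divide_le_eq)
  then show ?thesis by (simp only: of_nat_le_iff)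
qed

lemma exists_first_max:
  fixes D :: "nat \<Rightarrow> real"
  shows "\<exists>k\<le>K. (\<forall>i\<le>K. D i \<le> D k) \<and> (\<forall>i<k. D i < D k)"
proof (induction K)
  case (Suc K)
  then obtain k where k: "k \<le> K" "\<forall>i\<le>K. D i \<le> D k" "\<forall>i<k. D i < D k" by blast
  show ?case
  proof (cases "D (Suc K) \<le> D k")
    case True
    then show ?thesis using k by (intro exI[of _ k]) (auto simp: le_Suc_eq)
  next
    case False
    then show ?thesis using k by (intro exI[of _ "Suc K"]) (auto simp: le_Suc_eq less_Suc_eq_le intro: order_trans le_less_trans)
  qed
qed auto

lemma exists_grid_point:
  fixes a b :: real
  assumes "0 \<le> a" "1 / 2 ^ m < b - a"
  shows "\<exists>k::nat. a < real k / 2 ^ m \<and> real k / 2 ^ m < b"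
proof (intro exI conjI)
  let ?k = "nat (\<lfloor>a * 2 ^ m\<rfloor> + 1)"
  have k: "real ?k = of_int \<lfloor>a * 2 ^ m\<rfloor> + 1" using assms(1) by simp
  have "a * 2 ^ m < real ?k" unfolding k by linarith
  then show "a < real ?k / 2 ^ m" by (simp add: field_simps)
  have "real ?k \<le> a * 2 ^ m + 1" unfolding k by linarith
  also have "\<dots> < b * 2 ^ m" using assms(2) by (simp add: field_simps)
  finally show "real ?k / 2 ^ m < b" by (simp add: field_simps)
qed

lemma eventually_grid_small: "(0::real) < c \<Longrightarrow> \<exists>m0. \<forall>m\<ge>m0. 1 / 2 ^ m < c"
proof -
  assume "0 < c"
  have "(\<lambda>m. (1 / 2 :: real) ^ m) \<longlonglongrightarrow> 0" by (rule LIMSEQ_realpow_zero) auto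
  from order_tendstoD(2)[OF this \<open>0 < c\<close>] show ?thesis
    by (simp add: power_one_over eventually_sequentially)
qed

context levy
begin

abbreviation stay_prob :: "nat \<Rightarrow> real \<Rightarrow> (real \<Rightarrow> real set) \<Rightarrow> real" where
  "stay_prob m T C \<equiv> G.S.prob m {\<xi>. stay m T C \<xi>}"

text \<open>Dyadic times make this an event; \<open>X \<omega> 0\<close> is subtracted because it
  vanishes only almost surely and grid walks see increments only.\<close>

definition dyadic_stay :: "real \<Rightarrow> (real \<Rightarrow> real set) \<Rightarrow> 'a set" where
  "dyadic_stay T C = {\<omega> \<in> space M. \<forall>m k. real k / 2 ^ m \<le> T \<longrightarrow> X \<omega> (real k / 2 ^ m) - X \<omega> 0 \<in> C (real k / 2 ^ m)}"

text \<open>That it vanishes for every \<open>r\<close> expresses regularity of 0 for the open upper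
  half-line; for \<open>- X\<close> in place of \<open>X\<close>, for the open lower one.\<close>

abbreviation nonpos_prob :: "nat \<Rightarrow> real" where
  "nonpos_prob r \<equiv> prob (dyadic_stay (1 / 2 ^ r) (\<lambda>_. {..0}))"

lemma dyadic_stay_sets [measurable]:
  assumes [measurable]: "\<And>s. C s \<in> sets borel"
  shows "dyadic_stay T C \<in> events"
  unfolding dyadic_stay_def by measurable

lemma prob_stay_at:
  assumes [measurable]: "\<And>s. C s \<in> sets borel"
  shows "prob {\<omega> \<in> space M. \<forall>k. real k / 2 ^ m \<le> T \<longrightarrow> X \<omega> (t + real k / 2 ^ m) - X \<omega> t \<in> C (real k / 2 ^ m)}
    = stay_prob m T C"
proof -
  have "prob {\<omega> \<in> space M. stay m T C (\<lambda>i. grid_inc (X \<omega>) m t (0 + int i))} = stay_prob m T C"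
    by (rule prob_grid[OF inj_fwd]) measurable
  then show ?thesis by (simp add: stay_def psum_grid_inc_fwd)
qed

text \<open>Refining the dyadic grid only adds constraints, so the grid events decrease to
  \<open>dyadic_stay\<close>.\<close>

lemma prob_stay_tendsto:
  assumes [measurable]: "\<And>s. C s \<in> sets borel"
  shows "(\<lambda>m. stay_prob m T C) \<longlonglongrightarrow> prob (dyadic_stay T C)"
    and "m \<le> m' \<Longrightarrow> G.S.prob m' {\<xi>. stay m' T C \<xi>} \<le> stay_prob m T C"
    and "prob (dyadic_stay T C) \<le> stay_prob m T C"
proof -
  define A where "A = (\<lambda>m. {\<omega> \<in> space M. \<forall>k. real k / 2 ^ m \<le> T \<longrightarrow> X \<omega> (0 + real k / 2 ^ m) - X \<omega> 0 \<in> C (real k / 2 ^ m)})"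
  have pA: "stay_prob m T C = prob (A m)" for m
    unfolding A_def by (rule prob_stay_at[symmetric]) measurable
  have A [measurable]: "A m \<in> events" for m unfolding A_def by measurable
  have "A (Suc m) \<subseteq> A m" for m
  proof
    fix \<omega> assume *: "\<omega> \<in> A (Suc m)"
    have dbl: "real k / 2 ^ m = real (2 * k) / 2 ^ Suc m" for k by simp
    show "\<omega> \<in> A m" unfolding A_def
    proof (intro CollectI conjI allI impI)
      show "\<omega> \<in> space M" using * unfolding A_def by blast
      show "X \<omega> (0 + real k / 2 ^ m) - X \<omega> 0 \<in> C (real k / 2 ^ m)" if "real k / 2 ^ m \<le> T" for k
        using * that unfolding A_def dbl[of k] by blast
    qed
  qed
  then have dec: "decseq A" by (rule decseq_SucI)
  have eq: "dyadic_stay T C = (\<Inter>m. A m)" unfolding dyadic_stay_def A_def by auto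
  show "(\<lambda>m. stay_prob m T C) \<longlonglongrightarrow> prob (dyadic_stay T C)"
    unfolding pA eq by (rule finite_Lim_measure_decseq) (use dec in auto)
  show "m \<le> m' \<Longrightarrow> G.S.prob m' {\<xi>. stay m' T C \<xi>} \<le> stay_prob m T C"
    unfolding pA using dec by (intro finite_measure_mono) (auto simp: decseq_def)
  show "prob (dyadic_stay T C) \<le> stay_prob m T C"
    unfolding pA eq by (rule finite_measure_mono) auto
qed

text \<open>Tolerance and mesh are refined together; the events then decrease into the null event of
  staying nonpositive. With the tolerance fixed, finer meshes only lower the probability.\<close>

lemma prob_stay_below_small:
  assumes "prob (dyadic_stay T (\<lambda>_. {..0})) = 0" "e > 0"
  obtains w m0 where "w > 0" "\<And>m. m \<ge> m0 \<Longrightarrow> stay_prob m T (\<lambda>_. {..w}) \<le> e"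
proof -
  define A where "A = (\<lambda>n. {\<omega> \<in> space M. \<forall>k. real k / 2 ^ n \<le> T \<longrightarrow> X \<omega> (0 + real k / 2 ^ n) - X \<omega> 0 \<in> {..1 / real (Suc n)}})"
  have pA: "stay_prob n T (\<lambda>_. {..1 / real (Suc n)}) = prob (A n)" for n
    unfolding A_def by (rule prob_stay_at[symmetric]) measurable
  have A [measurable]: "A m \<in> events" for m unfolding A_def by measurable
  have "A (Suc n) \<subseteq> A n" for n
  proof
    fix \<omega> assume *: "\<omega> \<in> A (Suc n)"
    have "X \<omega> (0 + real k / 2 ^ n) - X \<omega> 0 \<le> 1 / real (Suc n)" if "real k / 2 ^ n \<le> T" for k
    proof -
      have k: "real k / 2 ^ n = real (2 * k) / 2 ^ Suc n" by simp
      have "X \<omega> (0 + real (2 * k) / 2 ^ Suc n) - X \<omega> 0 \<le> 1 / real (Suc (Suc n))"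
        using * that unfolding A_def k by blast
      also have "\<dots> \<le> 1 / real (Suc n)" by (simp add: frac_le)
      finally show ?thesis unfolding k .
    qed
    then show "\<omega> \<in> A n" using * unfolding A_def by blast
  qed
  then have dec: "decseq A" by (rule decseq_SucI)
  have "(\<Inter>n. A n) \<subseteq> dyadic_stay T (\<lambda>_. {..0})"
  proof
    fix \<omega> assume *: "\<omega> \<in> (\<Inter>n. A n)"
    have "X \<omega> (real k / 2 ^ m) - X \<omega> 0 \<le> 0" if k: "real k / 2 ^ m \<le> T" for k m
    proof (rule LIMSEQ_le_const[OF LIMSEQ_inverse_real_of_nat], intro exI allI impI)
      fix n assume "m \<le> n"
      then have eq: "real k / 2 ^ m = real (k * 2 ^ (n - m)) / 2 ^ n"
        by (simp only: of_nat_mult real_two_power_diff) simp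
      have "\<omega> \<in> A n" using * by blast
      then have "X \<omega> (0 + real (k * 2 ^ (n - m)) / 2 ^ n) - X \<omega> 0 \<in> {..1 / real (Suc n)}"
        using k unfolding A_def eq by blast
      then show "X \<omega> (real k / 2 ^ m) - X \<omega> 0 \<le> inverse (real (Suc n))"
        unfolding eq[symmetric] by (simp add: inverse_eq_divide)
    qed
    then show "\<omega> \<in> dyadic_stay T (\<lambda>_. {..0})" using * unfolding A_def dyadic_stay_def by auto
  qed
  then have "prob (\<Inter>n. A n) \<le> prob (dyadic_stay T (\<lambda>_. {..0}))" by (intro finite_measure_mono) auto
  then have lt: "prob (\<Inter>n. A n) < e" using assms by linarith
  have "(\<lambda>n. prob (A n)) \<longlonglongrightarrow> prob (\<Inter>n. A n)"
    by (rule finite_Lim_measure_decseq) (use dec in auto)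
  from order_tendstoD(2)[OF this lt] have "eventually (\<lambda>n. prob (A n) < e) sequentially" .
  then obtain n where n: "prob (A n) < e" using eventually_happens by force
  show thesis
  proof (rule that[of "1 / real (Suc n)" n])
    fix m assume "n \<le> m"
    then have "stay_prob m T (\<lambda>_. {..1 / real (Suc n)}) \<le> stay_prob n T (\<lambda>_. {..1 / real (Suc n)})"
      by (intro prob_stay_tendsto) auto
    then show "stay_prob m T (\<lambda>_. {..1 / real (Suc n)}) \<le> e" using n unfolding pA by simp
  qed simp
qed

end

definition inc_seq :: "(real \<Rightarrow> real) \<Rightarrow> nat \<Rightarrow> nat \<Rightarrow> real" where
  "inc_seq z m i = z (real (Suc i) / 2 ^ m) - z (real i / 2 ^ m)"

lemma psum_inc_seq: "psum (inc_seq z m) k = z (real k / 2 ^ m) - z 0"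
  by (induction k) (auto simp: psum_def inc_seq_def)

text \<open>A path with a steep left side at \<open>T\<close> has, after subtracting a smaller drift, its grid maximum
  near \<open>T\<close>; this is a strict record, after which the path does not climb.\<close>

lemma steep_max_grid:
  fixes z :: "real \<Rightarrow> real"
  assumes "0 < \<delta>" "0 < T" "T < 1 / 2 ^ r"
    and left: "\<And>s. 0 \<le> s \<Longrightarrow> s < T \<Longrightarrow> z s \<le> S - 2 * \<delta> * (T - s)"
    and right: "\<And>s. T \<le> s \<Longrightarrow> s \<le> 2 / 2 ^ r \<Longrightarrow> z s \<le> S"
    and near: "\<And>w \<theta>. 0 < w \<Longrightarrow> 0 < \<theta> \<Longrightarrow> \<exists>a b. a < b \<and> 0 \<le> a \<and> T - \<theta> < a \<and> b < T + \<theta> \<and> (\<forall>s. a < s \<and> s < b \<longrightarrow> S - w < z s)"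
    and "0 < w"
  shows "\<exists>m0. \<forall>m\<ge>m0. \<exists>k\<le>2 ^ (m - r). strict_record (\<delta> / 2 ^ m) k (inc_seq z m) \<and>
    stay m (1 / 2 ^ r) (\<lambda>_. {..4 * w}) (shift_seq k (inc_seq z m))"
proof -
  \<comment> \<open>Small enough that the drift over a length \<open>\<theta>\<close> costs at most
    \<open>w\<close> and that \<open>T + \<theta>\<close> does not pass the horizon.\<close>
  define \<theta> where "\<theta> = min (w / \<delta>) (1 / 2 ^ r - T)"
  have \<theta>: "0 < \<theta>" "\<delta> * \<theta> \<le> w" "T + \<theta> \<le> 1 / 2 ^ r"
    using assms by (auto simp: \<theta>_def min_def field_simps)
  obtain a b where ab: "a < b" "0 \<le> a" "T - \<theta> < a" "b < T + \<theta>" "\<forall>s. a < s \<and> s < b \<longrightarrow> S - w < z s"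
    using near[OF \<open>0 < w\<close> \<theta>(1)] by blast
  obtain m1 where m1: "\<forall>m\<ge>m1. 1 / 2 ^ m < b - a" using eventually_grid_small[of "b - a"] ab by auto
  show ?thesis
  proof (rule exI[of _ "max m1 r"], intro allI impI)
    fix m assume m: "max m1 r \<le> m"
    let ?h = "\<lambda>k::nat. real k / 2 ^ m"
    have half: "?h k \<le> 1 / 2 ^ r \<longleftrightarrow> k \<le> 2 ^ (m - r)" for k
      using m by (intro grid_le_iff) auto
    obtain k1 where k1: "a < ?h k1" "?h k1 < b" using exists_grid_point[of a m b] ab m m1 by auto
    define D where "D = (\<lambda>k. z (?h k) - \<delta> * ?h k)"
    obtain k where k: "k \<le> 2 ^ (m - r)" "\<forall>i\<le>2 ^ (m - r). D i \<le> D k" "\<forall>i<k. D i < D k"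
      using exists_first_max[of "2 ^ (m - r)" D] by blast
    \<comment> \<open>Removing half of the steepness leaves slope \<open>\<delta>\<close> on both
      sides of \<open>T\<close>. This pins the maximum of \<open>D\<close> to within
      \<open>2 * w / \<delta>\<close> of \<open>T\<close>.\<close>
    have up: "z s - \<delta> * s \<le> S - \<delta> * T - \<delta> * \<bar>s - T\<bar>" if "0 \<le> s" "s \<le> 2 / 2 ^ r" for s
      using left[of s] right[of s] that by (cases "s < T") (auto simp: algebra_simps)
    have zle: "z s \<le> S" if "0 \<le> s" "s \<le> 2 / 2 ^ r" for s
    proof (cases "s < T")
      case True
      then have "0 \<le> 2 * \<delta> * (T - s)" using \<open>0 < \<delta>\<close> by simp
      then show ?thesis using left[OF that(1) True] by linarith
    qed (use right that in auto)
    have hk: "?h k \<le> 1 / 2 ^ r" using k half by blast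
    have "k1 \<le> 2 ^ (m - r)" using k1 ab \<theta> half[of k1] by linarith
    then have "D k1 \<le> D k" using k by blast
    moreover have "D k1 \<ge> S - w - \<delta> * (T + \<theta>)"
    proof -
      have "\<delta> * ?h k1 \<le> \<delta> * (T + \<theta>)" using k1 ab \<open>0 < \<delta>\<close> by (intro mult_left_mono) auto
      moreover have "S - w < z (?h k1)" using ab k1 by blast
      ultimately show ?thesis unfolding D_def by linarith
    qed
    moreover have "D k \<le> S - \<delta> * T - \<delta> * \<bar>?h k - T\<bar>"
      unfolding D_def
    proof (rule up)
      have "1 / 2 ^ r \<le> (2::real) / 2 ^ r" by (simp add: divide_right_mono)
      with hk show "?h k \<le> 2 / 2 ^ r" by linarith
    qed auto
    ultimately have "\<delta> * \<bar>?h k - T\<bar> \<le> 2 * w" "D k \<ge> S - 2 * w - \<delta> * T" using \<theta>(2) by (auto simp: algebra_simps)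
    moreover have "\<delta> * (T - ?h k) \<le> \<delta> * \<bar>?h k - T\<bar>" using \<open>0 < \<delta>\<close> by (intro mult_left_mono) auto
    \<comment> \<open>With the drift removed, the maximum is within \<open>2 * w\<close> of the
      ideal peak; restoring the drift costs at most another \<open>2 * w\<close>.\<close>
    ultimately have zk: "z (?h k) \<ge> S - 4 * w" unfolding D_def by (simp add: algebra_simps)
    have rec: "strict_record (\<delta> / 2 ^ m) k (inc_seq z m)"
      unfolding strict_record_def psum_inc_seq using k(3) by (auto simp: D_def)
    have "stay m (1 / 2 ^ r) (\<lambda>_. {..4 * w}) (shift_seq k (inc_seq z m))"
      unfolding stay_def psum_shift psum_inc_seq
    proof (intro allI impI)
      fix i assume i: "real i / 2 ^ m \<le> 1 / 2 ^ r"
      have "?h (k + i) = ?h k + ?h i" by (simp add: add_divide_distrib)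
      then have "z (?h (k + i)) \<le> S" using hk i by (intro zle) auto
      then show "z (real (k + i) / 2 ^ m) - z 0 - (z (real k / 2 ^ m) - z 0) \<in> {..4 * w}" using zk by simp
    qed
    with rec k(1) show "\<exists>k\<le>2 ^ (m - r). strict_record (\<delta> / 2 ^ m) k (inc_seq z m) \<and>
      stay m (1 / 2 ^ r) (\<lambda>_. {..4 * w}) (shift_seq k (inc_seq z m))" by blast
  qed
qed

text \<open>\<open>T\<close> is the distance from the start of the path to the steep point,
  \<open>S\<close> the level there. After a jump this level may be only a one-sided limit, so the
  last clause asks for whole intervals near \<open>T\<close> where the path almost reaches
  \<open>S\<close>; every fine grid has a point in them. The horizon is \<open>2 / 2 ^ r\<close>:
  one half to meet the record, one half to observe the stay after it.\<close>

definition steep_at :: "(real \<Rightarrow> real) \<Rightarrow> real \<Rightarrow> nat \<Rightarrow> real \<Rightarrow> real \<Rightarrow> bool" where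
  "steep_at z \<delta> r T S \<longleftrightarrow> 0 < T \<and> T < 1 / 2 ^ r \<and>
    (\<forall>s. 0 \<le> s \<and> s < T \<longrightarrow> z s \<le> S - 2 * \<delta> * (T - s)) \<and>
    (\<forall>s. T \<le> s \<and> s \<le> 2 / 2 ^ r \<longrightarrow> z s \<le> S) \<and>
    (\<forall>w \<theta>. 0 < w \<and> 0 < \<theta> \<longrightarrow> (\<exists>a b. a < b \<and> 0 \<le> a \<and> T - \<theta> < a \<and> b < T + \<theta> \<and> (\<forall>s. a < s \<and> s < b \<longrightarrow> S - w < z s)))"

text \<open>\<open>Z\<close> enters only through the law of its grid increments, so the argument
  serves paths read to the right and, within the negated process, paths read to the left.\<close>

lemma (in levy) AE_not_steep_at:
  fixes Z :: "'a \<Rightarrow> real \<Rightarrow> real"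
  assumes Zm [measurable]: "\<And>s. (\<lambda>\<omega>. Z \<omega> s) \<in> borel_measurable M"
    and law: "\<And>m P. Measurable.pred SB P \<Longrightarrow> prob {\<omega> \<in> space M. P (inc_seq (Z \<omega>) m)} = G.S.prob m {\<xi>. P \<xi>}"
    and stay0: "\<And>r. nonpos_prob r = 0"
    and slope: "\<And>m. r \<le> m \<Longrightarrow> G.S.prob m {\<xi>. \<forall>i\<le>2 ^ (m - r). psum \<xi> i \<le> \<delta> / 2 ^ m * i} \<ge> 1 / 2"
    and "\<delta> > 0"
  shows "AE \<omega> in M. \<not> (\<exists>T S. steep_at (Z \<omega>) \<delta> r T S)"
proof (rule AE_liminfI, goal_cases)
  case (1 e)
  \<comment> \<open>Halved because the expected number of records is at most 2, the inverse of the
    bound in \<open>slope\<close>.\<close>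
  have "e / 2 > 0" using \<open>0 < e\<close> by simp
  obtain w m0 where w: "w > 0" and m0: "\<And>m. m \<ge> m0 \<Longrightarrow> stay_prob m (1 / 2 ^ r) (\<lambda>_. {..w}) \<le> e / 2"
    using prob_stay_below_small[OF stay0 \<open>e / 2 > 0\<close>] by metis
  define P where "P = (\<lambda>m \<xi>. \<exists>k\<le>2 ^ (m - r). strict_record (\<delta> / 2 ^ m) k \<xi> \<and> stay m (1 / 2 ^ r) (\<lambda>_. {..w}) (shift_seq k \<xi>))"
  have [measurable]: "Measurable.pred SB (P m)" for m unfolding P_def by measurable
  define A where "A = (\<lambda>m. {\<omega> \<in> space M. P m (inc_seq (Z \<omega>) m)})"
  have [measurable]: "(\<lambda>\<omega>. inc_seq (Z \<omega>) m) \<in> measurable M SB" for m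
    unfolding inc_seq_def by (rule measurable_PiM_single') auto
  have A: "A m \<in> events" for m unfolding A_def by measurable
  have pA: "prob (A m) \<le> e" if "m \<ge> max m0 r" for m
  proof -
    let ?R = "G.S.prob m {\<xi>. \<forall>i\<le>2 ^ (m - r). psum \<xi> i \<le> \<delta> / 2 ^ m * i}"
    have "prob (A m) * (1 / 2) \<le> prob (A m) * ?R"
      using slope[of m] that by (intro mult_left_mono) auto
    also have "\<dots> = G.S.prob m {\<xi>. P m \<xi>} * ?R" unfolding A_def by (subst law) auto
    also have "\<dots> \<le> stay_prob m (1 / 2 ^ r) (\<lambda>_. {..w})"
      unfolding P_def by (rule G.prob_ex_record_le) measurable
    also have "\<dots> \<le> e / 2" using that by (intro m0) auto
    finally show ?thesis by simp
  qed
  have "\<exists>k. \<forall>n\<ge>k. \<omega> \<in> A n" if "\<omega> \<in> space M" "steep_at (Z \<omega>) \<delta> r T S" for \<omega> T S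
  proof -
    have "\<exists>m0. \<forall>m\<ge>m0. \<exists>k\<le>2 ^ (m - r). strict_record (\<delta> / 2 ^ m) k (inc_seq (Z \<omega>) m) \<and>
      stay m (1 / 2 ^ r) (\<lambda>_. {..4 * (w / 4)}) (shift_seq k (inc_seq (Z \<omega>) m))"
      by (rule steep_max_grid[of \<delta> T r "Z \<omega>" S]) (use that(2) \<open>\<delta> > 0\<close> w in \<open>auto simp: steep_at_def\<close>)
    then show ?thesis using that(1) unfolding A_def P_def by simp
  qed
  then have ae: "AE \<omega> in M. \<not> \<not> (\<exists>T S. steep_at (Z \<omega>) \<delta> r T S) \<longrightarrow> (\<exists>k. \<forall>n\<ge>k. \<omega> \<in> A n)"
    by (intro AE_I2) blast
  show ?case
    by (rule exI[of _ A], rule exI[of _ "max m0 r"], intro conjI allI impI A pA ae)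
qed

section \<open>One-sided steepness and one-sided maxima\<close>

definition ub :: "(real \<Rightarrow> real) \<Rightarrow> real \<Rightarrow> real" where
  "ub f p = max (f p) (left_lim f p)"

text \<open>The sign \<open>\<sigma>\<close> selects the right (\<open>1\<close>) or the left (\<open>-1\<close>) side of \<open>p\<close>.\<close>

definition steep :: "(real \<Rightarrow> real) \<Rightarrow> real \<Rightarrow> real \<Rightarrow> bool" where
  "steep f \<sigma> p \<longleftrightarrow> (\<exists>\<delta>>0. \<exists>\<epsilon>>0. \<forall>t. 0 < t \<and> t < \<epsilon> \<longrightarrow> f (p + \<sigma> * t) \<le> ub f p - \<delta> * t)"

definition side_max :: "(real \<Rightarrow> real) \<Rightarrow> real \<Rightarrow> real \<Rightarrow> bool" where
  "side_max f \<sigma> p \<longleftrightarrow> (\<exists>\<epsilon>>0. \<forall>t. 0 < t \<and> t < \<epsilon> \<longrightarrow> f (p + \<sigma> * t) \<le> ub f p)"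

lemma cadlag_near_ub:
  assumes "cadlag f" "0 < w" "0 < \<theta>"
  shows "\<exists>a b. a < b \<and> p - \<theta> < a \<and> b < p + \<theta> \<and> (\<forall>y. a < y \<and> y < b \<longrightarrow> ub f p - w < f y)"
proof (cases "f p \<ge> left_lim f p")
  case True
  have "eventually (\<lambda>y. ub f p - w < f y) (at_right p)"
    by (rule order_tendstoD(1)[OF cadlagD(1)[OF assms(1)]]) (use True \<open>0 < w\<close> in \<open>auto simp: ub_def\<close>)
  then obtain b where "b > p" "\<forall>y>p. y < b \<longrightarrow> ub f p - w < f y"
    unfolding eventually_at_right_field by blast
  then show ?thesis using \<open>0 < \<theta>\<close>
    by (intro exI[of _ p] exI[of _ "min b (p + \<theta> / 2)"]) auto
next
  case False
  have "eventually (\<lambda>y. ub f p - w < f y) (at_left p)"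
    by (rule order_tendstoD(1)[OF cadlagD(2)[OF assms(1)]]) (use False \<open>0 < w\<close> in \<open>auto simp: ub_def\<close>)
  then obtain a where "a < p" "\<forall>y>a. y < p \<longrightarrow> ub f p - w < f y"
    unfolding eventually_at_left_field by blast
  then show ?thesis using \<open>0 < \<theta>\<close>
    by (intro exI[of _ "max a (p - \<theta> / 2)"] exI[of _ p]) auto
qed

text \<open>The path is started at a rational \<open>q\<close> just behind \<open>p\<close> on the
  steep side, so that countably many paths cover all candidates; lowering the slope to
  \<open>2 / Suc n\<close> makes the slopes countable as well.\<close>

lemma steep_imp_steep_at:
  assumes f: "cadlag f" and "steep f (- \<sigma>) p" "side_max f \<sigma> p" and \<sigma>: "\<sigma> = 1 \<or> \<sigma> = - 1"
  shows "\<exists>n0::nat. \<forall>n\<ge>n0. \<exists>r0. \<forall>r\<ge>r0. \<exists>q::rat. \<exists>T S.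
    steep_at (\<lambda>s. f (of_rat q + \<sigma> * s) - f (of_rat q)) (1 / real (Suc n)) r T S"
proof -
  obtain \<delta> \<epsilon>1 where \<delta>: "\<delta> > 0" "\<epsilon>1 > 0" and l: "\<And>t. 0 < t \<Longrightarrow> t < \<epsilon>1 \<Longrightarrow> f (p - \<sigma> * t) \<le> ub f p - \<delta> * t"
    using assms(2) unfolding steep_def by auto
  obtain \<epsilon>2 where e2: "\<epsilon>2 > 0" and r: "\<And>t. 0 < t \<Longrightarrow> t < \<epsilon>2 \<Longrightarrow> f (p + \<sigma> * t) \<le> ub f p"
    using assms(3) unfolding side_max_def by blast
  have r': "f (p + \<sigma> * t) \<le> ub f p" if "0 \<le> t" "t < \<epsilon>2" for t
    using r[of t] that by (cases "t = 0") (auto simp: ub_def)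
  obtain n0 where n0: "inverse (real (Suc n0)) < \<delta> / 2" using reals_Archimedean[of "\<delta> / 2"] \<delta> by auto
  obtain r0 where r0: "\<forall>r\<ge>r0. 1 / 2 ^ r < min \<epsilon>1 \<epsilon>2 / 2" using eventually_grid_small[of "min \<epsilon>1 \<epsilon>2 / 2"] \<delta> e2 by auto
  have main: "\<exists>q::rat. \<exists>T S. steep_at (\<lambda>s. f (of_rat q + \<sigma> * s) - f (of_rat q)) (1 / real (Suc n)) k T S"
    if "n0 \<le> n" "r0 \<le> k" for n k
  proof -
    have "1 / real (Suc n) \<le> inverse (real (Suc n0))" using \<open>n0 \<le> n\<close> by (simp add: inverse_eq_divide frac_le)
    with n0 have n: "2 * (1 / real (Suc n)) \<le> \<delta>" by linarith
    have k: "1 / 2 ^ k < \<epsilon>1 / 2" "1 / 2 ^ k < \<epsilon>2 / 2" using r0 \<open>r0 \<le> k\<close> by auto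
    obtain q T where q: "of_rat q = p - \<sigma> * T" and T: "0 < T" "T < 1 / 2 ^ k"
    proof -
      \<comment> \<open>Density is used at \<open>\<sigma> * p\<close> so that one choice serves
        both orientations; \<open>q\<close> is \<open>\<sigma>\<close> times the rational
        found.\<close>
      obtain x where "x \<in> \<rat>" and x: "\<sigma> * p - 1 / 2 ^ k < x" "x < \<sigma> * p"
        using Rats_dense_in_real[of "\<sigma> * p - 1 / 2 ^ k" "\<sigma> * p"] by auto
      then obtain q where q: "x = of_rat q" by (auto elim: Rats_cases)
      from \<sigma> show thesis
      proof
        assume "\<sigma> = 1"
        then show thesis using x q that[of q "p - x"] by auto
      next
        assume "\<sigma> = - 1"
        then show thesis using x q that[of "- q" "- p - x"] by (auto simp: of_rat_minus)
      qed
    qed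
    have "steep_at (\<lambda>s. f (p - \<sigma> * T + \<sigma> * s) - f (p - \<sigma> * T)) (1 / real (Suc n)) k T (ub f p - f (p - \<sigma> * T))"
      unfolding steep_at_def
    proof (intro conjI allI impI)
      fix s assume s: "0 \<le> s \<and> s < T"
      have "2 * (1 / real (Suc n)) * (T - s) \<le> \<delta> * (T - s)" using s n by (intro mult_right_mono) auto
      moreover have "f (p - \<sigma> * (T - s)) \<le> ub f p - \<delta> * (T - s)" using s k T \<delta> by (intro l) auto
      moreover have "p - \<sigma> * (T - s) = p - \<sigma> * T + \<sigma> * s" by (simp add: algebra_simps)
      ultimately show "f (p - \<sigma> * T + \<sigma> * s) - f (p - \<sigma> * T) \<le> ub f p - f (p - \<sigma> * T) - 2 * (1 / real (Suc n)) * (T - s)"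
        by simp
    next
      fix s assume s: "T \<le> s \<and> s \<le> 2 / 2 ^ k"
      have "f (p + \<sigma> * (s - T)) \<le> ub f p" using s k T by (intro r') auto
      moreover have "p + \<sigma> * (s - T) = p - \<sigma> * T + \<sigma> * s" by (simp add: algebra_simps)
      ultimately show "f (p - \<sigma> * T + \<sigma> * s) - f (p - \<sigma> * T) \<le> ub f p - f (p - \<sigma> * T)" by simp
    next
      fix w \<theta> :: real assume *: "0 < w \<and> 0 < \<theta>"
      obtain a b where ab: "a < b" "p - min \<theta> T < a" "b < p + min \<theta> T"
        "\<And>y. a < y \<Longrightarrow> y < b \<Longrightarrow> ub f p - w < f y"
        using cadlag_near_ub[OF f, of w "min \<theta> T" p] * T by auto
      obtain a' b' where ab': "a' < b'" "- min \<theta> T < a'" "b' < min \<theta> T"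
        "\<And>t. a' < t \<Longrightarrow> t < b' \<Longrightarrow> ub f p - w < f (p + \<sigma> * t)"
        using \<sigma>
      proof
        assume "\<sigma> = 1"
        then show thesis using ab by (intro that[of "a - p" "b - p"]) auto
      next
        assume "\<sigma> = - 1"
        then show thesis using ab by (intro that[of "p - b" "p - a"]) auto
      qed
      have "ub f p - f (p - \<sigma> * T) - w < f (p - \<sigma> * T + \<sigma> * s) - f (p - \<sigma> * T)" if "T + a' < s" "s < T + b'" for s
      proof -
        have eq: "p + \<sigma> * (s - T) = p - \<sigma> * T + \<sigma> * s" by (simp add: algebra_simps)
        have "ub f p - w < f (p + \<sigma> * (s - T))" by (rule ab'(4)) (use that in auto)
        then show ?thesis unfolding eq by simp
      qed
      then show "\<exists>a b. a < b \<and> 0 \<le> a \<and> T - \<theta> < a \<and> b < T + \<theta> \<and>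
          (\<forall>s. a < s \<and> s < b \<longrightarrow> ub f p - f (p - \<sigma> * T) - w < f (p - \<sigma> * T + \<sigma> * s) - f (p - \<sigma> * T))"
        using ab'(1-3) by - (rule exI[of _ "T + a'"], rule exI[of _ "T + b'"], auto)
    qed (use T in auto)
    then show ?thesis unfolding q[symmetric] by blast
  qed
  then show ?thesis by blast
qed

context levy
begin

text \<open>The threshold \<open>r0\<close> comes from the step law and the slope alone, so it
  serves all rational starts at once.\<close>

lemma AE_no_steep_path:
  fixes Z :: "rat \<Rightarrow> 'a \<Rightarrow> real \<Rightarrow> real"
  assumes "\<And>q s. (\<lambda>\<omega>. Z q \<omega> s) \<in> borel_measurable M"
    and "\<And>q m P. Measurable.pred SB P \<Longrightarrow> prob {\<omega> \<in> space M. P (inc_seq (Z q \<omega>) m)} = G.S.prob m {\<xi>. P \<xi>}"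
    and "\<And>r. nonpos_prob r = 0"
  shows "AE \<omega> in M. \<forall>n. \<exists>r0. \<forall>r\<ge>r0. \<forall>q. \<not> (\<exists>T S. steep_at (Z q \<omega>) (1 / real (Suc n)) r T S)"
  unfolding AE_all_countable
proof
  fix n
  have pos: "1 / real (Suc n) > 0" by simp
  obtain r0 where r0: "\<And>r m. r0 \<le> r \<Longrightarrow> r \<le> m \<Longrightarrow>
    G.S.prob m {\<xi>. \<forall>i\<le>2 ^ (m - r). psum \<xi> i \<le> 1 / real (Suc n) / 2 ^ m * i} \<ge> 1 / 2"
    using prob_below_slope[OF pos] by blast
  have "AE \<omega> in M. \<forall>r q. r0 \<le> r \<longrightarrow> \<not> (\<exists>T S. steep_at (Z q \<omega>) (1 / real (Suc n)) r T S)"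
    unfolding AE_all_countable
  proof (intro allI)
    fix r q
    show "AE \<omega> in M. r0 \<le> r \<longrightarrow> \<not> (\<exists>T S. steep_at (Z q \<omega>) (1 / real (Suc n)) r T S)"
    proof (cases "r0 \<le> r")
      case True
      then have "AE \<omega> in M. \<not> (\<exists>T S. steep_at (Z q \<omega>) (1 / real (Suc n)) r T S)"
        by (intro AE_not_steep_at assms r0 pos) auto
      then show ?thesis by eventually_elim simp
    qed simp
  qed
  then show "AE \<omega> in M. \<exists>r0. \<forall>r\<ge>r0. \<forall>q. \<not> (\<exists>T S. steep_at (Z q \<omega>) (1 / real (Suc n)) r T S)"
    by eventually_elim blast
qed

lemma no_steep_max:
  assumes "\<forall>n. \<exists>r0. \<forall>r\<ge>r0. \<forall>q. \<not> (\<exists>T S. steep_at (\<lambda>s. f (of_rat q + \<sigma> * s) - f (of_rat q)) (1 / real (Suc n)) r T S)"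
    and "cadlag f" "\<sigma> = 1 \<or> \<sigma> = - 1"
  shows "\<not> (steep f (- \<sigma>) p \<and> side_max f \<sigma> p)"
proof
  assume "steep f (- \<sigma>) p \<and> side_max f \<sigma> p"
  then obtain n r1 where r1: "\<forall>r\<ge>r1. \<exists>q::rat. \<exists>T S.
    steep_at (\<lambda>s. f (of_rat q + \<sigma> * s) - f (of_rat q)) (1 / real (Suc n)) r T S"
    using steep_imp_steep_at[OF assms(2) _ _ assms(3)] by blast
  obtain r0 where r0: "\<forall>r\<ge>r0. \<forall>q. \<not> (\<exists>T S.
    steep_at (\<lambda>s. f (of_rat q + \<sigma> * s) - f (of_rat q)) (1 / real (Suc n)) r T S)" using assms(1) by blast
  show False using r0[rule_format, of "max r0 r1"] r1[rule_format, of "max r0 r1"] by auto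
qed

lemma AE_no_left_steep_max:
  assumes "\<And>r. nonpos_prob r = 0"
  shows "AE \<omega> in M. \<forall>p. \<not> (steep (X \<omega>) (- 1) p \<and> side_max (X \<omega>) 1 p)"
proof -
  let ?Z = "\<lambda>q \<omega> s. X \<omega> (of_rat q + 1 * s) - X \<omega> (of_rat q)"
  have "AE \<omega> in M. \<forall>n. \<exists>r0. \<forall>r\<ge>r0. \<forall>q.
      \<not> (\<exists>T S. steep_at (?Z q \<omega>) (1 / real (Suc n)) r T S)"
  proof (rule AE_no_steep_path)
    fix q m and P :: "(nat \<Rightarrow> real) \<Rightarrow> bool" assume P: "Measurable.pred SB P"
    have "inc_seq (?Z q \<omega>) m = (\<lambda>i. grid_inc (X \<omega>) m (of_rat q) (0 + int i))" for \<omega>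
      by (auto simp: inc_seq_def grid_inc_def add_ac)
    then show "prob {\<omega> \<in> space M. P (inc_seq (?Z q \<omega>) m)} = G.S.prob m {\<xi>. P \<xi>}"
      by (simp only: prob_grid[OF inj_fwd P])
  qed (use assms in auto)
  then show ?thesis using cadlag
    by eventually_elim (intro allI no_steep_max; simp)
qed

text \<open>Seen leftwards from \<open>q\<close>, the path has the grid law of \<open>- X\<close>;
  hence both the hypothesis and the instance used concern the negated process.\<close>

lemma AE_no_right_steep_max:
  assumes stay0: "\<And>r. levy.nonpos_prob M (\<lambda>\<omega> x. - X \<omega> x) r = 0"
  shows "AE \<omega> in M. \<forall>p. \<not> (steep (X \<omega>) 1 p \<and> side_max (X \<omega>) (- 1) p)"
proof -
  let ?Z = "\<lambda>q \<omega> s. X \<omega> (of_rat q + - 1 * s) - X \<omega> (of_rat q)"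
  interpret neg: levy M "\<lambda>\<omega> x. - X \<omega> x" by (rule levy_uminus)
  have "AE \<omega> in M. \<forall>n. \<exists>r0. \<forall>r\<ge>r0. \<forall>q.
      \<not> (\<exists>T S. steep_at (?Z q \<omega>) (1 / real (Suc n)) r T S)"
  proof (rule neg.AE_no_steep_path)
    fix q m and P :: "(nat \<Rightarrow> real) \<Rightarrow> bool" assume P: "Measurable.pred SB P"
    have "inc_seq (?Z q \<omega>) m = (\<lambda>i. grid_inc (\<lambda>x. - X \<omega> x) m (of_rat q) (- int i - 1))" for \<omega>
      by (auto simp: inc_seq_def grid_inc_def algebra_simps add_divide_distrib diff_divide_distrib)
    then show "prob {\<omega> \<in> space M. P (inc_seq (?Z q \<omega>) m)} = neg.G.S.prob m {\<xi>. P \<xi>}"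
      by (simp only: neg.prob_grid[OF inj_bwd P])
  qed (use stay0 in auto)
  then show ?thesis using cadlag
  proof eventually_elim
    case (elim \<omega>)
    then show ?case using no_steep_max[of "X \<omega>" "- 1"] by simp
  qed
qed

end

section \<open>Regularity for the open half-lines\<close>

lemma (in prob_space) prob_card_ge_le:
  assumes A: "\<And>k. k \<in> J \<Longrightarrow> A k \<in> events" and "finite J"
    and E: "E \<in> events" "\<And>\<omega>. \<omega> \<in> E \<Longrightarrow> n \<le> card {k \<in> J. \<omega> \<in> A k}"
  shows "real n * prob E \<le> (\<Sum>k\<in>J. prob (A k))"
proof -
  have int: "integrable M (indicator B :: 'a \<Rightarrow> real)" if "B \<in> events" for B
    using that by (simp add: integrable_indicator_iff emeasure_eq_measure)
  have "real n * prob E = (\<integral>\<omega>. real n * indicator E \<omega> \<partial>M)"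
    using E(1) by simp
  also have "\<dots> \<le> (\<integral>\<omega>. (\<Sum>k\<in>J. indicator (A k) \<omega>) \<partial>M)"
  proof (rule integral_mono)
    fix \<omega> assume "\<omega> \<in> space M"
    have "(\<Sum>j\<in>J. indicator (A j) \<omega>) = real (card {j \<in> J. \<omega> \<in> A j})"
      using \<open>finite J\<close> by (simp add: indicator_def sum.If_cases Int_def)
    then show "real n * indicator E \<omega> \<le> (\<Sum>j\<in>J. indicator (A j) \<omega>)"
      using E(2)[of \<omega>] by (auto simp: indicator_def)
  qed (use int A E in \<open>auto intro!: Bochner_Integration.integrable_sum\<close>)
  also have "\<dots> = (\<Sum>k\<in>J. \<integral>\<omega>. indicator (A k) \<omega> \<partial>M)"
    by (rule Bochner_Integration.integral_sum) (use A int in auto)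
  also have "\<dots> = (\<Sum>k\<in>J. prob (A k))"
    using A by (intro sum.cong) auto
  finally show ?thesis .
qed

lemma finite_grid: "finite {k::nat. real k / 2 ^ m < c}"
proof (rule finite_subset)
  show "{k::nat. real k / 2 ^ m < c} \<subseteq> {..nat \<lceil>c * 2 ^ m\<rceil>}"
  proof
    fix k :: nat assume "k \<in> {k. real k / 2 ^ m < c}"
    then have "real k < c * 2 ^ m" by (simp add: divide_less_eq)
    then show "k \<in> {..nat \<lceil>c * 2 ^ m\<rceil>}" by simp linarith
  qed
qed auto

lemma grid_refine: "m0 \<le> m \<Longrightarrow> real k / 2 ^ m0 = real (k * 2 ^ (m - m0)) / 2 ^ m"
  by (simp only: of_nat_mult real_two_power_diff) simp

text \<open>Right continuity keeps the path below the value at \<open>?s\<close> on a shorter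
  initial stretch. By induction that stretch has \<open>n\<close> records on fine grids, and the
  first maximum up to \<open>?s\<close> is one more.\<close>

lemma many_records:
  assumes cont: "(z \<longlongrightarrow> z 0) (at_right 0)"
    and up: "\<And>\<epsilon>. 0 < \<epsilon> \<Longrightarrow> \<exists>m k::nat. real k / 2 ^ m < \<epsilon> \<and> z 0 < z (real k / 2 ^ m)"
  shows "0 < \<epsilon> \<Longrightarrow> \<exists>m0. \<forall>m\<ge>m0. n \<le> card {k. real k / 2 ^ m < \<epsilon> \<and> strict_record 0 k (inc_seq z m)}"
proof (induction n arbitrary: \<epsilon>)
  case (Suc n)
  obtain m1 k0 where k0: "real k0 / 2 ^ m1 < \<epsilon>" "z 0 < z (real k0 / 2 ^ m1)" using up[OF Suc.prems] by blast
  let ?s = "real k0 / 2 ^ m1"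
  have "?s \<noteq> 0" using k0(2) by force
  then have s0: "0 < ?s" by simp
  obtain b where b: "b > 0" "\<forall>y>0. y < b \<longrightarrow> z y < z ?s"
    using order_tendstoD(2)[OF cont k0(2)] unfolding eventually_at_right_field by blast
  define \<epsilon>' where "\<epsilon>' = min b ?s"
  have e': "0 < \<epsilon>'" using b s0 by (simp add: \<epsilon>'_def)
  have small: "z y < z ?s" if "0 \<le> y" "y < \<epsilon>'" for y
    using that b k0(2) by (cases "y = 0") (auto simp: \<epsilon>'_def)
  obtain m2 where m2: "\<forall>m\<ge>m2. n \<le> card {k. real k / 2 ^ m < \<epsilon>' \<and> strict_record 0 k (inc_seq z m)}"
    using Suc.IH[OF e'] by blast
  show ?case
  proof (rule exI[of _ "max m1 m2"], intro allI impI)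
    fix m assume m: "max m1 m2 \<le> m"
    define K where "K = k0 * 2 ^ (m - m1)"
    have sK: "?s = real K / 2 ^ m" unfolding K_def using m by (intro grid_refine) auto
    obtain k where k: "k \<le> K" "\<forall>i\<le>K. z (real i / 2 ^ m) \<le> z (real k / 2 ^ m)" "\<forall>i<k. z (real i / 2 ^ m) < z (real k / 2 ^ m)"
      using exists_first_max[of K "\<lambda>i. z (real i / 2 ^ m)"] by blast
    let ?R = "\<lambda>e. {k. real k / 2 ^ m < e \<and> strict_record 0 k (inc_seq z m)}"
    have fin: "finite (?R e)" for e by (rule finite_subset[OF _ finite_grid[of m e]]) auto
    have "z ?s \<le> z (real k / 2 ^ m)" using k(2) unfolding sK by blast
    then have k1: "k \<notin> ?R \<epsilon>'" using small[of "real k / 2 ^ m"] by auto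
    have "real k / 2 ^ m \<le> ?s" unfolding sK using k(1) by (intro divide_right_mono) auto
    then have "k \<in> ?R \<epsilon>" using k0(1) k(3) by (auto simp: strict_record_def psum_inc_seq)
    moreover have "?R \<epsilon>' \<subseteq> ?R \<epsilon>" using k0(1) by (auto simp: \<epsilon>'_def)
    ultimately have "card (insert k (?R \<epsilon>')) \<le> card (?R \<epsilon>)" using fin by (intro card_mono) auto
    moreover have "card (insert k (?R \<epsilon>')) = Suc (card (?R \<epsilon>'))" using k1 fin by simp
    moreover have "n \<le> card (?R \<epsilon>')" using m2 m by auto
    ultimately show "Suc n \<le> card (?R \<epsilon>)" by linarith
  qed
qed auto

context levy
begin

lemma prob_inc_seq:
  assumes P: "Measurable.pred SB P"
  shows "prob {\<omega> \<in> space M. P (inc_seq (X \<omega>) m)} = G.S.prob m {\<xi>. P \<xi>}"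
proof -
  have "inc_seq (X \<omega>) m = (\<lambda>i. grid_inc (X \<omega>) m 0 (0 + int i))" for \<omega>
    by (auto simp: inc_seq_def grid_inc_def add_ac)
  then show ?thesis by (simp only: prob_grid[OF inj_fwd P])
qed

lemma measurable_inc_seq [measurable]: "(\<lambda>\<omega>. inc_seq (X \<omega>) m) \<in> measurable M SB"
  unfolding inc_seq_def by (rule measurable_PiM_single') auto

lemma AE_cadlag_0: "AE \<omega> in M. (X \<omega> \<longlongrightarrow> X \<omega> 0) (at_right 0)"
  using cadlag by eventually_elim (rule cadlagD)

lemma dyadic_stay_mono: "T' \<le> T \<Longrightarrow> (\<And>s. C s \<subseteq> C' s) \<Longrightarrow> dyadic_stay T C \<subseteq> dyadic_stay T' C'"
  unfolding dyadic_stay_def by (auto, meson order_trans subsetD)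

text \<open>A zero-one law obtained by counting records: with probability \<open>a > 0\<close> of
  staying nonpositive, the expected number of driftless records is at most \<open>1 / a\<close> on
  every fine grid, whereas a path that is positive at arbitrarily small dyadic times has arbitrarily
  many.\<close>

lemma AE_dyadic_stay_nonpos:
  assumes pos: "nonpos_prob r > 0"
  shows "AE \<omega> in M. \<exists>r. \<omega> \<in> dyadic_stay (1 / 2 ^ r) (\<lambda>_. {..0})"
proof (rule AE_liminfI, goal_cases)
  case (1 e)
  define a where "a = nonpos_prob r"
  have "a > 0" using pos by (simp add: a_def)
  \<comment> \<open>Makes the bound \<open>1 / (n * a)\<close> on the probability of
    \<open>n\<close> records smaller than \<open>e\<close>.\<close>
  obtain n :: nat where n: "1 / (a * e) < n" using reals_Archimedean2 by blast
  then have n': "1 < n * (a * e)" using \<open>a > 0\<close> \<open>0 < e\<close> by (simp add: divide_less_eq)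
  define A where "A = (\<lambda>m. {\<omega> \<in> space M. real n \<le> (\<Sum>k\<le>2 ^ (m - r). if strict_record 0 k (inc_seq (X \<omega>) m) then 1 else 0)})"
  have A: "A m \<in> events" for m unfolding A_def by measurable
  have card_eq: "(\<Sum>k\<le>K. if strict_record 0 k \<xi> then 1 else 0 :: real) = card {k \<in> {..K}. strict_record 0 k \<xi>}" for K \<xi>
    by (simp add: sum.If_cases Int_def)
  have pA: "prob (A m) \<le> e" if "m \<ge> r" for m
  proof -
    let ?NR = "G.S.prob m {\<xi>. \<forall>i\<le>2 ^ (m - r). psum \<xi> i \<le> 0 * real i}"
    have "{\<xi>. \<forall>i\<le>2 ^ (m - r). psum \<xi> i \<le> 0 * real i} = {\<xi>. stay m (1 / 2 ^ r) (\<lambda>_. {..0}) \<xi>}"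
      using that by (auto simp: stay_def grid_le_iff)
    then have NR: "a \<le> ?NR" unfolding a_def using prob_stay_tendsto(3)[of "\<lambda>_. {..0}" "1 / 2 ^ r" m] by simp
    have "real n * prob (A m) \<le> (\<Sum>k\<le>2 ^ (m - r). prob {\<omega> \<in> space M. strict_record 0 k (inc_seq (X \<omega>) m)})"
      using A by (intro prob_card_ge_le) (auto simp: A_def card_eq)
    also have "\<dots> = (\<Sum>k\<le>2 ^ (m - r). G.S.prob m {\<xi>. strict_record 0 k \<xi>})"
      by (intro sum.cong refl prob_inc_seq) measurable
    finally have "real n * prob (A m) * a \<le> (\<Sum>k\<le>2 ^ (m - r). G.S.prob m {\<xi>. strict_record 0 k \<xi>}) * ?NR"
      using NR \<open>a > 0\<close> by (intro mult_mono) (auto intro!: sum_nonneg)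
    also have "\<dots> \<le> 1" by (rule G.sum_prob_record)
    finally have "real n * prob (A m) * a < real n * e * a" using n' by (simp add: algebra_simps)
    then have "real n * prob (A m) < real n * e" using \<open>a > 0\<close> by (simp only: mult_less_cancel_right_pos)
    then show ?thesis by (cases "n = 0") (auto simp: mult_less_cancel_left)
  qed
  have ae: "AE \<omega> in M. \<not> (\<exists>r. \<omega> \<in> dyadic_stay (1 / 2 ^ r) (\<lambda>_. {..0})) \<longrightarrow> (\<exists>k. \<forall>n\<ge>k. \<omega> \<in> A n)"
    using AE_cadlag_0 AE_space
  proof eventually_elim
    case (elim \<omega>)
    show ?case
    proof
      assume no: "\<not> (\<exists>r. \<omega> \<in> dyadic_stay (1 / 2 ^ r) (\<lambda>_. {..0}))"
      have up: "\<exists>m k::nat. real k / 2 ^ m < \<epsilon> \<and> X \<omega> 0 < X \<omega> (real k / 2 ^ m)" if "\<epsilon> > 0" for \<epsilon>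
      proof -
        obtain r where r: "1 / 2 ^ r < \<epsilon>" using eventually_grid_small[OF \<open>\<epsilon> > 0\<close>] by blast
        have "\<omega> \<notin> dyadic_stay (1 / 2 ^ r) (\<lambda>_. {..0})" using no by blast
        then obtain m k where "real k / 2 ^ m \<le> 1 / 2 ^ r" "X \<omega> 0 < X \<omega> (real k / 2 ^ m)"
          using elim(2) unfolding dyadic_stay_def by (auto simp: not_le)
        then show ?thesis using r by (intro exI[of _ m] exI[of _ k]) auto
      qed
      have "0 < (1::real) / 2 ^ r" by simp
      from many_records[of "X \<omega>", OF elim(1) up this, of n]
      obtain m0 where m0: "\<forall>m\<ge>m0. n \<le> card {k. real k / 2 ^ m < 1 / 2 ^ r \<and> strict_record 0 k (inc_seq (X \<omega>) m)}"
        by blast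
      have "\<omega> \<in> A m" if "max m0 r \<le> m" for m
      proof -
        have "{k. real k / 2 ^ m < 1 / 2 ^ r \<and> strict_record 0 k (inc_seq (X \<omega>) m)} \<subseteq> {k \<in> {..2 ^ (m - r)}. strict_record 0 k (inc_seq (X \<omega>) m)}"
          using that grid_le_iff[of r m] by (auto dest: less_imp_le)
        then have "card {k. real k / 2 ^ m < 1 / 2 ^ r \<and> strict_record 0 k (inc_seq (X \<omega>) m)} \<le> card {k \<in> {..2 ^ (m - r)}. strict_record 0 k (inc_seq (X \<omega>) m)}"
          by (intro card_mono) auto
        then have "n \<le> card {k \<in> {..2 ^ (m - r)}. strict_record 0 k (inc_seq (X \<omega>) m)}" using m0 that by (meson max.boundedE order_trans)
        then show ?thesis unfolding A_def card_eq using elim(2) by simp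
      qed
      then show "\<exists>k. \<forall>n\<ge>k. \<omega> \<in> A n" by blast
    qed
  qed
  show ?case
    by (rule exI[of _ A], rule exI[of _ r], intro conjI allI impI A pA ae)
qed

lemma prob_dyadic_stay_nonpos_large:
  assumes pos: "nonpos_prob r > 0" and "e > 0"
  shows "\<exists>r0. \<forall>r\<ge>r0. nonpos_prob r > 1 - e"
proof -
  let ?O = "\<lambda>r::nat. dyadic_stay (1 / 2 ^ r) (\<lambda>_. {..0})"
  have "AE \<omega> in M. \<omega> \<in> (\<Union>r. ?O r)" using AE_dyadic_stay_nonpos[OF pos] by eventually_elim blast
  then have "prob (\<Union>r. ?O r) = 1" by (subst prob_eq_1) auto
  moreover have "(\<lambda>r. prob (?O r)) \<longlonglongrightarrow> prob (\<Union>r. ?O r)"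
  proof (rule finite_Lim_measure_incseq)
    show "incseq ?O" unfolding incseq_def
      by (intro allI impI dyadic_stay_mono) (auto simp: frac_le power_increasing)
  qed auto
  ultimately show ?thesis
    using order_tendstoD(1)[of _ 1 sequentially "1 - e"] \<open>0 < e\<close> by (simp add: eventually_sequentially)
qed

end

section \<open>Returns to the initial maximum on both sides of a fixed time\<close>

lemma psum_Suc: "psum \<xi> (Suc k) = psum \<xi> k + \<xi> k"
  by (simp add: psum_def)

text \<open>The \<open>L\<close> cells to the right of grid point \<open>C\<close> come first, then
  those to its left, read leftwards. A stopping rule in the second phase may thus use the whole
  right part, and the cells still to come are fresh.\<close>

definition fold_index :: "nat \<Rightarrow> nat \<Rightarrow> nat \<Rightarrow> int" where
  "fold_index C L i = (if i < L then int C + int i else int C - 1 - int (i - L))"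

lemma inj_fold_index: "inj (fold_index C L)"
  by (auto simp: inj_def fold_index_def split: if_splits)

lemma psum_fold_index_fwd:
  "k \<le> L \<Longrightarrow> psum (\<lambda>i. grid_inc f m 0 (fold_index C L i)) k = f (real (C + k) / 2 ^ m) - f (real C / 2 ^ m)"
proof -
  assume "k \<le> L"
  then have "psum (\<lambda>i. grid_inc f m 0 (fold_index C L i)) k = psum (\<lambda>i. grid_inc f m 0 (int C + int i)) k"
    by (intro psum_cong) (auto simp: fold_index_def)
  then show ?thesis by (simp add: psum_grid_inc)
qed

lemma psum_fold_index_bwd:
  "psum (\<lambda>i. grid_inc f m 0 (fold_index C L i)) (L + i) =
    psum (\<lambda>i. grid_inc f m 0 (fold_index C L i)) L + f (real C / 2 ^ m) - f ((real C - real i) / 2 ^ m)"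
  by (induction i) (auto simp: psum_Suc fold_index_def grid_inc_def algebra_simps diff_divide_distrib add_divide_distrib)

context levy
begin

text \<open>Reveal the path to the right of \<open>c\<close>, then walk left from \<open>c\<close>
  until it first comes within \<open>w\<close> of the maximum seen on the right. If the path returns
  to its initial level on both sides of \<open>c\<close>, then for a further time
  \<open>1 / 2 ^ re\<close> to the left it must not exceed the value found by more than
  \<open>w'\<close>. Those cells are fresh, and \<open>Qp\<close>, regularity for the open lower
  half-line, makes this unlikely.\<close>

lemma AE_no_repeated_max:
  assumes Qp: "\<And>r. levy.nonpos_prob M (\<lambda>\<omega> x. - X \<omega> x) r = 0"
  shows "AE \<omega> in M. \<omega> \<in> dyadic_stay (1 / 2 ^ r0) (\<lambda>_. {..0}) \<longrightarrow>
    \<not> (\<exists>t' t. 1 / 2 ^ re \<le> t' \<and> t' < real jc / 2 ^ mc \<and> real jc / 2 ^ mc < t \<and> t < 1 / 2 ^ r0 \<and> X \<omega> 0 \<le> X \<omega> t' \<and> X \<omega> 0 \<le> X \<omega> t)"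
    (is "AE \<omega> in M. ?Q \<omega>")
proof (cases "real jc / 2 ^ mc < 1 / 2 ^ r0")
  case False
  then show ?thesis by (intro AE_I2) auto
next
  case cr: True
  interpret neg: levy M "\<lambda>\<omega> x. - X \<omega> x" by (rule levy_uminus)
  define c where "c = real jc / 2 ^ mc"
  show ?thesis
  proof (rule AE_liminfI, goal_cases)
    case (1 e)
    obtain w' m0 where w': "w' > 0" and m0: "\<And>m. m \<ge> m0 \<Longrightarrow> neg.stay_prob m (1 / 2 ^ re) (\<lambda>_. {..w'}) \<le> e"
      using neg.prob_stay_below_small[OF Qp \<open>0 < e\<close>] by metis
    \<comment> \<open>One \<open>w\<close> is lost between \<open>X \<omega> 0\<close> and the grid
      maximum on the right, another between that maximum and the stopping position.\<close>
    define w where "w = w' / 2"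
    have w: "w > 0" using w' by (simp add: w_def)
    define C where "C = (\<lambda>m. jc * 2 ^ (m - mc))"
    define L where "L = (\<lambda>m. 2 ^ (m - r0) - C m)"
    \<comment> \<open>\<open>i\<close> is the first leftward distance at which the path is within
      \<open>w\<close> of its grid maximum on the right. Relative to its value at \<open>c\<close>,
      the path at that distance is \<open>psum \<xi> (L m) - psum \<xi> (L m + i)\<close>.\<close>
    define H where "H = (\<lambda>m i \<xi>. (\<forall>k\<le>L m. psum \<xi> k - w \<le> psum \<xi> (L m) - psum \<xi> (L m + i)) \<and>
      (\<forall>i'<i. \<exists>k\<le>L m. psum \<xi> (L m) - psum \<xi> (L m + i') < psum \<xi> k - w))"
    have Hm [measurable]: "Measurable.pred SB (H m i)" for m i
      unfolding H_def not_less[of "psum _ _ - psum _ _" "psum _ _ - w", symmetric] by measurable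
    have Hdep: "depends_on k (H m (k - L m))" if "k \<in> {L m..L m + C m}" for k m
    proof (rule depends_on_psum)
      fix \<xi> \<xi>' assume *: "\<And>i. i \<le> k \<Longrightarrow> psum \<xi> i = psum \<xi>' i"
      have 1: "psum \<xi> k' = psum \<xi>' k'" if "k' \<le> L m" for k' using that \<open>k \<in> {L m..L m + C m}\<close> by (intro *) auto
      have 2: "psum \<xi> (L m + i) = psum \<xi>' (L m + i)" if "i \<le> k - L m" for i
        using that \<open>k \<in> {L m..L m + C m}\<close> by (intro *) auto
      show "H m (k - L m) \<xi> = H m (k - L m) \<xi>'" unfolding H_def by (simp add: 1 2 cong: conj_cong imp_cong)
    qed
    define P where "P = (\<lambda>m \<xi>. \<exists>k\<in>{L m..L m + C m}. H m (k - L m) \<xi> \<and> stay m (1 / 2 ^ re) (\<lambda>_. {- w'..}) (shift_seq k \<xi>))"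
    have [measurable]: "Measurable.pred SB (P m)" for m unfolding P_def by measurable
    define A where "A = (\<lambda>m. {\<omega> \<in> space M. P m (\<lambda>i. grid_inc (X \<omega>) m 0 (fold_index (C m) (L m) i))})"
    have A: "A m \<in> events" for m unfolding A_def by measurable
    have stay_neg: "stay_prob m (1 / 2 ^ re) (\<lambda>_. {- w'..}) = neg.stay_prob m (1 / 2 ^ re) (\<lambda>_. {..w'})" for m
    proof -
      have "{\<omega> \<in> space M. \<forall>k. real k / 2 ^ m \<le> 1 / 2 ^ re \<longrightarrow> X \<omega> (0 + real k / 2 ^ m) - X \<omega> 0 \<in> {- w'..}}
        = {\<omega> \<in> space M. \<forall>k. real k / 2 ^ m \<le> 1 / 2 ^ re \<longrightarrow> - X \<omega> (0 + real k / 2 ^ m) - - X \<omega> 0 \<in> {..w'}}"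
        by (auto simp: algebra_simps)
      from arg_cong[OF this, of prob] show ?thesis
        using prob_stay_at[of "\<lambda>_. {- w'..}" m "1 / 2 ^ re" 0] neg.prob_stay_at[of "\<lambda>_. {..w'}" m "1 / 2 ^ re" 0]
        by (simp only: atLeast_borel atMost_borel)
    qed
    have pA: "prob (A m) \<le> e" if "m \<ge> m0" for m
    proof -
      let ?I = "{L m..L m + C m}"
      have "prob (A m) = G.S.prob m {\<xi>. P m \<xi>}"
        unfolding A_def by (rule prob_grid[OF inj_fold_index]) measurable
      also have "\<dots> \<le> (\<Sum>k\<in>?I. G.S.prob m {\<xi>. H m (k - L m) \<xi>}) * stay_prob m (1 / 2 ^ re) (\<lambda>_. {- w'..})"
        unfolding P_def by (rule G.prob_ex_split_le) (auto intro: Hdep)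
      also have "\<dots> \<le> 1 * stay_prob m (1 / 2 ^ re) (\<lambda>_. {- w'..})"
      proof (rule mult_right_mono)
        \<comment> \<open>First times are unique, so disjointness holds already with the trivial
          second event.\<close>
        have "(\<Sum>k\<in>?I. G.S.prob m {\<xi>. H m (k - L m) \<xi>}) * G.S.prob m {\<xi>. True} \<le> 1"
        proof (rule G.sum_prob_split_le_1)
          fix \<xi> k l assume "k \<in> ?I" "l \<in> ?I" "k < l" and H: "H m (k - L m) \<xi>" "H m (l - L m) \<xi>"
          then have "k - L m < l - L m" by auto
          then obtain k' where "k' \<le> L m" "psum \<xi> (L m) - psum \<xi> (L m + (k - L m)) < psum \<xi> k' - w"
            using H(2) unfolding H_def by blast
          then show False using H(1) unfolding H_def by force
        qed (auto intro: Hdep)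
        then show "(\<Sum>k\<in>?I. G.S.prob m {\<xi>. H m (k - L m) \<xi>}) \<le> 1" using G.S.prob_space[of m] by simp
      qed simp
      also have "\<dots> \<le> e" using m0[OF that] by (simp add: stay_neg)
      finally show ?thesis .
    qed
    have ae: "AE \<omega> in M. \<not> ?Q \<omega> \<longrightarrow> (\<exists>k. \<forall>n\<ge>k. \<omega> \<in> A n)"
      using cadlag AE_space
    proof eventually_elim
      case (elim \<omega>)
      show ?case
      proof
        assume "\<not> ?Q \<omega>"
        then obtain t' t where O: "\<omega> \<in> dyadic_stay (1 / 2 ^ r0) (\<lambda>_. {..0})" and t: "1 / 2 ^ re \<le> t'" "t' < c" "c < t" "t < 1 / 2 ^ r0"
          and Xt: "X \<omega> 0 \<le> X \<omega> t'" "X \<omega> 0 \<le> X \<omega> t" unfolding c_def by blast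
        have near: "\<exists>b>y. \<forall>z. y < z \<and> z < b \<longrightarrow> X \<omega> 0 - w < X \<omega> z" if "X \<omega> 0 \<le> X \<omega> y" for y
        proof -
          have "X \<omega> 0 - w < X \<omega> y" using that w by linarith
          from order_tendstoD(1)[OF cadlagD(1)[OF elim(1)] this] show ?thesis
            unfolding eventually_at_right_field by blast
        qed
        obtain b1 where b1: "b1 > t'" "\<forall>z. t' < z \<and> z < b1 \<longrightarrow> X \<omega> 0 - w < X \<omega> z" using near[OF Xt(1)] by blast
        obtain b2 where b2: "b2 > t" "\<forall>z. t < z \<and> z < b2 \<longrightarrow> X \<omega> 0 - w < X \<omega> z" using near[OF Xt(2)] by blast
        define d1 where "d1 = min b1 c"
        define d2 where "d2 = min b2 (1 / 2 ^ r0)"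
        have d: "t' < d1" "t < d2" using b1 b2 t by (auto simp: d1_def d2_def)
        obtain m1 where m1: "\<forall>m\<ge>m1. 1 / 2 ^ m < d1 - t'" using eventually_grid_small[of "d1 - t'"] d by auto
        obtain m2 where m2: "\<forall>m\<ge>m2. 1 / 2 ^ m < d2 - t" using eventually_grid_small[of "d2 - t"] d by auto
        have Ole: "X \<omega> (real k / 2 ^ m) \<le> X \<omega> 0" if "real k / 2 ^ m \<le> 1 / 2 ^ r0" for k m
          using O that unfolding dyadic_stay_def by (auto simp: algebra_simps)
        have "\<omega> \<in> A m" if m: "m \<ge> Max {m1, m2, mc, r0}" for m
        proof -
          from m have mm: "m1 \<le> m" "m2 \<le> m" "mc \<le> m" "r0 \<le> m" by auto
          have cC: "c = real (C m) / 2 ^ m" unfolding c_def C_def using mm by (intro grid_refine)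
          have CL: "real (C m) < 2 ^ (m - r0)"
          proof -
            have "real (C m) / 2 ^ m < 1 / 2 ^ r0" using cr unfolding cC[symmetric] c_def .
            then have "real (C m) < 2 ^ m / 2 ^ r0" by (simp add: divide_less_eq)
            then show ?thesis using real_two_power_diff[OF mm(4)] by simp
          qed
          then have "C m < 2 ^ (m - r0)" by (metis of_nat_less_iff of_nat_numeral of_nat_power)
          then have LC: "C m + L m = 2 ^ (m - r0)" unfolding L_def by simp
          have t0: "0 < t'" using t(1) by (rule less_le_trans[rotated]) simp
          obtain k1 where k1: "t' < real k1 / 2 ^ m" "real k1 / 2 ^ m < d1"
            using exists_grid_point[of t' m d1] m1 mm t0 by auto
          obtain k2 where k2: "t < real k2 / 2 ^ m" "real k2 / 2 ^ m < d2"
            using exists_grid_point[of t m d2] m2 mm t0 t by auto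
          define \<xi> where "\<xi> = (\<lambda>i. grid_inc (X \<omega>) m 0 (fold_index (C m) (L m) i))"
          let ?c = "real (C m) / 2 ^ m"
          have fw: "psum \<xi> k = X \<omega> (real (C m + k) / 2 ^ m) - X \<omega> c" if "k \<le> L m" for k
            unfolding \<xi>_def cC using that by (rule psum_fold_index_fwd)
          have bw: "psum \<xi> (L m + i) = psum \<xi> (L m) + X \<omega> c - X \<omega> ((real (C m) - real i) / 2 ^ m)" for i
            unfolding \<xi>_def cC by (rule psum_fold_index_bwd)
          have fw_le: "psum \<xi> k \<le> X \<omega> 0 - X \<omega> c" if "k \<le> L m" for k
          proof -
            have "C m + k \<le> 2 ^ (m - r0)" using that LC by linarith
            then have "real (C m + k) / 2 ^ m \<le> 1 / 2 ^ r0" using grid_le_iff[OF mm(4)] by blast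
            from Ole[OF this] show ?thesis using fw[OF that] by simp
          qed
          have k1c: "k1 < C m"
          proof -
            have "real k1 / 2 ^ m < real (C m) / 2 ^ m" using k1(2) unfolding cC[symmetric] d1_def by simp
            then show ?thesis by (simp add: divide_less_cancel)
          qed
          have k2c: "C m < k2" "k2 - C m \<le> L m"
          proof -
            have "real (C m) / 2 ^ m < real k2 / 2 ^ m" using k2(1) t(3) unfolding cC[symmetric] by simp
            then show "C m < k2" by (simp add: divide_less_cancel)
            have "real k2 / 2 ^ m \<le> 1 / 2 ^ r0" using k2(2) by (simp add: d2_def)
            then have "k2 \<le> 2 ^ (m - r0)" using grid_le_iff[OF mm(4)] by blast
            then show "k2 - C m \<le> L m" using LC by linarith
          qed
          define Rg where "Rg = (\<lambda>i. psum \<xi> (L m) - psum \<xi> (L m + i))"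
          have Rg: "Rg i = X \<omega> ((real (C m) - real i) / 2 ^ m) - X \<omega> c" for i unfolding Rg_def bw by simp
          have Rg_le: "Rg i \<le> X \<omega> 0 - X \<omega> c" if "i \<le> C m" for i
          proof -
            have eq: "(real (C m) - real i) / 2 ^ m = real (C m - i) / 2 ^ m" using that by (simp add: of_nat_diff)
            have "C m - i \<le> 2 ^ (m - r0)" using LC by linarith
            then have "real (C m - i) / 2 ^ m \<le> 1 / 2 ^ r0" using grid_le_iff[OF mm(4)] by blast
            from Ole[OF this] show ?thesis unfolding Rg eq by simp
          qed
          let ?S = "\<lambda>i. \<forall>k\<le>L m. psum \<xi> k - w \<le> Rg i"
          have "X \<omega> 0 - w < X \<omega> (real k1 / 2 ^ m)" using b1 k1 by (auto simp: d1_def)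
          moreover have "Rg (C m - k1) = X \<omega> (real k1 / 2 ^ m) - X \<omega> c" unfolding Rg using k1c by (simp add: of_nat_diff)
          ultimately have Sk1: "?S (C m - k1)" using fw_le by (auto intro: order_trans[of _ "X \<omega> 0 - X \<omega> c - w"])
          define i where "i = (LEAST i. ?S i)"
          have Si: "?S i" unfolding i_def using Sk1 by (rule LeastI)
          have i_le: "i \<le> C m - k1" unfolding i_def using Sk1 by (rule Least_le)
          have "\<not> ?S i'" if "i' < i" for i' using that unfolding i_def by (rule not_less_Least)
          then have "\<exists>k\<le>L m. Rg i' < psum \<xi> k - w" if "i' < i" for i' using that by (meson not_le)
          then have H: "H m i \<xi>" unfolding H_def using Si unfolding Rg_def by blast
          have big: "Rg i > X \<omega> 0 - X \<omega> c - w'"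
          proof -
            have "X \<omega> 0 - w < X \<omega> (real k2 / 2 ^ m)" using b2 k2 by (auto simp: d2_def)
            moreover have "psum \<xi> (k2 - C m) = X \<omega> (real k2 / 2 ^ m) - X \<omega> c" using fw[OF k2c(2)] k2c(1) by simp
            moreover have "psum \<xi> (k2 - C m) - w \<le> Rg i" using Si k2c(2) by blast
            ultimately show ?thesis by (simp add: w_def)
          qed
          \<comment> \<open>The stopping position is not to the left of \<open>k1\<close>, whose
            time exceeds \<open>1 / 2 ^ re\<close>; a leftward stay of that length does not pass
            time 0, so the bound by \<open>X \<omega> 0\<close> applies throughout.\<close>
          have "stay m (1 / 2 ^ re) (\<lambda>_. {- w'..}) (shift_seq (L m + i) \<xi>)"
            unfolding stay_def
          proof (intro allI impI)
            fix k assume k: "real k / 2 ^ m \<le> 1 / 2 ^ re"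
            then have "real k / 2 ^ m < real k1 / 2 ^ m" using k1 t by linarith
            then have "k < k1" by (simp add: divide_less_cancel)
            then have "i + k \<le> C m" using i_le k1c by linarith
            then have "Rg (i + k) \<le> X \<omega> 0 - X \<omega> c" by (rule Rg_le)
            moreover have "psum (shift_seq (L m + i) \<xi>) k = Rg i - Rg (i + k)"
              unfolding psum_shift Rg_def by (simp add: add.assoc)
            ultimately show "psum (shift_seq (L m + i) \<xi>) k \<in> {- w'..}" using big by simp
          qed
          then have "P m \<xi>" unfolding P_def using H i_le by (intro bexI[of _ "L m + i"]) auto
          then show "\<omega> \<in> A m" unfolding A_def \<xi>_def using elim(2) by simp
        qed
        then show "\<exists>k. \<forall>n\<ge>k. \<omega> \<in> A n" by blast
      qed
    qed
    show ?case
      by (rule exI[of _ A], rule exI[of _ m0], intro conjI allI impI A pA ae)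
  qed
qed

text \<open>Regularity for the closed upper half-line enters here: on the event of staying
  nonpositive it gives two distinct returns to level 0, separated by some dyadic time. If 0 were
  regular for the open lower half-line, this would almost surely not happen.\<close>

lemma prob_dyadic_stay_nonneg_pos:
  assumes pos: "nonpos_prob r0 > 0"
  shows "\<exists>r. levy.nonpos_prob M (\<lambda>\<omega> x. - X \<omega> x) r > 0"
proof (rule ccontr)
  assume "\<not> ?thesis"
  then have Qp: "levy.nonpos_prob M (\<lambda>\<omega> x. - X \<omega> x) r = 0" for r
    using measure_nonneg[of M] by (metis not_less order_antisym)
  have "AE \<omega> in M. \<forall>re jc mc. \<omega> \<in> dyadic_stay (1 / 2 ^ r0) (\<lambda>_. {..0}) \<longrightarrow>
    \<not> (\<exists>t' t. 1 / 2 ^ re \<le> t' \<and> t' < real jc / 2 ^ mc \<and> real jc / 2 ^ mc < t \<and> t < 1 / 2 ^ r0 \<and> X \<omega> 0 \<le> X \<omega> t' \<and> X \<omega> 0 \<le> X \<omega> t)"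
    unfolding AE_all_countable by (intro allI AE_no_repeated_max Qp)
  then have "AE \<omega> in M. \<omega> \<notin> dyadic_stay (1 / 2 ^ r0) (\<lambda>_. {..0})"
    using reg_nonneg zero
  proof eventually_elim
    case (elim \<omega>)
    show ?case
    proof
      assume O: "\<omega> \<in> dyadic_stay (1 / 2 ^ r0) (\<lambda>_. {..0})"
      obtain t where t: "0 < t" "t < 1 / 2 ^ r0" "X \<omega> t \<ge> 0"
        using elim(2)[rule_format, of "1 / 2 ^ r0"] by auto
      obtain t' where t': "0 < t'" "t' < t" "X \<omega> t' \<ge> 0"
        using elim(2)[rule_format, of t] t by auto
      obtain re :: nat where re: "1 / 2 ^ re < t'" using eventually_grid_small[OF t'(1)] by blast
      obtain mc :: nat where mc: "1 / 2 ^ mc < t - t'" using eventually_grid_small[of "t - t'"] t' by auto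
      obtain jc :: nat where jc: "t' < real jc / 2 ^ mc" "real jc / 2 ^ mc < t"
        using exists_grid_point[of t' mc t] t' mc by auto
      show False
        using elim(1)[rule_format, of re jc mc] O t t' re jc elim(3) by (metis less_imp_le)
    qed
  qed
  then have "nonpos_prob r0 = 0"
    by (subst (asm) AE_iff_measurable[of "dyadic_stay (1 / 2 ^ r0) (\<lambda>_. {..0})"])
       (auto simp: dyadic_stay_def measure_def)
  with pos show False by simp
qed

text \<open>Failure of regularity for one open half-line implies failure for the other, by the
  preceding fact for \<open>X\<close> or \<open>- X\<close>. For large \<open>r\<close> both
  one-sided stays then have probability above 1/2, so they overlap, and on the overlap the path is
  constant at dyadic times.\<close>

lemma flat_or_strictly_regular:
  "(\<exists>r. prob (dyadic_stay (1 / 2 ^ r) (\<lambda>_. {0})) > 0) \<or>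
   (\<forall>r. nonpos_prob r = 0 \<and>
        levy.nonpos_prob M (\<lambda>\<omega> x. - X \<omega> x) r = 0)"
proof -
  interpret neg: levy M "\<lambda>\<omega> x. - X \<omega> x" by (rule levy_uminus)
  have flat: "\<exists>r. prob (dyadic_stay (1 / 2 ^ r) (\<lambda>_. {0})) > 0"
    if 1: "nonpos_prob r1 > 0" and 2: "neg.nonpos_prob r2 > 0" for r1 r2
  proof -
    obtain s1 where s1: "\<forall>r\<ge>s1. nonpos_prob r > 1 - 1 / 2"
      using prob_dyadic_stay_nonpos_large[OF 1, of "1 / 2"] by auto
    obtain s2 where s2: "\<forall>r\<ge>s2. neg.nonpos_prob r > 1 - 1 / 2"
      using neg.prob_dyadic_stay_nonpos_large[OF 2, of "1 / 2"] by auto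
    define r where "r = max s1 s2"
    let ?A = "dyadic_stay (1 / 2 ^ r) (\<lambda>_. {..0})" and ?B = "neg.dyadic_stay (1 / 2 ^ r) (\<lambda>_. {..0})"
    have "prob (?A \<union> ?B) = prob ?A + prob (?B - ?A)" by (rule finite_measure_Union') auto
    moreover have "prob (?B - ?A) = prob ?B - prob (?B \<inter> ?A)" by (rule finite_measure_Diff') auto
    moreover have "prob (?A \<union> ?B) \<le> 1" by (rule prob_le_1)
    ultimately have "prob (?B \<inter> ?A) > 0" using s1[rule_format, of r] s2[rule_format, of r] by (auto simp: r_def)
    also have "prob (?B \<inter> ?A) \<le> prob (dyadic_stay (1 / 2 ^ r) (\<lambda>_. {0}))"
      by (rule finite_measure_mono) (auto simp: dyadic_stay_def neg.dyadic_stay_def intro: antisym)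
    finally show ?thesis by blast
  qed
  have 3: "nonpos_prob r = 0 \<or> nonpos_prob r > 0" for r
    using zero_less_measure_iff by blast
  have 4: "neg.nonpos_prob r = 0 \<or> neg.nonpos_prob r > 0" for r
    using zero_less_measure_iff by blast
  have 5: "neg.nonpos_prob r > 0 \<Longrightarrow> \<exists>r. nonpos_prob r > 0" for r
    using neg.prob_dyadic_stay_nonneg_pos[of r] by simp
  show ?thesis using 3 4 5 flat prob_dyadic_stay_nonneg_pos by meson
qed

end

section \<open>Paths below a parabola\<close>

text \<open>One-sided limits bound the path near every point, and compactness leaves finitely many
  bounds.\<close>

lemma cadlag_bounded_on:
  assumes f: "cadlag f"
  shows "\<exists>B. \<forall>x\<in>{a..b}. \<bar>f x\<bar> \<le> B"
proof -
  have loc: "\<exists>U B. open U \<and> x \<in> U \<and> (\<forall>y\<in>U. \<bar>f y\<bar> \<le> B)" for x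
  proof -
    let ?B = "max (\<bar>f x\<bar> + 1) (\<bar>left_lim f x\<bar> + 1)"
    have "eventually (\<lambda>y. \<bar>f y\<bar> < \<bar>f x\<bar> + 1) (at_right x)"
      by (rule order_tendstoD(2)[OF tendsto_rabs[OF cadlagD(1)[OF f]]]) simp
    moreover have "eventually (\<lambda>y. \<bar>f y\<bar> < \<bar>left_lim f x\<bar> + 1) (at_left x)"
      by (rule order_tendstoD(2)[OF tendsto_rabs[OF cadlagD(2)[OF f]]]) simp
    ultimately have "eventually (\<lambda>y. \<bar>f y\<bar> \<le> ?B) (at x)"
      unfolding eventually_at_split by (auto elim: eventually_mono)
    then have "eventually (\<lambda>y. \<bar>f y\<bar> \<le> ?B) (nhds x)"
      unfolding eventually_at_filter by eventually_elim auto
    then show ?thesis unfolding eventually_nhds by blast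
  qed
  then obtain U B where UB: "\<And>x. open (U x)" "\<And>x. x \<in> U x" "\<And>x y. y \<in> U x \<Longrightarrow> \<bar>f y\<bar> \<le> B x" by metis
  obtain C where C: "C \<subseteq> {a..b}" "finite C" "{a..b} \<subseteq> (\<Union>c\<in>C. U c)"
    by (rule compactE_image[OF compact_Icc[of a b], of "{a..b}" U]) (use UB in auto)
  show ?thesis
  proof (intro exI[of _ "\<Sum>c\<in>C. \<bar>B c\<bar>"] ballI)
    fix x assume "x \<in> {a..b}"
    then obtain c where c: "c \<in> C" "x \<in> U c" using C by blast
    have "\<bar>f x\<bar> \<le> \<bar>B c\<bar>" using UB(3)[OF c(2)] by linarith
    also have "\<dots> \<le> (\<Sum>c\<in>C. \<bar>B c\<bar>)" using C c by (intro member_le_sum) auto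
    finally show "\<bar>f x\<bar> \<le> (\<Sum>c\<in>C. \<bar>B c\<bar>)" .
  qed
qed

lemma quadratic_growth:
  assumes f: "cadlag f" and lim: "((\<lambda>x. f x / x\<^sup>2) \<longlongrightarrow> 0) at_infinity" and "e > 0"
  shows "\<exists>B\<ge>0. \<forall>x. \<bar>f x\<bar> \<le> e * x\<^sup>2 + B"
proof -
  have "eventually (\<lambda>x. \<bar>f x / x\<^sup>2\<bar> < e) at_infinity"
    using tendsto_rabs[OF lim] \<open>e > 0\<close> by (intro order_tendstoD(2)) auto
  then obtain R where R: "\<And>x. norm x \<ge> R \<Longrightarrow> \<bar>f x / x\<^sup>2\<bar> < e"
    unfolding eventually_at_infinity by blast
  define r where "r = max R 1"
  obtain B where B: "\<forall>x\<in>{-r..r}. \<bar>f x\<bar> \<le> B" using cadlag_bounded_on[OF f] by blast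
  have "\<bar>f 0\<bar> \<le> B" using B by (auto simp: r_def)
  then have B0: "B \<ge> 0" by linarith
  show ?thesis
  proof (rule exI[of _ B], intro conjI allI B0)
    fix x
    show "\<bar>f x\<bar> \<le> e * x\<^sup>2 + B"
    proof (cases "x \<in> {-r..r}")
      case True
      then have "\<bar>f x\<bar> \<le> B" using B by blast
      moreover have "0 \<le> e * x\<^sup>2" using \<open>e > 0\<close> by simp
      ultimately show ?thesis by linarith
    next
      case False
      then have x: "\<bar>x\<bar> \<ge> R" "\<bar>x\<bar> > 1" by (auto simp: r_def)
      then have "x\<^sup>2 > 0" by auto
      then have "\<bar>f x\<bar> < e * x\<^sup>2" using R[of x] x by (simp add: divide_less_eq)
      then show ?thesis using B0 by linarith
    qed
  qed
qed

abbreviation sub_parabola :: "real \<Rightarrow> real \<Rightarrow> real set" where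
  "sub_parabola a s \<equiv> {..<s\<^sup>2 / 2 + a}"

text \<open>A path piece of length \<open>q\<close> that can be iterated: it ends no higher than it
  started and stays below \<open>\<eta>\<close> on the way.\<close>

definition dip :: "real \<Rightarrow> real \<Rightarrow> real \<Rightarrow> real set" where
  "dip q \<eta> s = (if s = q then {..0} else {..<\<eta>})"

lemma dip_borel [measurable]: "dip q \<eta> s \<in> sets borel"
  by (simp add: dip_def)

text \<open>The margin is \<open>(\<delta> / 2)\<^sup>2 / 2\<close>: half of the flat stretch is
  given up so that parabolas centred in the other half still lie above the path.\<close>

definition flat_side :: "real \<Rightarrow> real \<Rightarrow> real set" where
  "flat_side \<delta> s = (if s \<le> \<delta> then {0} else {..(s - \<delta>)\<^sup>2 / 2 + \<delta>\<^sup>2 / 8})"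

text \<open>Nothing is asked before \<open>\<delta>\<close>. Beyond it the vertex lies strictly
  below the level of the centre, so the maximum over the gap beats everything outside.\<close>

definition low_side :: "real \<Rightarrow> real \<Rightarrow> real \<Rightarrow> real set" where
  "low_side \<delta> \<kappa> s = (if s < \<delta> then UNIV else {..(s - \<delta>)\<^sup>2 / 2 - \<kappa>})"

lemma side_borel [measurable]: "flat_side \<delta> s \<in> sets borel" "low_side \<delta> \<kappa> s \<in> sets borel"
  by (simp_all add: flat_side_def low_side_def)

context levy
begin

lemma AE_quadratic_growth: "AE \<omega> in M. \<forall>n::nat. \<exists>B\<ge>0. \<forall>x. \<bar>X \<omega> x\<bar> \<le> 1 / Suc n * x\<^sup>2 + B"
  using cadlag hypA
proof eventually_elim
  case (elim \<omega>)
  show ?case by (intro allI quadratic_growth elim) simp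
qed

text \<open>Quadratic growth gives a random additive constant; a large deterministic one suffices
  with probability above 1/2, whatever the horizon.\<close>

lemma prob_stay_quadratic_large:
  "\<exists>\<Lambda>. \<forall>m T. stay_prob m T (sub_parabola \<Lambda>) \<ge> 1 / 2"
proof -
  define Q where "Q = (\<lambda>n::nat. {\<omega> \<in> space M. \<forall>m k. X \<omega> (real k / 2 ^ m) - X \<omega> 0 < (real k / 2 ^ m)\<^sup>2 / 2 + n})"
  have Q [measurable]: "Q n \<in> events" for n unfolding Q_def by measurable
  have "AE \<omega> in M. \<omega> \<in> (\<Union>n. Q n)"
    using AE_quadratic_growth AE_space
  proof eventually_elim
    case (elim \<omega>)
    obtain B where B: "B \<ge> 0" "\<And>x. \<bar>X \<omega> x\<bar> \<le> 1 / Suc 1 * x\<^sup>2 + B" using elim(1) by blast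
    obtain n :: nat where n: "B + B < n" using reals_Archimedean2 by blast
    have "X \<omega> x - X \<omega> 0 < x\<^sup>2 / 2 + n" for x
      using B(2)[of x] B(2)[of 0] n by simp
    then have "\<omega> \<in> Q n" using elim(2) by (simp add: Q_def)
    then show ?case by blast
  qed
  then have "prob (\<Union>n. Q n) = 1" by (subst prob_eq_1) auto
  moreover have "(\<lambda>n. prob (Q n)) \<longlonglongrightarrow> prob (\<Union>n. Q n)"
  proof (rule finite_Lim_measure_incseq)
    show "incseq Q" unfolding incseq_def Q_def by (fastforce intro: less_le_trans)
  qed auto
  ultimately have "eventually (\<lambda>n. prob (Q n) > 1 / 2) sequentially"
    by (intro order_tendstoD(1)) auto
  then obtain n where n: "prob (Q n) > 1 / 2" using eventually_happens by force
  show ?thesis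
  proof (rule exI[of _ "real n"], intro allI)
    fix m T
    have "prob (Q n) \<le> prob (dyadic_stay T (sub_parabola (real n)))"
      by (intro finite_measure_mono) (auto simp: Q_def dyadic_stay_def)
    also have "\<dots> \<le> stay_prob m T (sub_parabola (real n))"
      by (rule prob_stay_tendsto) auto
    finally show "stay_prob m T (sub_parabola (real n)) \<ge> 1 / 2" using n by simp
  qed
qed

text \<open>The length \<open>q\<close> is dyadic so that on fine meshes the junction is a grid
  time, where the two pieces are independent.\<close>

lemma prob_stay_concat:
  assumes [measurable]: "\<And>s. C1 s \<in> sets borel" "\<And>s. C2 s \<in> sets borel" "\<And>s. C s \<in> sets borel"
    and "mq \<le> m" and q: "q = real jq / 2 ^ mq"
    and C1: "\<And>s x. 0 \<le> s \<Longrightarrow> s \<le> q \<Longrightarrow> x \<in> C1 s \<Longrightarrow> x \<in> C s"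
    and C2: "\<And>s x y. 0 < s \<Longrightarrow> x \<in> C1 q \<Longrightarrow> y \<in> C2 s \<Longrightarrow> x + y \<in> C (q + s)"
  shows "stay_prob m q C1 * stay_prob m T C2 \<le> stay_prob m T C"
proof -
  define K where "K = jq * 2 ^ (m - mq)"
  have qK: "q = real K / 2 ^ m" unfolding q K_def using \<open>mq \<le> m\<close> by (rule grid_refine)
  have "stay_prob m q C1 * stay_prob m T C2 = G.S.prob m {\<xi>. stay m q C1 \<xi> \<and> stay m T C2 (shift_seq K \<xi>)}"
    by (rule G.prob_split[symmetric]) (auto intro!: depends_on_stay simp: qK)
  also have "\<dots> \<le> stay_prob m T C"
  proof (rule G.S.finite_measure_mono)
    show "{\<xi>. stay m q C1 \<xi> \<and> stay m T C2 (shift_seq K \<xi>)} \<subseteq> {\<xi>. stay m T C \<xi>}"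
    proof (intro subsetI CollectI, elim CollectE conjE)
      fix \<xi> assume 1: "stay m q C1 \<xi>" and 2: "stay m T C2 (shift_seq K \<xi>)"
      show "stay m T C \<xi>" unfolding stay_def
      proof (intro allI impI)
        fix k assume k: "real k / 2 ^ m \<le> T"
        show "psum \<xi> k \<in> C (real k / 2 ^ m)"
        proof (cases "k \<le> K")
          case True
          then have "real k / 2 ^ m \<le> q" unfolding qK by (simp add: divide_right_mono)
          then show ?thesis using 1 C1 unfolding stay_def by auto
        next
          case False
          define i where "i = k - K"
          have ki: "k = K + i" using False by (simp add: i_def)
          have kh: "real k / 2 ^ m = q + real i / 2 ^ m" unfolding ki qK by (simp add: add_divide_distrib)
          have "real i / 2 ^ m \<le> T" using k kh unfolding qK by (smt (verit) divide_nonneg_nonneg of_nat_0_le_iff zero_le_power)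
          then have "psum (shift_seq K \<xi>) i \<in> C2 (real i / 2 ^ m)" using 2 unfolding stay_def by blast
          moreover have "psum \<xi> K \<in> C1 q" using 1 unfolding stay_def qK by blast
          ultimately have "psum \<xi> K + psum (shift_seq K \<xi>) i \<in> C (q + real i / 2 ^ m)" 
            by (intro C2) (use False in \<open>auto simp: i_def\<close>)
          then show ?thesis unfolding kh by (simp add: psum_shift ki)
        qed
      qed
    qed
  qed (auto intro!: G.sets_SI)
  finally show ?thesis .
qed

text \<open>After a dip of length \<open>q\<close> the parabola has risen:
  \<open>(q + s)\<^sup>2\<close> is at least \<open>q\<^sup>2 + s\<^sup>2\<close>, so the constant
  allowed for the rest of the path grows by \<open>q\<^sup>2 / 2\<close>. Finitely many dips lead
  from \<open>\<eta>\<close> to a constant that is satisfied with probability at least 1/2.\<close>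

lemma prob_stay_quadratic_lower:
  assumes "\<eta> > 0" and q: "q = real jq / 2 ^ mq" "q > 0" and pos: "prob (dyadic_stay q (dip q \<eta>)) > 0"
  shows "\<exists>c>0. \<forall>m\<ge>mq. \<forall>T. c \<le> stay_prob m T (sub_parabola \<eta>)"
proof -
  define \<beta> where "\<beta> = prob (dyadic_stay q (dip q \<eta>))"
  obtain \<Lambda> where \<Lambda>: "\<And>m T. stay_prob m T (sub_parabola \<Lambda>) \<ge> 1 / 2"
    using prob_stay_quadratic_large by blast
  \<comment> \<open>The number of dips after which the constant has grown from \<open>\<eta>\<close>
    to at least \<open>\<Lambda>\<close>.\<close>
  obtain n :: nat where "\<Lambda> / (q\<^sup>2 / 2) < n" using reals_Archimedean2 by blast
  then have n: "\<Lambda> \<le> \<eta> + n * (q\<^sup>2 / 2)" using q \<open>\<eta> > 0\<close> by (simp add: divide_less_eq split: if_splits)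
  have step: "\<beta> * stay_prob m T (sub_parabola (a + q\<^sup>2 / 2)) \<le> stay_prob m T (sub_parabola a)"
    if "mq \<le> m" "\<eta> \<le> a" for a m T
  proof -
    have "\<beta> * stay_prob m T (sub_parabola (a + q\<^sup>2 / 2))
      \<le> stay_prob m q (dip q \<eta>) * stay_prob m T (sub_parabola (a + q\<^sup>2 / 2))"
      unfolding \<beta>_def by (intro mult_right_mono prob_stay_tendsto) auto
    also have "\<dots> \<le> stay_prob m T (sub_parabola a)"
    proof (rule prob_stay_concat[OF _ _ _ \<open>mq \<le> m\<close> q(1)])
      fix s x :: real assume "x \<in> dip q \<eta> s"
      then have "x < \<eta>" using \<open>\<eta> > 0\<close> by (auto simp: dip_def split: if_splits)
      moreover have "0 \<le> s\<^sup>2 / 2" by simp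
      ultimately have "x < s\<^sup>2 / 2 + a" using \<open>\<eta> \<le> a\<close> by linarith
      then show "x \<in> {..<s\<^sup>2 / 2 + a}" by simp
    next
      fix s x y assume s: "0 < s" and "x \<in> dip q \<eta> q" "y \<in> {..<s\<^sup>2 / 2 + (a + q\<^sup>2 / 2)}"
      then have "x + y < s\<^sup>2 / 2 + (a + q\<^sup>2 / 2)" by (simp add: dip_def)
      also have "\<dots> \<le> (q + s)\<^sup>2 / 2 + a" using s q(2) by (simp add: power2_sum field_simps)
      finally show "x + y \<in> {..<(q + s)\<^sup>2 / 2 + a}" by simp
    qed auto
    finally show ?thesis .
  qed
  have iter: "\<beta> ^ i * stay_prob m T (sub_parabola (\<eta> + i * (q\<^sup>2 / 2))) \<le> stay_prob m T (sub_parabola \<eta>)"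
    if "mq \<le> m" for i m T
  proof (induction i)
    case (Suc i)
    have "\<beta> ^ Suc i * stay_prob m T (sub_parabola (\<eta> + real (Suc i) * (q\<^sup>2 / 2)))
      = \<beta> ^ i * (\<beta> * stay_prob m T (sub_parabola ((\<eta> + real i * (q\<^sup>2 / 2)) + q\<^sup>2 / 2)))"
      by (simp add: algebra_simps add_divide_distrib)
    also have "\<dots> \<le> \<beta> ^ i * stay_prob m T (sub_parabola (\<eta> + real i * (q\<^sup>2 / 2)))"
      by (intro mult_left_mono step that) (auto simp: \<beta>_def)
    also note Suc.IH
    finally show ?case .
  qed simp
  show ?thesis
  proof (intro exI[of _ "\<beta> ^ n * (1 / 2)"] conjI allI impI)
    show "0 < \<beta> ^ n * (1 / 2)" using pos by (simp add: \<beta>_def)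
    fix m T assume "mq \<le> m"
    have "1 / 2 \<le> stay_prob m T (sub_parabola \<Lambda>)" by (rule \<Lambda>)
    also have "\<dots> \<le> stay_prob m T (sub_parabola (\<eta> + n * (q\<^sup>2 / 2)))"
      using n by (intro G.S.finite_measure_mono G.sets_SI pred_stay) (fastforce simp: stay_def)+
    finally have "\<beta> ^ n * (1 / 2) \<le> \<beta> ^ n * stay_prob m T (sub_parabola (\<eta> + n * (q\<^sup>2 / 2)))"
      by (intro mult_left_mono) (auto simp: \<beta>_def)
    also note iter[OF \<open>mq \<le> m\<close>]
    finally show "\<beta> ^ n * (1 / 2) \<le> stay_prob m T (sub_parabola \<eta>)" .
  qed
qed

text \<open>A flat piece is a dip for every positive height, so flatness alone supplies the repeated
  pieces; one more flat piece is put in front.\<close>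

lemma prob_flat_side_lower:
  assumes pos: "prob (dyadic_stay (1 / 2 ^ r) (\<lambda>_. {0})) > 0"
  shows "\<exists>c>0. \<forall>m\<ge>r. \<forall>T. c \<le> stay_prob m T (flat_side (1 / 2 ^ r))"
proof -
  define \<delta> :: real where "\<delta> = 1 / 2 ^ r"
  have \<delta>: "\<delta> > 0" "\<delta> = real 1 / 2 ^ r" by (auto simp: \<delta>_def)
  have \<eta>: "\<delta>\<^sup>2 / 8 > 0" using \<delta> by simp
  have "dyadic_stay \<delta> (\<lambda>_. {0}) \<subseteq> dyadic_stay \<delta> (dip \<delta> (\<delta>\<^sup>2 / 8))"
    using \<eta> by (intro dyadic_stay_mono) (auto simp: dip_def)
  then have "prob (dyadic_stay \<delta> (\<lambda>_. {0})) \<le> prob (dyadic_stay \<delta> (dip \<delta> (\<delta>\<^sup>2 / 8)))"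
    by (intro finite_measure_mono) auto
  then have "prob (dyadic_stay \<delta> (dip \<delta> (\<delta>\<^sup>2 / 8))) > 0" using pos by (simp add: \<delta>_def)
  from prob_stay_quadratic_lower[OF \<eta> \<delta>(2,1) this]
  obtain c where c: "c > 0" "\<And>m T. r \<le> m \<Longrightarrow> c \<le> stay_prob m T (sub_parabola (\<delta>\<^sup>2 / 8))" by blast
  show ?thesis unfolding \<delta>_def[symmetric]
  proof (intro exI[of _ "prob (dyadic_stay \<delta> (\<lambda>_. {0})) * c"] conjI allI impI)
    show "0 < prob (dyadic_stay \<delta> (\<lambda>_. {0})) * c" using pos c by (simp add: \<delta>_def)
    fix m T assume m: "r \<le> m"
    have "prob (dyadic_stay \<delta> (\<lambda>_. {0})) * c \<le> stay_prob m \<delta> (\<lambda>_. {0}) * stay_prob m T (sub_parabola (\<delta>\<^sup>2 / 8))"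
      using c m by (intro mult_mono prob_stay_tendsto) auto
    also have "\<dots> \<le> stay_prob m T (flat_side \<delta>)"
    proof (rule prob_stay_concat[OF _ _ _ m \<delta>(2)])
      fix s x y :: real assume s: "0 < s" "x \<in> {0}" "y \<in> {..<s\<^sup>2 / 2 + \<delta>\<^sup>2 / 8}"
      then show "x + y \<in> flat_side \<delta> (\<delta> + s)" by (simp add: flat_side_def)
    qed (auto simp: flat_side_def)
    finally show "prob (dyadic_stay \<delta> (\<lambda>_. {0})) * c \<le> stay_prob m T (flat_side \<delta>)" .
  qed
qed

text \<open>Countable pigeonhole; it turns random dyadic times and thresholds into fixed
  ones.\<close>

lemma exists_prob_pos:
  fixes P :: "'i::countable \<Rightarrow> 'a \<Rightarrow> bool"
  assumes "\<And>i. {\<omega> \<in> space M. P i \<omega>} \<in> events" and ae: "AE \<omega> in M. \<exists>i. P i \<omega>"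
  shows "\<exists>i. prob {\<omega> \<in> space M. P i \<omega>} > 0"
proof (rule ccontr)
  assume "\<not> ?thesis"
  then have "prob {\<omega> \<in> space M. P i \<omega>} = 0" for i using zero_less_measure_iff by blast
  then have "AE \<omega> in M. \<not> P i \<omega>" for i
    using AE_iff_measurable[OF assms(1), of "\<lambda>\<omega>. \<not> P i \<omega>"] by (simp add: emeasure_eq_measure)
  then have "AE \<omega> in M. \<forall>i. \<not> P i \<omega>" by (simp add: AE_all_countable)
  with ae have "AE \<omega> in M. False" by eventually_elim blast
  then show False by simp
qed

text \<open>Regularity for the open lower half-line supplies both pieces: a dyadic time
  \<open>\<delta>\<close> at which the path is at most \<open>- 2 * \<kappa>\<close>, and a dip for
  height \<open>\<kappa>\<close>. Adding the later excess, which stays below the parabola plus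
  \<open>\<kappa>\<close>, leaves the margin \<open>\<kappa>\<close>.\<close>

lemma prob_low_side_lower:
  assumes Qp: "\<And>r. levy.nonpos_prob M (\<lambda>\<omega> x. - X \<omega> x) r = 0"
  shows "\<exists>jd md \<delta> \<kappa> c m0. \<delta> = real jd / 2 ^ md \<and> \<delta> > 0 \<and> \<kappa> > 0 \<and> c > 0 \<and>
    (\<forall>m\<ge>m0. \<forall>T. c \<le> stay_prob m T (low_side \<delta> \<kappa>))"
proof -
  interpret neg: levy M "\<lambda>\<omega> x. - X \<omega> x" by (rule levy_uminus)
  have "AE \<omega> in M. \<forall>r. \<omega> \<notin> neg.dyadic_stay (1 / 2 ^ r) (\<lambda>_. {..0})"
    unfolding AE_all_countable by (intro allI AE_not_in null_setsI) (auto simp: emeasure_eq_measure Qp)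
  then have neg: "AE \<omega> in M. \<forall>r. \<exists>m k. real k / 2 ^ m \<le> 1 / 2 ^ r \<and> 0 < k \<and> X \<omega> (real k / 2 ^ m) - X \<omega> 0 < 0"
    using AE_space
  proof eventually_elim
    case (elim \<omega>)
    show ?case
    proof
      fix r
      obtain m k where "real k / 2 ^ m \<le> 1 / 2 ^ r" "\<not> - X \<omega> (real k / 2 ^ m) - - X \<omega> 0 \<le> 0"
        using elim unfolding neg.dyadic_stay_def by (simp, blast)
      then show "\<exists>m k. real k / 2 ^ m \<le> 1 / 2 ^ r \<and> 0 < k \<and> X \<omega> (real k / 2 ^ m) - X \<omega> 0 < 0"
        by (intro exI[of _ m] exI[of _ k]) (auto intro: gr0I)
    qed
  qed
  define P where "P = (\<lambda>(m::nat, k::nat, n::nat) \<omega>. 0 < k \<and> X \<omega> (real k / 2 ^ m) - X \<omega> 0 \<le> - 2 / real (Suc n))"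
  have "\<exists>i. prob {\<omega> \<in> space M. P i \<omega>} > 0"
  proof (rule exists_prob_pos)
    show "{\<omega> \<in> space M. P i \<omega>} \<in> events" for i unfolding P_def by (cases i) simp
    show "AE \<omega> in M. \<exists>i. P i \<omega>" using neg
    proof eventually_elim
      case (elim \<omega>)
      obtain m k where k: "0 < k" "X \<omega> (real k / 2 ^ m) - X \<omega> 0 < 0" using elim by blast
      then have "0 < (X \<omega> 0 - X \<omega> (real k / 2 ^ m)) / 2" by simp
      then obtain n where "inverse (real (Suc n)) < (X \<omega> 0 - X \<omega> (real k / 2 ^ m)) / 2" using reals_Archimedean by blast
      then have "P (m, k, n) \<omega>" using k by (simp add: P_def inverse_eq_divide del: of_nat_Suc)
      then show ?case by blast
    qed
  qed
  then obtain md jd n where Ppos: "prob {\<omega> \<in> space M. P (md, jd, n) \<omega>} > 0" by (metis prod_cases3)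
  define \<delta> where "\<delta> = real jd / 2 ^ md"
  define \<kappa> where "\<kappa> = 1 / real (Suc n)"
  have "jd \<noteq> 0" using Ppos by (intro notI) (simp add: P_def)
  then have \<delta>: "\<delta> > 0" by (simp add: \<delta>_def)
  have \<kappa>: "\<kappa> > 0" by (simp add: \<kappa>_def)
  define D where "D = (\<lambda>s. if s = \<delta> then {..- 2 * \<kappa>} else (UNIV :: real set))"
  have [measurable]: "D s \<in> sets borel" for s by (simp add: D_def)
  have "{\<omega> \<in> space M. P (md, jd, n) \<omega>} \<subseteq> dyadic_stay \<delta> D"
    unfolding P_def dyadic_stay_def D_def \<delta>_def \<kappa>_def by auto
  then have "prob {\<omega> \<in> space M. P (md, jd, n) \<omega>} \<le> prob (dyadic_stay \<delta> D)" by (intro finite_measure_mono) auto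
  with Ppos have D: "prob (dyadic_stay \<delta> D) > 0" by linarith
  \<comment> \<open>Right continuity keeps the path below its start plus \<open>\<kappa>\<close> on
    a short stretch; a time of negative increment inside it becomes the length of the dip.\<close>
  define P' where "P' = (\<lambda>(m::nat, k::nat) \<omega>. 0 < k \<and> \<omega> \<in> dyadic_stay (real k / 2 ^ m) (dip (real k / 2 ^ m) \<kappa>))"
  have "\<exists>i. prob {\<omega> \<in> space M. P' i \<omega>} > 0"
  proof (rule exists_prob_pos)
    show "{\<omega> \<in> space M. P' i \<omega>} \<in> events" for i unfolding P'_def by (cases i) simp
    show "AE \<omega> in M. \<exists>i. P' i \<omega>" using neg AE_cadlag_0 AE_space
    proof eventually_elim
      case (elim \<omega>)
      have "X \<omega> 0 < X \<omega> 0 + \<kappa>" using \<kappa> by simp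
      from order_tendstoD(2)[OF elim(2) this] obtain b where b: "b > 0" "\<forall>y>0. y < b \<longrightarrow> X \<omega> y < X \<omega> 0 + \<kappa>"
        unfolding eventually_at_right_field by blast
      obtain r where r: "1 / 2 ^ r < b" using eventually_grid_small[OF b(1)] by blast
      obtain m k where k: "real k / 2 ^ m \<le> 1 / 2 ^ r" "0 < k" "X \<omega> (real k / 2 ^ m) - X \<omega> 0 < 0" using elim(1) by blast
      have "X \<omega> (real i / 2 ^ l) - X \<omega> 0 < \<kappa>" if "real i / 2 ^ l \<le> real k / 2 ^ m" for i l
      proof (cases "i = 0")
        case False
        then have "0 < real i / 2 ^ l" by simp
        moreover have "real i / 2 ^ l < b" using that k r by linarith
        ultimately show ?thesis using b(2) by (simp add: algebra_simps)
      qed (use \<kappa> in simp)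
      then have "\<omega> \<in> dyadic_stay (real k / 2 ^ m) (dip (real k / 2 ^ m) \<kappa>)"
        unfolding dyadic_stay_def dip_def using k elim(3) by auto
      then have "P' (m, k) \<omega>" using k by (simp add: P'_def)
      then show ?case by blast
    qed
  qed
  then obtain mq jq where P'pos: "prob {\<omega> \<in> space M. P' (mq, jq) \<omega>} > 0" by (metis surj_pair)
  define q where "q = real jq / 2 ^ mq"
  have "jq \<noteq> 0" using P'pos by (intro notI) (simp add: P'_def)
  then have q: "q > 0" by (simp add: q_def)
  have "prob {\<omega> \<in> space M. P' (mq, jq) \<omega>} \<le> prob (dyadic_stay q (dip q \<kappa>))"
    by (intro finite_measure_mono) (auto simp: P'_def q_def)
  with P'pos have "prob (dyadic_stay q (dip q \<kappa>)) > 0" by linarith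
  from prob_stay_quadratic_lower[OF \<kappa> q_def q this]
  obtain c where c: "c > 0" "\<And>m T. mq \<le> m \<Longrightarrow> c \<le> stay_prob m T (sub_parabola \<kappa>)" by blast
  have lower: "prob (dyadic_stay \<delta> D) * c \<le> stay_prob m T (low_side \<delta> \<kappa>)" if m: "max mq md \<le> m" for m T
  proof -
    have "prob (dyadic_stay \<delta> D) * c \<le> stay_prob m \<delta> D * stay_prob m T (sub_parabola \<kappa>)"
      using c m by (intro mult_mono prob_stay_tendsto) auto
    also have "\<dots> \<le> stay_prob m T (low_side \<delta> \<kappa>)"
    proof (rule prob_stay_concat[OF _ _ _ _ \<delta>_def])
      fix s x y :: real assume "0 < s" "x \<in> D \<delta>" "y \<in> {..<s\<^sup>2 / 2 + \<kappa>}"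
      then show "x + y \<in> low_side \<delta> \<kappa> (\<delta> + s)" by (simp add: low_side_def D_def)
    next
      fix s x assume "0 \<le> s" "s \<le> \<delta>" "x \<in> D s"
      then show "x \<in> low_side \<delta> \<kappa> s" using \<kappa> by (auto simp: low_side_def D_def split: if_splits)
    qed (use m in auto)
    finally show ?thesis .
  qed
  show ?thesis
    using \<delta>_def \<delta> \<kappa> D c(1) lower
    by (intro exI[of _ jd] exI[of _ md] exI[of _ \<delta>] exI[of _ \<kappa>] exI[of _ "prob (dyadic_stay \<delta> D) * c"] exI[of _ "max mq md"]) simp
qed

end

section \<open>Independent blocks\<close>

text \<open>Centred at time \<open>L\<close> with half-width \<open>L\<close>, the left half being
  read outwards from the centre.\<close>

definition block :: "nat \<Rightarrow> nat \<Rightarrow> (real \<Rightarrow> real set) \<Rightarrow> (real \<Rightarrow> real set) \<Rightarrow> (nat \<Rightarrow> real) \<Rightarrow> bool" where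
  "block m L U V \<xi> \<longleftrightarrow>
    (\<forall>k\<le>L * 2 ^ m. psum \<xi> (L * 2 ^ m - k) - psum \<xi> (L * 2 ^ m) \<in> V (real k / 2 ^ m)) \<and>
    stay m L U (shift_seq (L * 2 ^ m) \<xi>)"

lemma shift_seq_add: "shift_seq a (shift_seq b \<xi>) = shift_seq (b + a) \<xi>"
  by (simp add: shift_seq_def add_ac)

lemma depends_on_shift: "depends_on k P \<Longrightarrow> depends_on (a + k) (\<lambda>\<xi>. P (shift_seq a \<xi>))"
  unfolding depends_on_def shift_seq_def by auto

lemma pred_block [measurable]:
  assumes [measurable]: "\<And>s. U s \<in> sets borel" "\<And>s. V s \<in> sets borel"
  shows "Measurable.pred SB (block m L U V)"
  unfolding block_def by measurable

lemma depends_on_block: "depends_on (2 * (L * 2 ^ m)) (block m L U V)"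
proof -
  let ?K = "L * 2 ^ m"
  have "depends_on (?K + ?K) (\<lambda>\<xi>. stay m L U (shift_seq ?K \<xi>))"
    by (intro depends_on_shift depends_on_stay) simp
  moreover have "depends_on (?K + ?K) (\<lambda>\<xi>. \<forall>k\<le>?K. psum \<xi> (?K - k) - psum \<xi> ?K \<in> V (real k / 2 ^ m))"
  proof (rule depends_on_psum)
    fix \<xi> \<xi>' :: "nat \<Rightarrow> real" assume *: "\<And>i. i \<le> ?K + ?K \<Longrightarrow> psum \<xi> i = psum \<xi>' i"
    have "psum \<xi> ?K = psum \<xi>' ?K" "psum \<xi> (?K - k) = psum \<xi>' (?K - k)" for k by (intro *; simp)+
    then show "(\<forall>k\<le>?K. psum \<xi> (?K - k) - psum \<xi> ?K \<in> V (real k / 2 ^ m)) =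
      (\<forall>k\<le>?K. psum \<xi>' (?K - k) - psum \<xi>' ?K \<in> V (real k / 2 ^ m))" by simp
  qed
  ultimately show ?thesis unfolding depends_on_def block_def mult_2 by blast
qed

text \<open>Consecutive blocks use disjoint stretches of the sequence, so the failure probabilities
  multiply.\<close>

lemma (in iid_seq) prob_no_block_le:
  assumes [measurable]: "\<And>s. U s \<in> sets borel" "\<And>s. V s \<in> sets borel"
    and p: "p \<le> S.prob {\<xi>. block m L U V \<xi>}"
  shows "S.prob {\<xi>. \<forall>b<n. \<not> block m L U V (shift_seq (b * (2 * (L * 2 ^ m))) \<xi>)} \<le> (1 - p) ^ n"
proof (induction n)
  case 0
  then show ?case by simp
next
  case (Suc n)
  let ?D = "2 * (L * 2 ^ m)"
  have "(\<forall>b<Suc n. \<not> block m L U V (shift_seq (b * ?D) \<xi>)) \<longleftrightarrow>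
    \<not> block m L U V \<xi> \<and> (\<forall>b<n. \<not> block m L U V (shift_seq (b * ?D) (shift_seq ?D \<xi>)))" for \<xi>
    unfolding All_less_Suc2 by (simp add: shift_seq_add) (simp add: shift_seq_def)
  then have "S.prob {\<xi>. \<forall>b<Suc n. \<not> block m L U V (shift_seq (b * ?D) \<xi>)} =
    S.prob {\<xi>. \<not> block m L U V \<xi> \<and> (\<forall>b<n. \<not> block m L U V (shift_seq (b * ?D) (shift_seq ?D \<xi>)))}"
    by (simp only:)
  also have "\<dots> = S.prob {\<xi>. \<not> block m L U V \<xi>} * S.prob {\<xi>. \<forall>b<n. \<not> block m L U V (shift_seq (b * ?D) \<xi>)}"
    by (rule prob_split) (use depends_on_block in \<open>auto simp: depends_on_def\<close>)
  also have "\<dots> \<le> (1 - p) * (1 - p) ^ n"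
    using p prob_neg[of "block m L U V"] S.prob_le_1 by (intro mult_mono Suc.IH) (auto intro: order_trans)
  finally show ?case by simp
qed

context levy
begin

text \<open>The halves of a block are independent, and the left one, read outwards, has the law of
  \<open>- X\<close>; each succeeds with probability at least \<open>c\<close>.\<close>

lemma prob_block_ge:
  assumes [measurable]: "\<And>s. U s \<in> sets borel" "\<And>s. V s \<in> sets borel"
    and "0 \<le> c"
    and U: "c \<le> stay_prob m L U"
    and V: "c \<le> levy.stay_prob M (\<lambda>\<omega> x. - X \<omega> x) m L V"
  shows "c\<^sup>2 \<le> G.S.prob m {\<xi>. block m L U V \<xi>}"
proof -
  interpret neg: levy M "\<lambda>\<omega> x. - X \<omega> x" by (rule levy_uminus)
  define K where "K = L * 2 ^ m"
  have KL: "real K / 2 ^ m = real L" by (simp add: K_def)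
  have kK: "k \<le> K \<longleftrightarrow> real k / 2 ^ m \<le> real L" for k
    unfolding K_def by (rule grid_le_nat_iff[symmetric])
  let ?A = "\<lambda>\<xi>. \<forall>k\<le>K. psum \<xi> (K - k) - psum \<xi> K \<in> V (real k / 2 ^ m)"
  have A_dep: "depends_on K ?A"
  proof (rule depends_on_psum)
    fix \<xi> \<xi>' :: "nat \<Rightarrow> real" assume *: "\<And>i. i \<le> K \<Longrightarrow> psum \<xi> i = psum \<xi>' i"
    have "psum \<xi> K = psum \<xi>' K" "psum \<xi> (K - k) = psum \<xi>' (K - k)" for k by (intro *; simp)+
    then show "?A \<xi> = ?A \<xi>'" by simp
  qed
  have eq: "?A (\<lambda>i. grid_inc (X \<omega>) m 0 (0 + int i)) \<longleftrightarrow> stay m L V (\<lambda>i. grid_inc (\<lambda>x. - X \<omega> x) m L (- int i - 1))" for \<omega>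
  proof -
    have "real (K - k) / 2 ^ m = real L - real k / 2 ^ m" if "k \<le> K" for k
      using that KL by (simp add: of_nat_diff diff_divide_distrib)
    then show ?thesis
      unfolding stay_def kK[symmetric] psum_grid_inc psum_grid_inc_bwd using KL by simp
  qed
  have "G.S.prob m {\<xi>. ?A \<xi>} = prob {\<omega> \<in> space M. ?A (\<lambda>i. grid_inc (X \<omega>) m 0 (0 + int i))}"
    by (rule prob_grid[symmetric, OF inj_fwd]) measurable
  also have "\<dots> = prob {\<omega> \<in> space M. stay m L V (\<lambda>i. grid_inc (\<lambda>x. - X \<omega> x) m L (- int i - 1))}"
    by (simp only: eq)
  also have "\<dots> = neg.stay_prob m L V"
    by (rule neg.prob_grid[OF inj_bwd]) measurable
  finally have pA: "c \<le> G.S.prob m {\<xi>. ?A \<xi>}" using V by simp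
  have "c\<^sup>2 \<le> G.S.prob m {\<xi>. ?A \<xi>} * stay_prob m L U"
    unfolding power2_eq_square by (intro mult_mono pA U) (use \<open>0 \<le> c\<close> in auto)
  also have "\<dots> = G.S.prob m {\<xi>. ?A \<xi> \<and> stay m L U (shift_seq K \<xi>)}"
    by (rule G.prob_split[symmetric, OF _ A_dep]) measurable
  finally show ?thesis unfolding block_def K_def .
qed

text \<open>Disjoint blocks of half-width \<open>L\<close> are independent and each is good with probability bounded
  below uniformly in \<open>L\<close>; the quadratic growth condition controls everything outside the block as
  \<open>L\<close> grows.\<close>

lemma AE_exists_good_centre:
  assumes [measurable]: "\<And>s. U s \<in> sets borel" "\<And>s. V s \<in> sets borel"
    and "0 < c"
    and U: "\<And>m T. m0 \<le> m \<Longrightarrow> c \<le> stay_prob m T U"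
    and V: "\<And>m T. m0 \<le> m \<Longrightarrow> c \<le> levy.stay_prob M (\<lambda>\<omega> x. - X \<omega> x) m T V"
    and s0: "\<And>s. s0 \<le> s \<Longrightarrow> {..s\<^sup>2 / 4} \<subseteq> U s" "\<And>s. s0 \<le> s \<Longrightarrow> {..s\<^sup>2 / 4} \<subseteq> V s"
  shows "AE \<omega> in M. \<exists>z::nat. \<forall>m k. X \<omega> (real z + real k / 2 ^ m) - X \<omega> (real z) \<in> U (real k / 2 ^ m) \<and>
      X \<omega> (real z - real k / 2 ^ m) - X \<omega> (real z) \<in> V (real k / 2 ^ m)"
    (is "AE \<omega> in M. \<exists>z. ?good \<omega> z")
proof (rule AE_liminfI, goal_cases)
  case (1 e)
  have c1: "c \<le> 1" using U[of m0 0] G.S.prob_le_1 by (meson order_refl order_trans)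
  have "0 < c\<^sup>2" "c\<^sup>2 \<le> 1" using \<open>0 < c\<close> c1 by (auto simp: power_le_one)
  \<comment> \<open>The number of blocks that makes total failure less likely than \<open>e\<close>;
    it does not depend on \<open>L\<close>.\<close>
  then obtain N where N: "(1 - c\<^sup>2) ^ N < e" using real_arch_pow_inv[of e "1 - c\<^sup>2"] \<open>0 < e\<close> by auto
  define E where "E = (\<lambda>L m b \<omega>. (\<forall>k. real k / 2 ^ m \<le> real L \<longrightarrow>
      X \<omega> (real ((2 * b + 1) * L) + real k / 2 ^ m) - X \<omega> (real ((2 * b + 1) * L)) \<in> U (real k / 2 ^ m) \<and>
      X \<omega> (real ((2 * b + 1) * L) - real k / 2 ^ m) - X \<omega> (real ((2 * b + 1) * L)) \<in> V (real k / 2 ^ m)))"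
  have [measurable]: "Measurable.pred M (E L m b)" for L m b unfolding E_def by measurable
  define D where "D = (\<lambda>L m. {\<omega> \<in> space M. \<forall>b<N. \<not> E L m b \<omega>})"
  have D: "D L m \<in> events" for L m unfolding D_def by measurable
  define A where "A = (\<lambda>L. {\<omega> \<in> space M. \<forall>b<N. \<exists>m. \<not> E L m b \<omega>})"
  have A: "A L \<in> events" for L unfolding A_def by measurable
  have E_block: "E L m b \<omega> \<longleftrightarrow> block m L U V (shift_seq (b * (2 * (L * 2 ^ m))) (\<lambda>i. grid_inc (X \<omega>) m 0 (0 + int i)))" for L m b \<omega>
  proof -
    define K where "K = L * 2 ^ m"
    define a where "a = b * (2 * K)"
    have kK: "k \<le> K \<longleftrightarrow> real k / 2 ^ m \<le> real L" for k
      unfolding K_def by (rule grid_le_nat_iff[symmetric])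
    have ps: "psum (shift_seq j (\<lambda>i. grid_inc (X \<omega>) m 0 (0 + int i))) k = X \<omega> (real (j + k) / 2 ^ m) - X \<omega> (real j / 2 ^ m)" for j k
      unfolding psum_shift psum_grid_inc by simp
    have z: "real (a + K) / 2 ^ m = real ((2 * b + 1) * L)" by (simp add: a_def K_def algebra_simps add_divide_distrib)
    have fw: "real (a + K + k) / 2 ^ m = real ((2 * b + 1) * L) + real k / 2 ^ m" for k
      unfolding z[symmetric] by (simp add: add_divide_distrib)
    have bw: "real (a + (K - k)) / 2 ^ m = real ((2 * b + 1) * L) - real k / 2 ^ m" if "k \<le> K" for k
      unfolding z[symmetric] using that by (simp add: of_nat_diff add_divide_distrib diff_divide_distrib)
    let ?z = "real ((2 * b + 1) * L)"
    have b: "(\<forall>k\<le>K. X \<omega> (real (a + (K - k)) / 2 ^ m) - X \<omega> ?z \<in> V (real k / 2 ^ m)) \<longleftrightarrow>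
        (\<forall>k\<le>K. X \<omega> (?z - real k / 2 ^ m) - X \<omega> ?z \<in> V (real k / 2 ^ m))"
      by (intro all_cong1 imp_cong refl) (simp only: bw)
    have distr: "(\<forall>k\<le>K. P k \<and> Q k) \<longleftrightarrow> (\<forall>k\<le>K. Q k) \<and> (\<forall>k\<le>K. P k)" for P Q by blast
    have canc: "x - u - (y - u) = x - y" for x y u :: real by simp
    show ?thesis
      unfolding block_def stay_def K_def[symmetric] a_def[symmetric] shift_seq_add ps kK[symmetric] E_def fw z
      by (simp only: distr b canc)
  qed
  have pD: "prob (D L m) \<le> (1 - c\<^sup>2) ^ N" if m: "m0 \<le> m" for L m
  proof -
    have "prob (D L m) = G.S.prob m {\<xi>. \<forall>b<N. \<not> block m L U V (shift_seq (b * (2 * (L * 2 ^ m))) \<xi>)}"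
      unfolding D_def E_block by (rule prob_grid[OF inj_fwd]) measurable
    also have "\<dots> \<le> (1 - c\<^sup>2) ^ N"
      by (rule G.prob_no_block_le) (use prob_block_ge[of U V c m L] U[OF m] V[OF m] \<open>0 < c\<close> in auto)
    finally show ?thesis .
  qed
  have E_mono: "E L m b \<omega>" if "E L m' b \<omega>" "m \<le> m'" for L m m' b \<omega>
    unfolding E_def grid_refine[OF that(2)] using that(1) unfolding E_def by blast
  have pA: "prob (A L) \<le> e" for L
  proof -
    \<comment> \<open>A condition violated on one mesh is violated on all finer ones, so finitely
      many failing blocks fail together on every fine mesh.\<close>
    have "A L \<subseteq> (\<Union>k. \<Inter>n\<in>{k..}. D L n)"
    proof
      fix \<omega> assume w: "\<omega> \<in> A L"
      then obtain f where f: "\<And>b. b < N \<Longrightarrow> \<not> E L (f b) b \<omega>" unfolding A_def by auto metis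
      define k where "k = Max (insert 0 (f ` {..<N}))"
      have "f b \<le> k" if "b < N" for b unfolding k_def using that by (intro Max_ge) auto
      then have "\<omega> \<in> D L n" if "k \<le> n" for n
        using f E_mono that w unfolding D_def A_def by (auto, meson order_trans)
      then show "\<omega> \<in> (\<Union>k. \<Inter>n\<in>{k..}. D L n)" by blast
    qed
    then have "prob (A L) \<le> prob (\<Union>k. \<Inter>n\<in>{k..}. D L n)"
      by (rule finite_measure_mono) (use D prob_liminf_le(1)[of "D L" m0 "(1 - c\<^sup>2) ^ N"] pD in auto)
    also have "\<dots> \<le> (1 - c\<^sup>2) ^ N" by (rule prob_liminf_le(2)[OF D pD])
    finally show ?thesis using N by linarith
  qed
  have ae: "AE \<omega> in M. \<not> (\<exists>z. ?good \<omega> z) \<longrightarrow> (\<exists>k. \<forall>n\<ge>k. \<omega> \<in> A n)"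
    using AE_quadratic_growth AE_space
  proof eventually_elim
    case (elim \<omega>)
    \<comment> \<open>Centres are at most \<open>2 * N * L\<close>, and outside a block the distance
      \<open>s\<close> exceeds \<open>L\<close>, whence
      \<open>(z + t)\<^sup>2 + z\<^sup>2 \<le> R * s\<^sup>2\<close>. The growth coefficient is
      chosen so that these terms use up \<open>s\<^sup>2 / 8\<close>; the additive constants take at
      most another \<open>s\<^sup>2 / 8\<close>.\<close>
    define R where "R = (2 * real N + 1)\<^sup>2 + (2 * real N)\<^sup>2"
    have R: "R > 0" unfolding R_def by (intro add_pos_nonneg) auto
    obtain n where n: "inverse (real (Suc n)) < 1 / (8 * R)" using reals_Archimedean[of "1 / (8 * R)"] R by auto
    define \<epsilon> where "\<epsilon> = 1 / real (Suc n)"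
    have \<epsilon>: "\<epsilon> * R \<le> 1 / 8" "0 \<le> \<epsilon>" using n R by (auto simp: \<epsilon>_def inverse_eq_divide field_simps)
    obtain B where B: "B \<ge> 0" "\<And>x. \<bar>X \<omega> x\<bar> \<le> \<epsilon> * x\<^sup>2 + B" using elim(1) unfolding \<epsilon>_def by blast
    define L0 where "L0 = nat \<lceil>max s0 (16 * B + 1)\<rceil>"
    have L0: "s0 \<le> real L0" "16 * B + 1 \<le> real L0" unfolding L0_def by linarith+
    have tail: "X \<omega> (z + t) - X \<omega> z \<le> s\<^sup>2 / 4" if "L0 \<le> L" "0 \<le> z" "z \<le> 2 * real N * real L" "real L < s" "\<bar>t\<bar> = s" for L z s t
    proof -
      have s: "1 \<le> s" "16 * B \<le> s" using that(1,4) L0 B(1) by linarith+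
      have zs: "z \<le> 2 * real N * s" using that(3,4) by (meson less_imp_le mult_left_mono of_nat_0_le_iff order_trans zero_le_mult_iff zero_le_numeral)
      have "\<bar>z + t\<bar> \<le> (2 * real N + 1) * s" using zs that(2,5) by (simp add: algebra_simps)
      then have "(z + t)\<^sup>2 \<le> ((2 * real N + 1) * s)\<^sup>2" by (rule power2_le_iff_abs_le[THEN iffD2, rotated]) (use s in auto)
      moreover have "z\<^sup>2 \<le> (2 * real N * s)\<^sup>2" using zs that(2) by (intro power_mono)
      moreover have "R * s\<^sup>2 = ((2 * real N + 1) * s)\<^sup>2 + (2 * real N * s)\<^sup>2"
        unfolding R_def power_mult_distrib by (rule distrib_right)
      ultimately have "(z + t)\<^sup>2 + z\<^sup>2 \<le> R * s\<^sup>2" by linarith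
      then have "\<epsilon> * ((z + t)\<^sup>2 + z\<^sup>2) \<le> \<epsilon> * (R * s\<^sup>2)" using \<epsilon> by (intro mult_left_mono)
      also have "\<dots> = (\<epsilon> * R) * s\<^sup>2" by simp
      also have "\<dots> \<le> 1 / 8 * s\<^sup>2" using \<epsilon> by (intro mult_right_mono) auto
      finally have "\<epsilon> * (z + t)\<^sup>2 + \<epsilon> * z\<^sup>2 \<le> s\<^sup>2 / 8" by (simp add: algebra_simps)
      moreover have "16 * B \<le> s\<^sup>2" using s by (metis mult_1 mult_right_mono order_trans power2_eq_square zero_le_one)
      ultimately show ?thesis using B(2)[of "z + t"] B(2)[of z] by linarith
    qed
    show ?case
    proof
      assume no: "\<not> (\<exists>z. ?good \<omega> z)"
      have "\<omega> \<in> A L" if L: "L0 \<le> L" for L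
      proof -
        have "\<exists>m. \<not> E L m b \<omega>" if b: "b < N" for b
        proof (rule ccontr)
          assume "\<nexists>m. \<not> E L m b \<omega>"
          then have E: "E L m b \<omega>" for m by blast
          define z where "z = (2 * b + 1) * L"
          have "(2 * b + 1) * L \<le> (2 * N) * L" using b by (intro mult_right_mono) auto
          then have "real z \<le> real (2 * N * L)" unfolding z_def by (subst of_nat_le_iff)
          then have z: "0 \<le> real z" "real z \<le> 2 * real N * real L" by auto
          have "?good \<omega> z"
          proof (intro allI)
            fix m k
            let ?s = "real k / 2 ^ m"
            show "X \<omega> (real z + ?s) - X \<omega> (real z) \<in> U ?s \<and> X \<omega> (real z - ?s) - X \<omega> (real z) \<in> V ?s"
            proof (cases "?s \<le> real L")
              case True
              then show ?thesis using E[of m] unfolding E_def z_def by blast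
            next
              case False
              then have s: "real L < ?s" by simp
              then have ss: "s0 \<le> ?s" using L L0 by linarith
              have "X \<omega> (real z + ?s) - X \<omega> (real z) \<in> {..?s\<^sup>2 / 4}"
                unfolding atMost_iff by (rule tail[OF L z s]) simp
              moreover have "X \<omega> (real z + - ?s) - X \<omega> (real z) \<in> {..?s\<^sup>2 / 4}"
                unfolding atMost_iff by (rule tail[OF L z s]) simp
              ultimately show ?thesis
                using subsetD[OF s0(1)[OF ss]] subsetD[OF s0(2)[OF ss]] unfolding add_uminus_conv_diff by blast
            qed
          qed
          with no show False by blast
        qed
        then show ?thesis using elim(2) by (simp add: A_def)
      qed
      then show "\<exists>k. \<forall>n\<ge>k. \<omega> \<in> A n" by blast
    qed
  qed
  show ?case
    by (rule exI[of _ A], rule exI[of _ 0], intro conjI allI impI A pA ae)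
qed

end

section \<open>The map \<open>a\<close>\<close>

lemma lag_obj_ub: "lag_obj f x y = ub f y - (y - x)\<^sup>2 / 2"
  by (simp add: lag_obj_def ub_def)

lemma left_lim_le:
  assumes "cadlag f" "isCont g y" "a < y" "\<And>w. a < w \<Longrightarrow> w < y \<Longrightarrow> f w \<le> g w"
  shows "left_lim f y \<le> g y"
proof (rule tendsto_le[OF _ _ cadlagD(2)[OF assms(1)]])
  show "(g \<longlongrightarrow> g y) (at_left y)" using assms(2) by (simp add: isCont_def filterlim_at_split)
  show "eventually (\<lambda>w. f w \<le> g w) (at_left y)"
    using assms(3,4) unfolding eventually_at_left_field by blast
qed simp

lemma ub_le:
  assumes "cadlag f" "isCont g y" "a < y" "\<And>w. a < w \<Longrightarrow> w \<le> y \<Longrightarrow> f w \<le> g w"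
  shows "ub f y \<le> g y"
  unfolding ub_def using left_lim_le[where f = f and g = g and y = y and a = a] assms by (auto intro: less_imp_le)

lemma le_ub: "f y \<le> ub f y"
  by (simp add: ub_def)

section \<open>Upper semicontinuity and existence of maximisers\<close>

lemma ub_usc:
  assumes f: "cadlag f" and "e > 0"
  shows "\<exists>d>0. \<forall>w. \<bar>w - y\<bar> < d \<longrightarrow> ub f w < ub f y + e"
proof -
  have e2: "e / 2 > 0" using \<open>e > 0\<close> by simp
  have "eventually (\<lambda>w. f w < ub f y + e / 2) (at_right y)"
    by (rule order_tendstoD(2)[OF cadlagD(1)[OF f]]) (use e2 in \<open>auto simp: ub_def\<close>)
  then obtain b where b: "b > y" "\<forall>w>y. w < b \<longrightarrow> f w < ub f y + e / 2" unfolding eventually_at_right_field by blast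
  have "eventually (\<lambda>w. f w < ub f y + e / 2) (at_left y)"
    by (rule order_tendstoD(2)[OF cadlagD(2)[OF f]]) (use e2 in \<open>auto simp: ub_def\<close>)
  then obtain a where a: "a < y" "\<forall>w>a. w < y \<longrightarrow> f w < ub f y + e / 2" unfolding eventually_at_left_field by blast
  show ?thesis
  proof (intro exI[of _ "min (b - y) (y - a)"] conjI allI impI)
    fix w assume w: "\<bar>w - y\<bar> < min (b - y) (y - a)"
    show "ub f w < ub f y + e"
    proof (cases "w = y")
      case False
      define c where "c = (if w < y then a else y)"
      have "ub f w \<le> ub f y + e / 2"
      proof (rule ub_le[OF f, where a = c])
        show "c < w" using w False by (auto simp: c_def)
        fix v assume "c < v" "v \<le> w"
        then show "f v \<le> ub f y + e / 2" using a(2) b(2) w False by (auto simp: c_def split: if_splits intro!: less_imp_le)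
      qed simp
      then show ?thesis using \<open>e > 0\<close> by linarith
    qed (use \<open>e > 0\<close> in simp)
  qed (use a b in auto)
qed

definition usc :: "(real \<Rightarrow> real) \<Rightarrow> bool" where
  "usc u \<longleftrightarrow> (\<forall>y e. 0 < e \<longrightarrow> (\<exists>d>0. \<forall>w. \<bar>w - y\<bar> < d \<longrightarrow> u w < u y + e))"

lemma usc_ub: "cadlag f \<Longrightarrow> usc (ub f)"
  unfolding usc_def using ub_usc by blast

lemma usc_open:
  assumes "usc u"
  shows "open {y. u y < c}"
proof (unfold open_dist, intro ballI)
  fix y assume "y \<in> {y. u y < c}"
  then have "0 < c - u y" by simp
  then obtain d where "d > 0" "\<forall>w. \<bar>w - y\<bar> < d \<longrightarrow> u w < u y + (c - u y)" using assms unfolding usc_def by blast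
  then show "\<exists>e>0. \<forall>w. dist w y < e \<longrightarrow> w \<in> {y. u y < c}" by (intro exI[of _ d]) (auto simp: dist_real_def)
qed

lemma usc_add:
  assumes "usc u" "continuous_on UNIV g"
  shows "usc (\<lambda>y. u y + g y)"
  unfolding usc_def
proof (intro allI impI)
  fix y e :: real assume "0 < e"
  then have e2: "0 < e / 2" by simp
  obtain d1 where d1: "d1 > 0" "\<forall>w. \<bar>w - y\<bar> < d1 \<longrightarrow> u w < u y + e / 2" using assms(1) e2 unfolding usc_def by blast
  obtain d2 where d2: "d2 > 0" "\<forall>w. dist w y < d2 \<longrightarrow> dist (g w) (g y) < e / 2"
    using assms(2) e2 unfolding continuous_on_iff by blast
  show "\<exists>d>0. \<forall>w. \<bar>w - y\<bar> < d \<longrightarrow> u w + g w < u y + g y + e"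
  proof (intro exI[of _ "min d1 d2"] conjI allI impI)
    fix w assume "\<bar>w - y\<bar> < min d1 d2"
    then have "u w < u y + e / 2" "\<bar>g w - g y\<bar> < e / 2" using d1 d2 by (auto simp: dist_real_def)
    then show "u w + g w < u y + g y + e" by linarith
  qed (use d1 d2 in auto)
qed

text \<open>Without a maximum, the open sets where \<open>u\<close> is below one of its values would
  cover the interval; in a finite subcover the point with the largest value is not covered.\<close>

lemma usc_attains_max:
  fixes a b :: real
  assumes "usc u" "a \<le> b"
  shows "\<exists>y\<in>{a..b}. \<forall>w\<in>{a..b}. u w \<le> u y"
proof (rule ccontr)
  assume "\<not> ?thesis"
  then have *: "\<And>y. y \<in> {a..b} \<Longrightarrow> \<exists>w\<in>{a..b}. u y < u w" by force
  have cov: "{a..b} \<subseteq> (\<Union>w\<in>{a..b}. {y. u y < u w})" using * by blast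
  obtain C where C: "C \<subseteq> {a..b}" "finite C" "{a..b} \<subseteq> (\<Union>w\<in>C. {y. u y < u w})"
    by (rule compactE_image[OF compact_Icc[of a b] _ cov]) (auto intro: usc_open[OF assms(1)])
  have "C \<noteq> {}" using C(3) \<open>a \<le> b\<close> by auto
  then obtain w where w: "w \<in> C" "u w = Max (u ` C)" using C(2) by (metis (mono_tags, lifting) Max_in finite_imageI image_iff image_is_empty)
  then obtain w' where "w' \<in> C" "u w < u w'" using C by blast
  then show False using w C(2) by (metis Max_ge finite_imageI imageI not_less)
qed

lemma usc_lag_obj: "cadlag f \<Longrightarrow> usc (lag_obj f x)"
proof -
  assume "cadlag f"
  then have "usc (\<lambda>y. ub f y + (- (y - x)\<^sup>2 / 2))" by (intro usc_add usc_ub continuous_intros) auto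
  then show ?thesis by (simp add: lag_obj_ub[abs_def])
qed

lemma quadratic_dominates:
  fixes X Y c :: real
  assumes "1 \<le> Y" "8 * X + 16 * (c + 1) \<le> Y" "0 \<le> c"
  shows "- 3 / 8 * Y\<^sup>2 + Y * X < - c"
proof -
  have "Y * (8 * X + 16 * (c + 1)) \<le> Y * Y" using assms by (intro mult_left_mono) auto
  moreover have "1 * (c + 1) \<le> Y * (c + 1)" using assms by (intro mult_right_mono) auto
  ultimately have "8 * (Y * X) + 16 * (Y * c + Y) \<le> Y * Y" "1 + c \<le> Y * c + Y" by (simp_all add: algebra_simps)
  moreover have "0 \<le> Y * Y" by simp
  moreover have "- 3 / 8 * S + P < - c" if "8 * P + 16 * (Q + Y) \<le> S" "1 + c \<le> Q + Y" "0 \<le> S" for P Q S :: real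
    using that assms(3) by (simp add: field_simps)
  ultimately show ?thesis unfolding power2_eq_square by blast
qed

text \<open>Growth coefficient 1/8 against 1/2 leaves \<open>- 3 / 8 * y\<^sup>2\<close>, which
  dominates the term linear in \<open>y\<close>.\<close>

lemma lag_obj_bounded_below_far:
  assumes f: "cadlag f" and grow: "\<And>y. \<bar>f y\<bar> \<le> 1 / 8 * y\<^sup>2 + B"
  shows "\<exists>R\<ge>0. \<forall>y. \<bar>y\<bar> > R \<longrightarrow> lag_obj f x y < lag_obj f x 0"
proof -
  define R where "R = max 1 (2 * (4 * \<bar>x\<bar> + 8 * (\<bar>B\<bar> + \<bar>lag_obj f x 0\<bar> + 1)))"
  have "lag_obj f x y < lag_obj f x 0" if y: "\<bar>y\<bar> > R" for y
  proof -
    have "ub f y \<le> 1 / 8 * y\<^sup>2 + B"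
    proof (rule ub_le[OF f, where a = "y - 1"])
      show "f w \<le> 1 / 8 * w\<^sup>2 + B" for w using grow[of w] by linarith
    qed auto
    moreover have "1 / 8 * y\<^sup>2 + B - (y - x)\<^sup>2 / 2 \<le> - 3 / 8 * \<bar>y\<bar>\<^sup>2 + \<bar>y\<bar> * \<bar>x\<bar> + \<bar>B\<bar>"
    proof -
      have "y * x \<le> \<bar>y\<bar> * \<bar>x\<bar>" by (metis abs_ge_self abs_mult)
      moreover have "0 \<le> x\<^sup>2" by simp
      moreover have "B \<le> \<bar>B\<bar>" by simp
      moreover have "(y - x)\<^sup>2 = \<bar>y\<bar>\<^sup>2 - 2 * (y * x) + x\<^sup>2" by (simp add: power2_eq_square algebra_simps)
      moreover have "y\<^sup>2 = \<bar>y\<bar>\<^sup>2" by simp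
      ultimately show ?thesis by linarith
    qed
    moreover have "- 3 / 8 * \<bar>y\<bar>\<^sup>2 + \<bar>y\<bar> * \<bar>x\<bar> + \<bar>B\<bar> < - \<bar>lag_obj f x 0\<bar>"
    proof -
      have "- 3 / 8 * \<bar>y\<bar>\<^sup>2 + \<bar>y\<bar> * \<bar>x\<bar> < - (\<bar>B\<bar> + \<bar>lag_obj f x 0\<bar>)"
        using y by (intro quadratic_dominates) (auto simp: R_def)
      then show ?thesis by linarith
    qed
    ultimately show ?thesis unfolding lag_obj_ub[of f x y] by linarith
  qed
  then show ?thesis by (intro exI[of _ R]) (auto simp: R_def)
qed

text \<open>\<open>GREATEST\<close> needs a greatest maximiser to exist: the maximisers form a
  nonempty, closed and bounded set, which contains its supremum.\<close>

lemma lag_a_greatest: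
  assumes f: "cadlag f" and grow: "\<And>y. \<bar>f y\<bar> \<le> 1 / 8 * y\<^sup>2 + B"
  shows "lag_obj f x y \<le> lag_obj f x (lag_a f x)"
    and "(\<And>w. lag_obj f x w \<le> lag_obj f x y) \<Longrightarrow> y \<le> lag_a f x"
proof -
  let ?u = "lag_obj f x"
  obtain R where R: "R \<ge> 0" "\<And>y. \<bar>y\<bar> > R \<Longrightarrow> ?u y < ?u 0" using lag_obj_bounded_below_far[OF f grow] by blast
  obtain y0 where y0: "y0 \<in> {-R..R}" "\<forall>w\<in>{-R..R}. ?u w \<le> ?u y0"
    using usc_attains_max[OF usc_lag_obj[OF f], of "-R" R x] R(1) by auto
  have max0: "?u w \<le> ?u y0" for w
  proof (cases "\<bar>w\<bar> \<le> R")
    case True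
    then have "w \<in> {-R..R}" by (simp add: abs_le_iff minus_le_iff)
    then show ?thesis using y0(2) by blast
  next
    case False
    then have "?u w < ?u 0" using R(2) by simp
    also have "\<dots> \<le> ?u y0" using y0(2) R(1) by auto
    finally show ?thesis by simp
  qed
  define A where "A = {y. ?u y = ?u y0}"
  have Amax: "(\<forall>w. ?u w \<le> ?u y) \<longleftrightarrow> y \<in> A" for y
    using max0 unfolding A_def by (auto intro: antisym)
  have AR: "A \<subseteq> {-R..R}"
  proof
    fix y assume "y \<in> A"
    then have "?u 0 \<le> ?u y" using max0 by (simp add: A_def)
    then have "\<not> \<bar>y\<bar> > R" using R(2)[of y] by linarith
    then show "y \<in> {-R..R}" by (simp add: not_less abs_le_iff minus_le_iff)
  qed
  have "closed A"
  proof -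
    have "A = - {y. ?u y < ?u y0}" unfolding A_def using max0 by (auto simp: order_le_less)
    then show ?thesis using usc_open[OF usc_lag_obj[OF f], of x "?u y0"] by (metis closed_Compl)
  qed
  moreover have "bdd_above A" using AR by (meson bdd_above.unfold bdd_above_Icc bdd_above_mono)
  moreover have "A \<noteq> {}" by (auto simp: A_def)
  ultimately have "Sup A \<in> A" by (intro closed_contains_Sup)
  moreover have up: "y \<le> Sup A" if "y \<in> A" for y using that \<open>bdd_above A\<close> by (rule cSup_upper)
  ultimately have "lag_a f x = Sup A"
    unfolding lag_a_def Amax by (intro Greatest_equality)
  then show "?u y \<le> ?u (lag_a f x)" "(\<And>w. ?u w \<le> ?u y) \<Longrightarrow> y \<le> lag_a f x"
    using \<open>Sup A \<in> A\<close> max0 up Amax unfolding A_def by auto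
qed

text \<open>Moving the centre changes the objective by an affine function of \<open>y\<close>;
  monotonicity and stability of maximisers both rest on this.\<close>

lemma lag_obj_shift: "lag_obj f x y = lag_obj f p y + (y - p) * (x - p) - (x - p)\<^sup>2 / 2"
  unfolding lag_obj_ub by (simp add: power2_eq_square field_simps)

text \<open>A maximiser for \<open>x\<close> to the right of \<open>lag_a f x'\<close> would not
  lose by the affine change and so also maximise for \<open>x'\<close>, against the choice of the
  greatest maximiser.\<close>

lemma lag_a_mono:
  assumes f: "cadlag f" and grow: "\<And>y. \<bar>f y\<bar> \<le> 1 / 8 * y\<^sup>2 + B" and "x \<le> x'"
  shows "lag_a f x \<le> lag_a f x'"
proof (rule ccontr)
  assume "\<not> ?thesis"
  then have lt: "lag_a f x' < lag_a f x" by simp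
  have "lag_obj f x' w \<le> lag_obj f x' (lag_a f x)" for w
  proof -
    have "(lag_a f x' - x) * (x' - x) \<le> (lag_a f x - x) * (x' - x)" using lt \<open>x \<le> x'\<close> by (intro mult_right_mono) auto
    moreover have "lag_obj f x (lag_a f x') \<le> lag_obj f x (lag_a f x)" by (rule lag_a_greatest(1)[OF f grow])
    ultimately have "lag_obj f x' (lag_a f x') \<le> lag_obj f x' (lag_a f x)"
      unfolding lag_obj_shift[of f x' _ x] by linarith
    moreover have "lag_obj f x' w \<le> lag_obj f x' (lag_a f x')" by (rule lag_a_greatest(1)[OF f grow])
    ultimately show ?thesis by linarith
  qed
  then have "lag_a f x \<le> lag_a f x'" by (rule lag_a_greatest(2)[OF f grow])
  with lt show False by simp
qed

lemma lag_a_eqI: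
  assumes "\<And>y. y \<noteq> p \<Longrightarrow> lag_obj f x y < lag_obj f x p"
  shows "lag_a f x = p"
  unfolding lag_a_def
proof (rule Greatest_equality)
  show "\<forall>z. lag_obj f x z \<le> lag_obj f x p" using assms by (metis less_imp_le order_refl)
  show "y \<le> p" if "\<forall>z. lag_obj f x z \<le> lag_obj f x y" for y
    using that assms by (metis not_less order_refl)
qed

text \<open>On a compact interval without the unique maximiser the objective has a gap
  \<open>\<gamma>\<close>, and moving the centre by less than \<open>\<gamma> / W\<close> changes
  the comparison by less than \<open>\<gamma>\<close>.\<close>

lemma lag_a_avoids:
  assumes f: "cadlag f" and grow: "\<And>y. \<bar>f y\<bar> \<le> 1 / 8 * y\<^sup>2 + B"
    and uniq: "\<And>y. y \<noteq> p \<Longrightarrow> lag_obj f p y < lag_obj f p p" and "p \<notin> {c..d}"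
  shows "\<exists>\<eta>>0. \<forall>x. \<bar>x - p\<bar> < \<eta> \<longrightarrow> lag_a f x \<notin> {c..d}"
proof (cases "c \<le> d")
  case True
  obtain y0 where y0: "y0 \<in> {c..d}" "\<forall>w\<in>{c..d}. lag_obj f p w \<le> lag_obj f p y0"
    using usc_attains_max[OF usc_lag_obj[OF f] True] by blast
  define \<gamma> where "\<gamma> = lag_obj f p p - lag_obj f p y0"
  have \<gamma>: "\<gamma> > 0" using uniq[of y0] y0 \<open>p \<notin> {c..d}\<close> by (auto simp: \<gamma>_def)
  define W where "W = \<bar>c - p\<bar> + \<bar>d - p\<bar> + 1"
  have W: "W > 0" by (simp add: W_def)
  show ?thesis
  proof (intro exI[of _ "\<gamma> / W"] conjI allI impI notI)
    show "0 < \<gamma> / W" using \<gamma> W by simp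
    fix x assume x: "\<bar>x - p\<bar> < \<gamma> / W" and a: "lag_a f x \<in> {c..d}"
    let ?a = "lag_a f x"
    have "lag_obj f x p \<le> lag_obj f x ?a" by (rule lag_a_greatest(1)[OF f grow])
    then have "lag_obj f p p \<le> lag_obj f p ?a + (?a - p) * (x - p)"
      unfolding lag_obj_shift[of f x _ p] by simp
    moreover have "lag_obj f p ?a \<le> lag_obj f p y0" using y0 a by blast
    moreover have "(?a - p) * (x - p) \<le> \<bar>?a - p\<bar> * \<bar>x - p\<bar>" by (metis abs_ge_self abs_mult)
    moreover have "\<bar>?a - p\<bar> * \<bar>x - p\<bar> \<le> W * \<bar>x - p\<bar>" using a by (intro mult_right_mono) (auto simp: W_def)
    moreover have "W * \<bar>x - p\<bar> < \<gamma>" using x W by (simp add: field_simps)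
    ultimately show False by (simp add: \<gamma>_def)
  qed
qed (auto intro: exI[of _ 1])

text \<open>If \<open>p\<close> stays optimal for a centre at distance \<open>r\<close>, the path on
  that side lies under a parabola starting at level \<open>ub f p\<close> with slope
  \<open>- r\<close>; its chords up to distance \<open>r\<close> have slope at most
  \<open>- r / 2\<close>.\<close>

lemma steepI:
  assumes "0 < r" "\<sigma> = 1 \<or> \<sigma> = - 1" "\<And>y. lag_obj f (p + \<sigma> * r) y \<le> lag_obj f (p + \<sigma> * r) p"
  shows "steep f \<sigma> p"
proof -
  have *: "f (p + \<sigma> * t) \<le> ub f p - r / 2 * t" if t: "0 < t \<and> t < r" for t
  proof -
    have "ub f (p + \<sigma> * t) \<le> ub f p + (\<sigma> * t - \<sigma> * r)\<^sup>2 / 2 - (\<sigma> * r)\<^sup>2 / 2"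
      using assms(3)[of "p + \<sigma> * t"] unfolding lag_obj_ub by simp
    also have "\<dots> = ub f p + t * (t / 2 - r)" using assms(2) by (auto simp: power2_eq_square field_simps)
    also have "\<dots> \<le> ub f p + t * (- (r / 2))" using t by (intro add_left_mono mult_left_mono) (simp_all add: field_simps)
    finally show ?thesis using le_ub[of f "p + \<sigma> * t"] by (simp add: algebra_simps)
  qed
  have "r / 2 > 0" using assms(1) by simp
  with * assms(1) show ?thesis unfolding steep_def by blast
qed

lemma lag_A_memI: "lag_a f x \<in> lag_A f"
  unfolding lag_A_def by (rule subsetD[OF closure_subset rangeI])

text \<open>For centres within distance 1 of \<open>p\<close> monotonicity confines
  \<open>lag_a f\<close> to a bounded interval; \<open>lag_a_avoids\<close>, applied to the part of
  it at distance at least \<open>e\<close>, then forces the values close to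
  \<open>p\<close>.\<close>

lemma regular_point_of_unique_max:
  assumes f: "cadlag f" and grow: "\<And>y. \<bar>f y\<bar> \<le> 1 / 8 * y\<^sup>2 + B"
    and uniq: "\<And>y. y \<noteq> p \<Longrightarrow> lag_obj f p y < lag_obj f p p"
    and ns: "\<not> steep f (- 1) p" "\<not> steep f 1 p"
  shows "lagrangian_regular_point f p"
proof -
  have ap: "lag_a f p = p" by (rule lag_a_eqI[OF uniq])
  have gt: "p < lag_a f x" if "p < x" for x
  proof -
    have "lag_a f x \<noteq> p"
    proof
      assume eq: "lag_a f x = p"
      have "steep f 1 p" using lag_a_greatest(1)[OF f grow, of x] that unfolding eq by (intro steepI[of "x - p"]) auto
      with ns show False by blast
    qed
    moreover have "p \<le> lag_a f x" using lag_a_mono[OF f grow, of p x] that ap by simp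
    ultimately show ?thesis by simp
  qed
  have lt: "lag_a f x < p" if "x < p" for x
  proof -
    have "lag_a f x \<noteq> p"
    proof
      assume eq: "lag_a f x = p"
      have "steep f (- 1) p" using lag_a_greatest(1)[OF f grow, of x] that unfolding eq by (intro steepI[of "p - x"]) auto
      with ns show False by blast
    qed
    moreover have "lag_a f x \<le> p" using lag_a_mono[OF f grow, of x p] that ap by simp
    ultimately show ?thesis by simp
  qed
  show ?thesis unfolding lagrangian_regular_point_def islimpt_approachable
  proof (intro conjI allI impI)
    show "p \<in> lag_A f" using lag_A_memI[of f p] ap by simp
  next
    fix e :: real assume "0 < e"
    obtain \<eta> where \<eta>: "\<eta> > 0" "\<And>x. \<bar>x - p\<bar> < \<eta> \<Longrightarrow> lag_a f x \<notin> {lag_a f (p - 1)..p - e}"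
      using lag_a_avoids[OF f grow uniq, of "lag_a f (p - 1)" "p - e"] \<open>0 < e\<close> by auto
    define x where "x = p - min (\<eta> / 2) 1"
    have x: "x < p" "p - 1 \<le> x" "\<bar>x - p\<bar> < \<eta>" using \<eta>(1) by (auto simp: x_def)
    have "lag_a f (p - 1) \<le> lag_a f x" by (rule lag_a_mono[OF f grow x(2)])
    then have "p - e < lag_a f x" using \<eta>(2)[OF x(3)] by auto
    then show "\<exists>x'\<in>lag_A f \<inter> {..<p}. x' \<noteq> p \<and> dist x' p < e"
      using lt[OF x(1)] lag_A_memI[of f x] by (intro bexI[of _ "lag_a f x"]) (auto simp: dist_real_def)
  next
    fix e :: real assume "0 < e"
    obtain \<eta> where \<eta>: "\<eta> > 0" "\<And>x. \<bar>x - p\<bar> < \<eta> \<Longrightarrow> lag_a f x \<notin> {p + e..lag_a f (p + 1)}"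
      using lag_a_avoids[OF f grow uniq, of "p + e" "lag_a f (p + 1)"] \<open>0 < e\<close> by auto
    define x where "x = p + min (\<eta> / 2) 1"
    have x: "p < x" "x \<le> p + 1" "\<bar>x - p\<bar> < \<eta>" using \<eta>(1) by (auto simp: x_def)
    have "lag_a f x \<le> lag_a f (p + 1)" by (rule lag_a_mono[OF f grow x(2)])
    then have "lag_a f x < p + e" using \<eta>(2)[OF x(3)] by auto
    then show "\<exists>x'\<in>lag_A f \<inter> {p<..}. x' \<noteq> p \<and> dist x' p < e"
      using gt[OF x(1)] lag_A_memI[of f x] by (intro bexI[of _ "lag_a f x"]) (auto simp: dist_real_def)
  qed
qed

lemma regular_point_in_flat_part:
  assumes "a < b" and fix_pt: "\<And>x. a < x \<Longrightarrow> x < b \<Longrightarrow> lag_a f x = x" and z: "a < z" "z < b"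
  shows "lagrangian_regular_point f z"
proof -
  have A: "x \<in> lag_A f" if "a < x" "x < b" for x using lag_A_memI[of f x] fix_pt[OF that] by simp
  show ?thesis unfolding lagrangian_regular_point_def islimpt_approachable
  proof (intro conjI allI impI)
    show "z \<in> lag_A f" using A z by blast
  next
    fix e :: real assume "0 < e"
    then obtain w where "max a (z - e) < w" "w < z" using dense[of "max a (z - e)" z] z by auto
    then show "\<exists>x'\<in>lag_A f \<inter> {..<z}. x' \<noteq> z \<and> dist x' z < e"
      using z A[of w] by (intro bexI[of _ w]) (auto simp: dist_real_def)
  next
    fix e :: real assume "0 < e"
    then obtain w where "z < w" "w < min b (z + e)" using dense[of z "min b (z + e)"] z by auto
    then show "\<exists>x'\<in>lag_A f \<inter> {z<..}. x' \<noteq> z \<and> dist x' z < e"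
      using z A[of w] by (intro bexI[of _ w]) (auto simp: dist_real_def)
  qed
qed

section \<open>From dyadic grid points to all points\<close>

lemma le_from_right:
  assumes f: "cadlag f" and g: "isCont g y" and w: "\<And>b. y < b \<Longrightarrow> \<exists>w. y < w \<and> w < b \<and> f w \<le> g w"
  shows "f y \<le> g y"
proof (rule ccontr)
  assume "\<not> ?thesis"
  then have pos: "0 < f y - g y" by simp
  have "(g \<longlongrightarrow> g y) (at_right y)" using g by (simp add: isCont_def filterlim_at_split)
  then have "((\<lambda>w. f w - g w) \<longlongrightarrow> f y - g y) (at_right y)" by (rule tendsto_diff[OF cadlagD(1)[OF f]])
  from order_tendstoD(1)[OF this pos] obtain b where b: "b > y" "\<forall>w>y. w < b \<longrightarrow> 0 < f w - g w"
    unfolding eventually_at_right_field by blast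
  then show False using w[OF b(1)] by force
qed

lemma grid_point_fwd:
  fixes z y b :: real
  assumes "z \<le> y" "y < b"
  shows "\<exists>m k::nat. y < z + real k / 2 ^ m \<and> z + real k / 2 ^ m < b"
proof -
  obtain m :: nat where m: "1 / 2 ^ m < b - y" using eventually_grid_small[of "b - y"] assms by auto
  obtain k :: nat where "y - z < real k / 2 ^ m" "real k / 2 ^ m < b - z"
    using exists_grid_point[of "y - z" m "b - z"] assms m by auto
  then show ?thesis by (intro exI[of _ m] exI[of _ k]) auto
qed

lemma grid_point_bwd:
  fixes z y b :: real
  assumes "b \<le> z" "y < b"
  shows "\<exists>m k::nat. y < z - real k / 2 ^ m \<and> z - real k / 2 ^ m < b"
proof -
  obtain m :: nat where m: "1 / 2 ^ m < b - y" using eventually_grid_small[of "b - y"] assms by auto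
  obtain k :: nat where "z - b < real k / 2 ^ m" "real k / 2 ^ m < z - y"
    using exists_grid_point[of "z - b" m "z - y"] assms m by auto
  then show ?thesis by (intro exI[of _ m] exI[of _ k]) auto
qed

lemma le_from_grid_fwd:
  assumes f: "cadlag f" and g: "isCont g y" and "z \<le> y" "y < c"
    and grid: "\<And>m k::nat. y < z + real k / 2 ^ m \<Longrightarrow> z + real k / 2 ^ m < c \<Longrightarrow> f (z + real k / 2 ^ m) \<le> g (z + real k / 2 ^ m)"
  shows "f y \<le> g y"
proof (rule le_from_right[OF f g])
  fix b assume "y < b"
  then have "y < min b c" using \<open>y < c\<close> by simp
  from grid_point_fwd[OF \<open>z \<le> y\<close> this] show "\<exists>w>y. w < b \<and> f w \<le> g w" using grid by fastforce
qed

text \<open>Even to the left of \<open>z\<close> the point \<open>y\<close> is approached from its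
  right, the side of continuity; \<open>c\<close> ends the range where the grid bound is
  available.\<close>

lemma le_from_grid_bwd:
  assumes f: "cadlag f" and g: "isCont g y" and "c \<le> z" "y < c"
    and grid: "\<And>m k::nat. y < z - real k / 2 ^ m \<Longrightarrow> z - real k / 2 ^ m < c \<Longrightarrow> f (z - real k / 2 ^ m) \<le> g (z - real k / 2 ^ m)"
  shows "f y \<le> g y"
proof (rule le_from_right[OF f g])
  fix b assume "y < b"
  then have "y < min b c" "min b c \<le> z" using \<open>y < c\<close> \<open>c \<le> z\<close> by (simp_all add: min.coboundedI2)
  from grid_point_bwd[OF this(2,1)] show "\<exists>w>y. w < b \<and> f w \<le> g w" using grid by fastforce
qed

lemma regular_point_of_low_sides:
  assumes f: "cadlag f" and grow: "\<And>y. \<bar>f y\<bar> \<le> 1 / 8 * y\<^sup>2 + B"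
    and pos: "0 < \<delta>" "0 < \<kappa>" "0 < \<delta>'" "0 < \<kappa>'"
    and R: "\<And>y. z + \<delta> \<le> y \<Longrightarrow> f y \<le> f z + (y - z - \<delta>)\<^sup>2 / 2 - \<kappa>"
    and L: "\<And>y. y \<le> z - \<delta>' \<Longrightarrow> f y \<le> f z + (z - y - \<delta>')\<^sup>2 / 2 - \<kappa>'"
    and ns: "\<And>p. \<not> (steep f (- 1) p \<and> side_max f 1 p)" "\<And>p. \<not> (steep f 1 p \<and> side_max f (- 1) p)"
  shows "\<exists>p. lagrangian_regular_point f p"
proof -
  define a where "a = z - \<delta>'"
  define b where "b = z + \<delta>"
  have ab: "a < z" "z < b" using pos by (auto simp: a_def b_def)
  obtain p where p: "p \<in> {a..b}" "\<And>w. w \<in> {a..b} \<Longrightarrow> ub f w \<le> ub f p"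
    using usc_attains_max[OF usc_ub[OF f], of a b] ab by auto
  have z: "f z \<le> ub f p" using p(2)[of z] ab le_ub[of f z] by auto
  have uR: "ub f y \<le> f z + (y - b)\<^sup>2 / 2 - \<kappa>" if "b < y" for y
  proof (rule ub_le[OF f _ that])
    show "f w \<le> f z + (w - b)\<^sup>2 / 2 - \<kappa>" if "b < w" for w
      using R[of w] that by (simp add: b_def diff_diff_eq)
  qed auto
  have uL: "ub f y \<le> f z + (a - y)\<^sup>2 / 2 - \<kappa>'" if "y \<le> a" for y
  proof (rule ub_le[OF f, where a = "y - 1"])
    show "f w \<le> f z + (a - w)\<^sup>2 / 2 - \<kappa>'" if "w \<le> y" for w
      using L[of w] that \<open>y \<le> a\<close> by (simp add: a_def algebra_simps)
  qed auto
  \<comment> \<open>The bound at \<open>a\<close> covers both the value and the left limit there, so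
    the left end cannot be the maximiser.\<close>
  have pa: "a < p" using uL[of p] z p(1) pos by (cases "p = a") auto
  have uniq: "lag_obj f p y < lag_obj f p p" if "y \<noteq> p" for y
  proof -
    consider "y \<in> {a..b}" | "b < y" | "y < a" by force
    then have "ub f y < ub f p + (y - p)\<^sup>2 / 2"
    proof cases
      case 1
      moreover have "0 < (y - p)\<^sup>2" using that by simp
      ultimately show ?thesis using p(2)[of y] by linarith
    next
      case 2
      then have "(y - b)\<^sup>2 \<le> (y - p)\<^sup>2" using p(1) by (intro power_mono) auto
      then show ?thesis using uR[OF 2] z pos by linarith
    next
      case 3
      then have "(a - y)\<^sup>2 \<le> (p - y)\<^sup>2" using p(1) by (intro power_mono) auto
      then show ?thesis using uL[of y] 3 z pos by (simp add: power2_commute[of y p])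
    qed
    then show ?thesis by (simp add: lag_obj_ub)
  qed
  have inside: "f y \<le> ub f p" if "a \<le> y" "y \<le> b" for y
    using p(2)[of y] that le_ub[of f y] by simp
  have "side_max f (- 1) p" unfolding side_max_def
    using pa p(1) by (intro exI[of _ "p - a"] conjI allI impI inside) auto
  moreover have "side_max f 1 p"
  proof (cases "p = b")
    case False
    then show ?thesis unfolding side_max_def
      using pa p(1) by (intro exI[of _ "b - p"] conjI allI impI inside) auto
  next
    \<comment> \<open>The right end can be the maximiser through its left limit if the path jumps
      down there. The value at \<open>b\<close> is below \<open>f z\<close>, and by right continuity
      so are the values just after it.\<close>
    case True
    have "f b < f z" using R[of b] pos by (simp add: b_def)
    from order_tendstoD(2)[OF cadlagD(1)[OF f] this] obtain c where c: "c > b" "\<forall>y>b. y < c \<longrightarrow> f y < f z"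
      unfolding eventually_at_right_field by blast
    have "f (b + t) \<le> ub f b" if "0 < t" "t < c - b" for t
    proof -
      have "f (b + t) < f z" using c(2) that by simp
      then show ?thesis using z True by simp
    qed
    then show ?thesis unfolding side_max_def True using c(1) by (intro exI[of _ "c - b"]) auto
  qed
  ultimately have "\<not> steep f (- 1) p" "\<not> steep f 1 p" using ns by blast+
  then show ?thesis using regular_point_of_unique_max[OF f grow uniq] by blast
qed

text \<open>From a centre \<open>x\<close> within \<open>\<delta> / 2\<close> of \<open>z\<close>, a
  point at distance \<open>t\<close> beyond the flat part is farther than
  \<open>t + \<delta> / 2\<close>, and the square of this sum absorbs the margin; within the flat
  part no point beats \<open>x\<close> itself.\<close>

lemma regular_point_of_flat_sides:
  assumes f: "cadlag f" and "0 < \<delta>"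
    and flat: "\<And>y. z - \<delta> \<le> y \<Longrightarrow> y \<le> z + \<delta> \<Longrightarrow> f y = f z"
    and R: "\<And>y. z + \<delta> < y \<Longrightarrow> f y \<le> f z + (y - z - \<delta>)\<^sup>2 / 2 + \<delta>\<^sup>2 / 8"
    and L: "\<And>y. y < z - \<delta> \<Longrightarrow> f y \<le> f z + (z - y - \<delta>)\<^sup>2 / 2 + \<delta>\<^sup>2 / 8"
  shows "lagrangian_regular_point f z"
proof (rule regular_point_in_flat_part)
  fix x assume x: "z - \<delta> / 2 < x" "x < z + \<delta> / 2"
  have flat_ub: "ub f y = f z" if "z - \<delta> < y" "y \<le> z + \<delta>" for y
  proof (rule antisym)
    show "ub f y \<le> f z"
    proof (rule ub_le[OF f, where g = "\<lambda>_. f z" and a = "z - \<delta>"])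
      fix w assume "z - \<delta> < w" "w \<le> y"
      then show "f w \<le> f z" using flat[of w] that by simp
    qed (use that in auto)
    show "f z \<le> ub f y" using le_ub[of f y] flat[of y] that by simp
  qed
  have sq: "t\<^sup>2 / 2 + \<delta>\<^sup>2 / 8 < (y - x)\<^sup>2 / 2" if "0 \<le> t" "t + \<delta> / 2 < \<bar>y - x\<bar>" for t y
  proof -
    have "(t + \<delta> / 2)\<^sup>2 < \<bar>y - x\<bar>\<^sup>2" using that \<open>0 < \<delta>\<close> by (intro power_strict_mono) auto
    moreover have "(t + \<delta> / 2)\<^sup>2 = t\<^sup>2 + t * \<delta> + \<delta>\<^sup>2 / 4" by (simp add: power2_eq_square field_simps)
    moreover have "0 \<le> t * \<delta>" using that \<open>0 < \<delta>\<close> by simp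
    ultimately show ?thesis by simp
  qed
  show "lag_a f x = x"
  proof (rule lag_a_eqI)
    fix y assume "y \<noteq> x"
    consider "z - \<delta> < y" "y \<le> z + \<delta>" | "z + \<delta> < y" | "y \<le> z - \<delta>" by linarith
    then have "ub f y < f z + (y - x)\<^sup>2 / 2"
    proof cases
      case 1
      then show ?thesis using flat_ub[of y] \<open>y \<noteq> x\<close> by simp
    next
      case 2
      have "ub f y \<le> f z + (y - z - \<delta>)\<^sup>2 / 2 + \<delta>\<^sup>2 / 8"
        by (rule ub_le[OF f _ 2]) (use R in auto)
      moreover have "(y - z - \<delta>)\<^sup>2 / 2 + \<delta>\<^sup>2 / 8 < (y - x)\<^sup>2 / 2" using 2 x by (intro sq) auto
      ultimately show ?thesis by linarith
    next
      case 3
      have "ub f y \<le> f z + (z - y - \<delta>)\<^sup>2 / 2 + \<delta>\<^sup>2 / 8"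
      proof (rule ub_le[OF f, where a = "y - 1"])
        fix w assume w: "w \<le> y"
        show "f w \<le> f z + (z - w - \<delta>)\<^sup>2 / 2 + \<delta>\<^sup>2 / 8"
          using L[of w] flat[of w] w 3 \<open>0 < \<delta>\<close> by (cases "w = z - \<delta>") auto
      qed auto
      moreover have "(z - y - \<delta>)\<^sup>2 / 2 + \<delta>\<^sup>2 / 8 < (y - x)\<^sup>2 / 2" using 3 x by (intro sq) auto
      ultimately show ?thesis by linarith
    qed
    then show "lag_obj f x y < lag_obj f x x" using flat_ub[of x] x \<open>0 < \<delta>\<close> by (simp add: lag_obj_ub)
  qed
qed (use \<open>0 < \<delta>\<close> in auto)

context levy
begin

lemma AE_growth_8: "AE \<omega> in M. \<exists>B. \<forall>y. \<bar>X \<omega> y\<bar> \<le> 1 / 8 * y\<^sup>2 + B"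
  using AE_quadratic_growth
proof eventually_elim
  case (elim \<omega>)
  then obtain B where "\<forall>x. \<bar>X \<omega> x\<bar> \<le> 1 / Suc 7 * x\<^sup>2 + B" by blast
  then show ?case by auto
qed

lemma AE_regular_point_flat:
  assumes pos: "prob (dyadic_stay (1 / 2 ^ r) (\<lambda>_. {0})) > 0"
  shows "AE \<omega> in M. \<exists>p. lagrangian_regular_point (X \<omega>) p"
proof -
  interpret neg: levy M "\<lambda>\<omega> x. - X \<omega> x" by (rule levy_uminus)
  define \<delta> :: real where "\<delta> = 1 / 2 ^ r"
  have \<delta>: "\<delta> > 0" by (simp add: \<delta>_def)
  have "neg.dyadic_stay (1 / 2 ^ r) (\<lambda>_. {0}) = dyadic_stay (1 / 2 ^ r) (\<lambda>_. {0})"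
    unfolding dyadic_stay_def neg.dyadic_stay_def by auto
  then have pos': "prob (neg.dyadic_stay (1 / 2 ^ r) (\<lambda>_. {0})) > 0" using pos by simp
  obtain c1 where c1: "c1 > 0" "\<And>m T. r \<le> m \<Longrightarrow> c1 \<le> stay_prob m T (flat_side \<delta>)"
    using prob_flat_side_lower[OF pos] unfolding \<delta>_def by blast
  obtain c2 where c2: "c2 > 0" "\<And>m T. r \<le> m \<Longrightarrow> c2 \<le> neg.stay_prob m T (flat_side \<delta>)"
    using neg.prob_flat_side_lower[OF pos'] unfolding \<delta>_def by blast
  have far: "{..s\<^sup>2 / 4} \<subseteq> flat_side \<delta> s" if s: "4 * \<delta> \<le> s" for s
  proof -
    have "(4 * \<delta>) * s \<le> s * s" using s \<delta> by (intro mult_right_mono) auto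
    moreover have "(s - \<delta>)\<^sup>2 / 2 + \<delta>\<^sup>2 / 8 = s\<^sup>2 / 4 + (s * s - (4 * \<delta>) * s) / 4 + 5 / 8 * (\<delta> * \<delta>)"
      by (simp add: power2_eq_square field_simps)
    moreover have "0 \<le> \<delta> * \<delta>" by simp
    ultimately have "s\<^sup>2 / 4 \<le> (s - \<delta>)\<^sup>2 / 2 + \<delta>\<^sup>2 / 8" by argo
    then show ?thesis using s \<delta> by (auto simp: flat_side_def)
  qed
  have "AE \<omega> in M. \<exists>z::nat. \<forall>m k. X \<omega> (real z + real k / 2 ^ m) - X \<omega> (real z) \<in> flat_side \<delta> (real k / 2 ^ m) \<and>
      X \<omega> (real z - real k / 2 ^ m) - X \<omega> (real z) \<in> flat_side \<delta> (real k / 2 ^ m)"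
  proof (rule AE_exists_good_centre[where c = "min c1 c2" and ?m0.0 = r and ?s0.0 = "4 * \<delta>"])
    show "min c1 c2 \<le> stay_prob m T (flat_side \<delta>)" if "r \<le> m" for m T
      by (rule min.coboundedI1[OF c1(2)[OF that]])
    show "min c1 c2 \<le> neg.stay_prob m T (flat_side \<delta>)" if "r \<le> m" for m T
      by (rule min.coboundedI2[OF c2(2)[OF that]])
  qed (use c1(1) c2(1) in \<open>simp_all add: far side_borel\<close>)
  then show ?thesis using cadlag
  proof eventually_elim
    case (elim \<omega>)
    let ?f = "X \<omega>"
    obtain z :: nat where z: "\<And>m k. ?f (real z + real k / 2 ^ m) - ?f (real z) \<in> flat_side \<delta> (real k / 2 ^ m)"
      "\<And>m k. ?f (real z - real k / 2 ^ m) - ?f (real z) \<in> flat_side \<delta> (real k / 2 ^ m)" using elim(1) by blast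
    have near: "?f y = ?f z" if y: "z - \<delta> \<le> y" "y \<le> z + \<delta>" for y
    proof -
      \<comment> \<open>Stated for a generic path so that it applies to the path and to its
        negative, which together give equality.\<close>
      have le: "h y \<le> h z" if h: "cadlag h"
        and fw: "\<And>m k. real k / 2 ^ m \<le> \<delta> \<Longrightarrow> h (real z + real k / 2 ^ m) = h z"
        and bw: "\<And>m k. real k / 2 ^ m \<le> \<delta> \<Longrightarrow> h (real z - real k / 2 ^ m) = h z" for h
      proof -
        \<comment> \<open>At the right end an approach from the right would leave the flat part, but
          \<open>z + \<delta>\<close> is itself a grid point.\<close>
        consider "y = z + \<delta>" | "z \<le> y" "y < z + \<delta>" | "y < z" using y by linarith
        then show ?thesis
        proof cases
          case 1
          then show ?thesis using fw[of 1 r] by (simp add: \<delta>_def)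
        next
          case 2
          then show ?thesis by (intro le_from_grid_fwd[OF h, of y "\<lambda>_. h z" z "z + \<delta>"]) (auto simp: fw)
        next
          case 3
          then show ?thesis using y by (intro le_from_grid_bwd[OF h, of y "\<lambda>_. h z" z z]) (auto simp: bw)
        qed
      qed
      have fw: "?f (real z + real k / 2 ^ m) = ?f z" if "real k / 2 ^ m \<le> \<delta>" for m k
        using z(1)[of k m] that by (simp add: flat_side_def)
      have bw: "?f (real z - real k / 2 ^ m) = ?f z" if "real k / 2 ^ m \<le> \<delta>" for m k
        using z(2)[of k m] that by (simp add: flat_side_def)
      have "?f y \<le> ?f z" by (rule le[OF elim(2)]) (auto simp: fw bw)
      moreover have "- ?f y \<le> - ?f z" by (rule le[OF cadlag_uminus(1)[OF elim(2)]]) (auto simp: fw bw)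
      ultimately show ?thesis by simp
    qed
    have "lagrangian_regular_point ?f z"
    proof (rule regular_point_of_flat_sides[OF elim(2) \<delta> near])
      fix y assume y: "real z + \<delta> < y"
      show "?f y \<le> ?f z + (y - z - \<delta>)\<^sup>2 / 2 + \<delta>\<^sup>2 / 8"
      proof (rule le_from_grid_fwd[OF elim(2), where z = z and c = "y + 1"])
        fix m k :: nat assume "y < real z + real k / 2 ^ m"
        then show "?f (real z + real k / 2 ^ m) \<le> ?f z + (real z + real k / 2 ^ m - z - \<delta>)\<^sup>2 / 2 + \<delta>\<^sup>2 / 8"
          using z(1)[of k m] y by (simp add: flat_side_def)
      qed (use y \<delta> in auto)
    next
      fix y assume y: "y < real z - \<delta>"
      show "?f y \<le> ?f z + (z - y - \<delta>)\<^sup>2 / 2 + \<delta>\<^sup>2 / 8"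
      proof (rule le_from_grid_bwd[OF elim(2), where z = z and c = "z - \<delta>"])
        fix m k :: nat assume "real z - real k / 2 ^ m < z - \<delta>"
        then show "?f (real z - real k / 2 ^ m) \<le> ?f z + (z - (real z - real k / 2 ^ m) - \<delta>)\<^sup>2 / 2 + \<delta>\<^sup>2 / 8"
          using z(2)[of k m] by (simp add: flat_side_def)
      qed (use y \<delta> in auto)
    qed
    then show ?case by blast
  qed
qed

text \<open>Low right sides come from regularity for the open lower half-line, low left sides from
  regularity for the upper one, because the path read leftwards has the law of \<open>- X\<close>;
  the constants of the two sides may differ.\<close>

lemma AE_regular_point_strict:
  assumes Q: "\<And>r. nonpos_prob r = 0"
    "\<And>r. levy.nonpos_prob M (\<lambda>\<omega> x. - X \<omega> x) r = 0"
  shows "AE \<omega> in M. \<exists>p. lagrangian_regular_point (X \<omega>) p"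
proof -
  interpret neg: levy M "\<lambda>\<omega> x. - X \<omega> x" by (rule levy_uminus)
  obtain j1 n1 \<delta> \<kappa> c1 m1 where \<delta>: "\<delta> = real j1 / 2 ^ n1" "\<delta> > 0" "\<kappa> > 0" "c1 > 0"
    and c1: "\<And>m T. m1 \<le> m \<Longrightarrow> c1 \<le> stay_prob m T (low_side \<delta> \<kappa>)"
    using prob_low_side_lower[OF Q(2)] by blast
  have Q1: "levy.nonpos_prob M (\<lambda>\<omega> x. - (- X \<omega> x)) r = 0" for r
    using Q(1) by simp
  obtain j2 n2 \<delta>' \<kappa>' c2 m2 where \<delta>': "\<delta>' = real j2 / 2 ^ n2" "\<delta>' > 0" "\<kappa>' > 0" "c2 > 0"
    and c2: "\<And>m T. m2 \<le> m \<Longrightarrow> c2 \<le> neg.stay_prob m T (low_side \<delta>' \<kappa>')"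
    using neg.prob_low_side_lower[OF Q1] by blast
  have far: "{..s\<^sup>2 / 4} \<subseteq> low_side d k s" if s: "4 * d + 4 * k + 1 \<le> s" and "0 < d" "0 < k" for s d k
  proof -
    have "(4 * d + 4 * k) * s \<le> s * s" using s that by (intro mult_right_mono) auto
    moreover have "4 * k * 1 \<le> 4 * k * s" using s that by (intro mult_left_mono) auto
    moreover have "(s - d)\<^sup>2 / 2 - k = s\<^sup>2 / 4 + (s * s - (4 * d + 4 * k) * s) / 4 + (4 * k * s - 4 * k * 1) / 4 + 1 / 2 * (d * d)"
      by (simp add: power2_eq_square field_simps)
    moreover have "0 \<le> d * d" by simp
    ultimately have "s\<^sup>2 / 4 \<le> (s - d)\<^sup>2 / 2 - k" by argo
    then show ?thesis using that by (auto simp: low_side_def)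
  qed
  have "AE \<omega> in M. \<exists>z::nat. \<forall>m k. X \<omega> (real z + real k / 2 ^ m) - X \<omega> (real z) \<in> low_side \<delta> \<kappa> (real k / 2 ^ m) \<and>
      X \<omega> (real z - real k / 2 ^ m) - X \<omega> (real z) \<in> low_side \<delta>' \<kappa>' (real k / 2 ^ m)"
  proof (rule AE_exists_good_centre[where c = "min c1 c2" and ?m0.0 = "max m1 m2" and ?s0.0 = "max (4 * \<delta> + 4 * \<kappa> + 1) (4 * \<delta>' + 4 * \<kappa>' + 1)"])
    show "0 < min c1 c2" using \<delta> \<delta>' by simp
    show "{..s\<^sup>2 / 4} \<subseteq> low_side \<delta> \<kappa> s" if "max (4 * \<delta> + 4 * \<kappa> + 1) (4 * \<delta>' + 4 * \<kappa>' + 1) \<le> s" for s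
      using that \<delta> by (intro far) auto
    show "{..s\<^sup>2 / 4} \<subseteq> low_side \<delta>' \<kappa>' s" if "max (4 * \<delta> + 4 * \<kappa> + 1) (4 * \<delta>' + 4 * \<kappa>' + 1) \<le> s" for s
      using that \<delta>' by (intro far) auto
    show "min c1 c2 \<le> stay_prob m T (low_side \<delta> \<kappa>)" if "max m1 m2 \<le> m" for m T
      using that by (intro min.coboundedI1 c1) simp
    show "min c1 c2 \<le> neg.stay_prob m T (low_side \<delta>' \<kappa>')" if "max m1 m2 \<le> m" for m T
      using that by (intro min.coboundedI2 c2) simp
  qed (simp_all add: side_borel)
  then show ?thesis using cadlag AE_growth_8 AE_no_left_steep_max[OF Q(1)] AE_no_right_steep_max[OF Q(2)]
  proof eventually_elim
    case (elim \<omega>)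
    let ?f = "X \<omega>"
    obtain z :: nat where z: "\<And>m k. ?f (real z + real k / 2 ^ m) - ?f (real z) \<in> low_side \<delta> \<kappa> (real k / 2 ^ m)"
      "\<And>m k. ?f (real z - real k / 2 ^ m) - ?f (real z) \<in> low_side \<delta>' \<kappa>' (real k / 2 ^ m)" using elim(1) by blast
    obtain B where grow: "\<And>y. \<bar>?f y\<bar> \<le> 1 / 8 * y\<^sup>2 + B" using elim(3) by blast
    show ?case
    proof (rule regular_point_of_low_sides[OF elim(2) grow \<delta>(2,3) \<delta>'(2,3), of "real z"])
      fix y assume y: "real z + \<delta> \<le> y"
      show "?f y \<le> ?f z + (y - z - \<delta>)\<^sup>2 / 2 - \<kappa>"
      proof (rule le_from_grid_fwd[OF elim(2), where z = z and c = "y + 1"])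
        fix m k :: nat assume "y < real z + real k / 2 ^ m"
        then show "?f (real z + real k / 2 ^ m) \<le> ?f z + (real z + real k / 2 ^ m - z - \<delta>)\<^sup>2 / 2 - \<kappa>"
          using z(1)[of k m] y by (simp add: low_side_def)
      qed (use y \<delta> in auto)
    next
      fix y assume y: "y \<le> real z - \<delta>'"
      show "?f y \<le> ?f z + (z - y - \<delta>')\<^sup>2 / 2 - \<kappa>'"
      \<comment> \<open>An approach to this point from the right would enter the gap, where nothing
        is controlled; since \<open>\<delta>'\<close> is dyadic, the point is a grid point and
        covered directly.\<close>
      proof (cases "y = z - \<delta>'")
        case True
        then show ?thesis using z(2)[of j2 n2] unfolding \<delta>'(1)[symmetric] by (simp add: low_side_def)
      next
        case False
        show ?thesis
        proof (rule le_from_grid_bwd[OF elim(2), where z = z and c = "z - \<delta>'"])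
          fix m k :: nat assume "real z - real k / 2 ^ m < z - \<delta>'"
          then show "?f (real z - real k / 2 ^ m) \<le> ?f z + (z - (real z - real k / 2 ^ m) - \<delta>')\<^sup>2 / 2 - \<kappa>'"
            using z(2)[of k m] by (simp add: low_side_def)
        qed (use y False \<delta>' in auto)
      qed
    qed (use elim(4,5) in auto)
  qed
qed

theorem AE_regular_point: "AE \<omega> in M. \<exists>p. lagrangian_regular_point (X \<omega>) p"
  using flat_or_strictly_regular AE_regular_point_flat AE_regular_point_strict by blast

end

theorem theorem4p9:
  fixes M :: "'a measure" and X :: "'a \<Rightarrow> real \<Rightarrow> real"
  assumes "two_sided_levy M X"
    and "AE \<omega> in M. bounded_variation (X \<omega>)"
    and "AE \<omega> in M. pure_jump (X \<omega>)"
    and "hypothesis_A M X"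
    and "regular_for M X {0..}"
    and "regular_for M X {..0}"
  shows "AE \<omega> in M. \<exists>p. lagrangian_regular_point (X \<omega>) p"
proof -
  interpret prob_space M using assms(1) by (simp add: two_sided_levy_def)
  interpret levy M X
    by unfold_locales
      (use assms in \<open>auto simp: two_sided_levy_def hypothesis_A_def regular_for_def\<close>)
  show ?thesis by (rule AE_regular_point)
qed

end
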